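(* Let $\mathfrak g$ be a simple complex Lie algebra and let $q\in\mathbb C^\times$ be not a root of unity. Then the Hopf center of the quantized enveloping algebra $U_q(\mathfrak g)$ is trivial: $\mathcal{HZ}(U_q(\mathfrak g))=\mathbb C$.
   Context: For a Hopf algebra $A$, the Hopf center $\mathcal{HZ}(A)$ is the largest Hopf subalgebra of $A$ contained in the center of the algebra $A$. Let $\mathfrak g$ have rank $\ell$, simple roots $\alpha_1,\dots,\alpha_\ell$, Cartan matrix $(a_{ij})$, and let $d_i=(\alpha_i,\alpha_i)/2$ for the invariant symmetric bilinear form normalized so that short roots have $(\alpha,\alpha)=2$; put $q_i=q^{d_i}$ (one assumes $q_i^2\neq1$). $U_q(\mathfrak g)$ is the complex algebra generated by $E_i,F_i,K_i^{\pm1}$, $1\le i\le\ell$, with relations: the $K_i$ are invertible and commute; $K_iE_jK_i^{-1}=q_i^{a_{ij}}E_j$; $K_iF_jK_i^{-1}=q_i^{-a_{ij}}F_j$; $[E_i,F_j]=\delta_{ij}\frac{K_i-K_i^{-1}}{q_i-q_i^{-1}}$; and the quantum Serre relations, for $i\ne j$, $$\sum_{r=0}^{1-a_{ij}}(-1)^r\begin{bmatrix}1-a_{ij}\\ r\end{bmatrix}_{q_i}E_i^{1-a_{ij}-r}E_jE_i^{r}=0,$$ and the same with $F$ in place of $E$ (symmetric Gaussian binomial coefficients). Its Hopf algebra structure has $K_i$ grouplike, $\Delta(E_i)=E_i\otimes K_i+1\otimes E_i$, $\Delta(F_i)=F_i\otimes1+K_i^{-1}\otimes F_i$. *)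

theory Defs
  imports Complex_Main "HOL-Library.Poly_Mapping"
begin

section \<open>Complex vector spaces and complex algebras\<close>

class scaleC =
  fixes scaleC :: "complex \<Rightarrow> 'a \<Rightarrow> 'a"  (infixr \<open>*\<^sub>C\<close> 75)

class complex_vector = scaleC + ab_group_add +
  assumes scaleC_add_right: "c *\<^sub>C (x + y) = c *\<^sub>C x + c *\<^sub>C y"
    and scaleC_add_left: "(c + d) *\<^sub>C x = c *\<^sub>C x + d *\<^sub>C x"
    and scaleC_scaleC: "c *\<^sub>C d *\<^sub>C x = (c * d) *\<^sub>C x"
    and scaleC_one: "1 *\<^sub>C x = x"

class complex_algebra_1 = complex_vector + ring_1 +
  assumes mult_scaleC_left: "(c *\<^sub>C x) * y = c *\<^sub>C (x * y)"
    and mult_scaleC_right: "x * (c *\<^sub>C y) = c *\<^sub>C (x * y)"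

instantiation complex :: complex_algebra_1
begin

definition scaleC_complex :: "complex \<Rightarrow> complex \<Rightarrow> complex"
  where "scaleC_complex c x = c * x"

instance
  by standard (simp_all add: scaleC_complex_def algebra_simps)

end

global_interpretation complex_vector: vector_space "scaleC :: complex \<Rightarrow> 'a \<Rightarrow> 'a::complex_vector"
  defines cspan = complex_vector.span
    and csubspace = complex_vector.subspace
  by standard (simp_all add: scaleC_add_right scaleC_add_left scaleC_scaleC scaleC_one)

abbreviation clinear :: "('a::complex_vector \<Rightarrow> 'b::complex_vector) \<Rightarrow> bool"
  where "clinear \<equiv> Vector_Spaces.linear scaleC scaleC"

definition cbilinear :: "('a::complex_vector \<Rightarrow> 'b::complex_vector \<Rightarrow> 'c::complex_vector) \<Rightarrow> bool"
  where "cbilinear \<beta> \<longleftrightarrow> (\<forall>x. clinear (\<beta> x)) \<and> (\<forall>y. clinear (\<lambda>x. \<beta> x y))"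

lemma clinear_iff:
  "clinear f \<longleftrightarrow> (\<forall>x y. f (x + y) = f x + f y) \<and> (\<forall>c x. f (c *\<^sub>C x) = c *\<^sub>C f x)"
  by (simp add: Vector_Spaces.linear_iff complex_vector.vector_space_axioms)


section \<open>Tensor products\<close>

text \<open>
  The tensor product of two complex vector spaces is the vector space on the pairs, modulo the
  bilinearity relations. The relations carry a coefficient \<open>c\<close>, so that the additive subgroup they
  generate is already a complex subspace.
\<close>

inductive_set tensor_null :: "('a::complex_vector \<times> 'b::complex_vector \<Rightarrow>\<^sub>0 complex) set"
  where
    zero: "0 \<in> tensor_null"
  | add_left: "Poly_Mapping.single (x + x', y) c - Poly_Mapping.single (x, y) c
      - Poly_Mapping.single (x', y) c \<in> tensor_null"
  | add_right: "Poly_Mapping.single (x, y + y') c - Poly_Mapping.single (x, y) c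
      - Poly_Mapping.single (x, y') c \<in> tensor_null"
  | scale_left: "Poly_Mapping.single (s *\<^sub>C x, y) c - Poly_Mapping.single (x, y) (s * c) \<in> tensor_null"
  | scale_right: "Poly_Mapping.single (x, s *\<^sub>C y) c - Poly_Mapping.single (x, y) (s * c) \<in> tensor_null"
  | diff: "p \<in> tensor_null \<Longrightarrow> r \<in> tensor_null \<Longrightarrow> p - r \<in> tensor_null"

lemma tensor_null_uminus: "p \<in> tensor_null \<Longrightarrow> - p \<in> tensor_null"
  using tensor_null.diff[OF tensor_null.zero] by force

lemma tensor_null_add: "p \<in> tensor_null \<Longrightarrow> r \<in> tensor_null \<Longrightarrow> p + r \<in> tensor_null"
  using tensor_null.diff[OF _ tensor_null_uminus] by force

definition pm_scale :: "complex \<Rightarrow> ('k \<Rightarrow>\<^sub>0 complex) \<Rightarrow> ('k \<Rightarrow>\<^sub>0 complex)"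
  where "pm_scale s = Poly_Mapping.map ((*) s)"

lemma lookup_pm_scale [simp]:
  "Poly_Mapping.lookup (pm_scale s p) k = s * Poly_Mapping.lookup p k"
  by (simp add: pm_scale_def map.rep_eq when_def)

lemma pm_scale_single [simp]:
  "pm_scale s (Poly_Mapping.single k c) = Poly_Mapping.single k (s * c)"
  by (rule poly_mapping_eqI) (simp add: lookup_single when_def)

lemma pm_scale_diff: "pm_scale s (p - r) = pm_scale s p - pm_scale s r"
  by (rule poly_mapping_eqI) (simp add: lookup_minus algebra_simps)

lemma tensor_null_pm_scale: "p \<in> tensor_null \<Longrightarrow> pm_scale s p \<in> tensor_null"
proof (induction rule: tensor_null.induct)
  case zero
  have "pm_scale s 0 = (0 :: 'a \<times> 'b \<Rightarrow>\<^sub>0 complex)"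
    by (rule poly_mapping_eqI) simp
  then show ?case by (simp add: tensor_null.zero)
next
  case (scale_left t x y c)
  then show ?case
    using tensor_null.scale_left[of t x y "s * c"] by (simp add: pm_scale_diff mult.left_commute)
next
  case (scale_right x t y c)
  then show ?case
    using tensor_null.scale_right[of x t y "s * c"] by (simp add: pm_scale_diff mult.left_commute)
qed (simp_all add: pm_scale_diff tensor_null.intros)

quotient_type (overloaded) ('a, 'b) tensor =
  "'a::complex_vector \<times> 'b::complex_vector \<Rightarrow>\<^sub>0 complex" / "\<lambda>p r. p - r \<in> tensor_null"
proof (rule equivpI)
  show "reflp (\<lambda>p r :: 'a \<times> 'b \<Rightarrow>\<^sub>0 complex. p - r \<in> tensor_null)"
    by (rule reflpI) (simp add: tensor_null.zero)
  show "symp (\<lambda>p r :: 'a \<times> 'b \<Rightarrow>\<^sub>0 complex. p - r \<in> tensor_null)"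
  proof (rule sympI)
    fix p r :: "'a \<times> 'b \<Rightarrow>\<^sub>0 complex"
    assume "p - r \<in> tensor_null"
    from tensor_null_uminus[OF this] show "r - p \<in> tensor_null" by simp
  qed
  show "transp (\<lambda>p r :: 'a \<times> 'b \<Rightarrow>\<^sub>0 complex. p - r \<in> tensor_null)"
  proof (rule transpI)
    fix p r s :: "'a \<times> 'b \<Rightarrow>\<^sub>0 complex"
    assume "p - r \<in> tensor_null" "r - s \<in> tensor_null"
    from tensor_null_add[OF this] show "p - s \<in> tensor_null" by simp
  qed
qed

instantiation tensor :: (complex_vector, complex_vector) complex_vector
begin

lift_definition zero_tensor :: "('a, 'b) tensor" is 0 .

lift_definition plus_tensor :: "('a, 'b) tensor \<Rightarrow> ('a, 'b) tensor \<Rightarrow> ('a, 'b) tensor" is "(+)"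
proof -
  fix p p' r r' :: "'a \<times> 'b \<Rightarrow>\<^sub>0 complex"
  assume "p - p' \<in> tensor_null" "r - r' \<in> tensor_null"
  then have "(p - p') + (r - r') \<in> tensor_null" by (rule tensor_null_add)
  then show "(p + r) - (p' + r') \<in> tensor_null" by (simp add: algebra_simps)
qed

lift_definition uminus_tensor :: "('a, 'b) tensor \<Rightarrow> ('a, 'b) tensor" is uminus
proof -
  fix p r :: "'a \<times> 'b \<Rightarrow>\<^sub>0 complex"
  assume "p - r \<in> tensor_null"
  from tensor_null_uminus[OF this] show "- p - - r \<in> tensor_null" by simp
qed

lift_definition minus_tensor :: "('a, 'b) tensor \<Rightarrow> ('a, 'b) tensor \<Rightarrow> ('a, 'b) tensor" is "(-)"
proof -
  fix p p' r r' :: "'a \<times> 'b \<Rightarrow>\<^sub>0 complex"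
  assume "p - p' \<in> tensor_null" "r - r' \<in> tensor_null"
  then have "(p - p') - (r - r') \<in> tensor_null" by (rule tensor_null.diff)
  then show "(p - r) - (p' - r') \<in> tensor_null" by (simp add: algebra_simps)
qed

lift_definition scaleC_tensor :: "complex \<Rightarrow> ('a, 'b) tensor \<Rightarrow> ('a, 'b) tensor" is pm_scale
  by (simp only: pm_scale_diff[symmetric] tensor_null_pm_scale)

instance
proof
  fix c d :: complex and x y z :: "('a, 'b) tensor"
  have eq: "p - r \<in> tensor_null" if "p = r" for p r :: "'a \<times> 'b \<Rightarrow>\<^sub>0 complex"
    using that by (simp add: tensor_null.zero)
  show "x + y + z = x + (y + z)" by transfer (rule eq, simp add: add.assoc)
  show "x + y = y + x" by transfer (rule eq, simp add: add.commute)
  show "0 + x = x" by transfer (rule eq, simp)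
  show "- x + x = 0" by transfer (rule eq, simp)
  show "x - y = x + - y" by transfer (rule eq, simp)
  show "c *\<^sub>C (x + y) = c *\<^sub>C x + c *\<^sub>C y"
    by transfer (rule eq, rule poly_mapping_eqI, simp add: lookup_add algebra_simps)
  show "(c + d) *\<^sub>C x = c *\<^sub>C x + d *\<^sub>C x"
    by transfer (rule eq, rule poly_mapping_eqI, simp add: lookup_add algebra_simps)
  show "c *\<^sub>C d *\<^sub>C x = (c * d) *\<^sub>C x"
    by transfer (rule eq, rule poly_mapping_eqI, simp)
  show "1 *\<^sub>C x = x"
    by transfer (rule eq, rule poly_mapping_eqI, simp)
qed

end

lift_definition pure_tensor :: "'a::complex_vector \<Rightarrow> 'b::complex_vector \<Rightarrow> ('a, 'b) tensor"
  (infixr \<open>\<boxtimes>\<close> 70)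
  is "\<lambda>x y. Poly_Mapping.single (x, y) 1" .

text \<open>
  The linear map on the tensor product induced by a bilinear map \<open>\<beta>\<close>. It is evaluated on an
  arbitrary representative; for bilinear \<open>\<beta>\<close> the choice does not matter, as shown below.
\<close>

definition tensor_eval ::
  "('a \<Rightarrow> 'b \<Rightarrow> 'c::complex_vector) \<Rightarrow> ('a \<times> 'b \<Rightarrow>\<^sub>0 complex) \<Rightarrow> 'c"
  where "tensor_eval \<beta> p =
    (\<Sum>k\<in>Poly_Mapping.keys p. Poly_Mapping.lookup p k *\<^sub>C \<beta> (fst k) (snd k))"

definition tensor_lift ::
  "('a::complex_vector \<Rightarrow> 'b::complex_vector \<Rightarrow> 'c::complex_vector) \<Rightarrow> ('a, 'b) tensor \<Rightarrow> 'c"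
  where "tensor_lift \<beta> t = tensor_eval \<beta> (rep_tensor t)"

lemma tensor_eval_superset:
  assumes "finite A" "Poly_Mapping.keys p \<subseteq> A"
  shows "tensor_eval \<beta> p = (\<Sum>k\<in>A. Poly_Mapping.lookup p k *\<^sub>C \<beta> (fst k) (snd k))"
  unfolding tensor_eval_def
  by (rule sum.mono_neutral_left) (use assms in \<open>auto simp: in_keys_iff\<close>)

lemma tensor_eval_add: "tensor_eval \<beta> (p + r) = tensor_eval \<beta> p + tensor_eval \<beta> r"
proof -
  let ?A = "Poly_Mapping.keys p \<union> Poly_Mapping.keys r"
  have "Poly_Mapping.keys (p + r) \<subseteq> ?A" by (rule keys_add)
  then show ?thesis
    by (simp add: tensor_eval_superset[of ?A] lookup_add scaleC_add_left sum.distrib)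
qed

lemma tensor_eval_diff: "tensor_eval \<beta> (p - r) = tensor_eval \<beta> p - tensor_eval \<beta> r"
  using tensor_eval_add[of \<beta> "p - r" r] by simp

lemma tensor_eval_single: "tensor_eval \<beta> (Poly_Mapping.single (x, y) c) = c *\<^sub>C \<beta> x y"
  by (cases "c = 0") (simp_all add: tensor_eval_def)

lemma tensor_eval_pm_scale: "tensor_eval \<beta> (pm_scale s p) = s *\<^sub>C tensor_eval \<beta> p"
proof -
  have "Poly_Mapping.keys (pm_scale s p) \<subseteq> Poly_Mapping.keys p"
    by (auto simp: in_keys_iff)
  then show ?thesis
    by (simp add: tensor_eval_superset[of "Poly_Mapping.keys p"] complex_vector.scale_sum_right)
qed

lemma tensor_eval_null:
  assumes "cbilinear \<beta>" "p \<in> tensor_null"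
  shows "tensor_eval \<beta> p = 0"
  using assms(2)
proof (induction rule: tensor_null.induct)
  case zero
  show ?case by (simp add: tensor_eval_def)
next
  case (add_left x x' y c)
  show ?case using assms(1)
    by (simp add: tensor_eval_diff tensor_eval_single cbilinear_def clinear_iff scaleC_add_right)
next
  case (add_right x y y' c)
  show ?case using assms(1)
    by (simp add: tensor_eval_diff tensor_eval_single cbilinear_def clinear_iff scaleC_add_right)
next
  case (scale_left s x y c)
  show ?case using assms(1)
    by (simp add: tensor_eval_diff tensor_eval_single cbilinear_def clinear_iff scaleC_scaleC
        mult.commute[of c])
next
  case (scale_right x s y c)
  show ?case using assms(1)
    by (simp add: tensor_eval_diff tensor_eval_single cbilinear_def clinear_iff scaleC_scaleC
        mult.commute[of c])
next
  case (diff p r)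
  then show ?case by (simp add: tensor_eval_diff)
qed

lemma tensor_lift_abs:
  assumes "cbilinear \<beta>"
  shows "tensor_lift \<beta> (abs_tensor p) = tensor_eval \<beta> p"
proof -
  have "rep_tensor (abs_tensor p) - p \<in> tensor_null"
    using Quotient3_rep_abs[OF Quotient3_tensor, of p] by (simp add: tensor_null.zero)
  from tensor_eval_null[OF assms this] show ?thesis
    by (simp add: tensor_lift_def tensor_eval_diff)
qed

lemma tensor_lift_pure [simp]: "cbilinear \<beta> \<Longrightarrow> tensor_lift \<beta> (x \<boxtimes> y) = \<beta> x y"
  unfolding pure_tensor.abs_eq by (simp only: tensor_lift_abs tensor_eval_single scaleC_one)

lemma clinear_tensor_lift:
  fixes \<beta> :: "'a::complex_vector \<Rightarrow> 'b::complex_vector \<Rightarrow> 'c::complex_vector"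
  assumes "cbilinear \<beta>"
  shows "clinear (tensor_lift \<beta>)"
  unfolding clinear_iff
proof (intro conjI allI)
  fix s t :: "('a, 'b) tensor" and c :: complex
  have "s = abs_tensor (rep_tensor s)" "t = abs_tensor (rep_tensor t)"
    by (rule Quotient3_abs_rep[OF Quotient3_tensor, symmetric])+
  then obtain p r where "s = abs_tensor p" "t = abs_tensor r" by blast
  then show "tensor_lift \<beta> (s + t) = tensor_lift \<beta> s + tensor_lift \<beta> t"
    and "tensor_lift \<beta> (c *\<^sub>C s) = c *\<^sub>C tensor_lift \<beta> s"
    by (simp_all only: plus_tensor.abs_eq scaleC_tensor.abs_eq tensor_lift_abs[OF assms]
        tensor_eval_add tensor_eval_pm_scale)
qed

lemma cbilinear_pure_tensor: "cbilinear (\<boxtimes>)"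
  unfolding cbilinear_def clinear_iff
proof (intro conjI allI)
  fix x x' :: 'a and y y' :: 'b and c :: complex
  show "x \<boxtimes> (y + y') = x \<boxtimes> y + x \<boxtimes> y'"
    by transfer (use tensor_null.add_right in \<open>simp add: diff_diff_add\<close>)
  show "(x + x') \<boxtimes> y = x \<boxtimes> y + x' \<boxtimes> y"
    by transfer (use tensor_null.add_left in \<open>simp add: diff_diff_add\<close>)
  show "x \<boxtimes> (c *\<^sub>C y) = c *\<^sub>C (x \<boxtimes> y)"
    by transfer (use tensor_null.scale_right[of _ _ _ 1] in simp)
  show "(c *\<^sub>C x) \<boxtimes> y = c *\<^sub>C (x \<boxtimes> y)"
    by transfer (use tensor_null.scale_left[of _ _ _ 1] in simp)
qed


section \<open>Hopf algebras and the Hopf center\<close>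

definition tensor_mult ::
  "('a, 'b) tensor \<Rightarrow> ('a, 'b) tensor \<Rightarrow> ('a::complex_algebra_1, 'b::complex_algebra_1) tensor"
  where "tensor_mult s t =
    tensor_lift (\<lambda>a b. tensor_lift (\<lambda>a' b'. (a * a') \<boxtimes> (b * b')) t) s"

text \<open>
  In \<open>coassoc\<close> both sides are taken in \<open>A \<otimes> (A \<otimes> A)\<close>: the left-hand side is
  \<open>(\<Delta> \<otimes> id) \<circ> \<Delta>\<close> followed by reassociation.
\<close>

locale hopf_algebra =
  fixes \<Delta> :: "'a::complex_algebra_1 \<Rightarrow> ('a, 'a) tensor"
    and \<epsilon> :: "'a \<Rightarrow> complex"
    and S :: "'a \<Rightarrow> 'a"
  assumes linear_comult: "clinear \<Delta>"
    and comult_one: "\<Delta> 1 = 1 \<boxtimes> 1"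
    and comult_mult: "\<Delta> (x * y) = tensor_mult (\<Delta> x) (\<Delta> y)"
    and linear_counit: "clinear \<epsilon>"
    and counit_one: "\<epsilon> 1 = 1"
    and counit_mult: "\<epsilon> (x * y) = \<epsilon> x * \<epsilon> y"
    and linear_antipode: "clinear S"
    and coassoc: "tensor_lift (\<lambda>a b. tensor_lift (\<lambda>a' a''. a' \<boxtimes> (a'' \<boxtimes> b)) (\<Delta> a)) (\<Delta> x)
      = tensor_lift (\<lambda>a b. a \<boxtimes> \<Delta> b) (\<Delta> x)"
    and counit_left: "tensor_lift (\<lambda>a b. \<epsilon> a *\<^sub>C b) (\<Delta> x) = x"
    and counit_right: "tensor_lift (\<lambda>a b. \<epsilon> b *\<^sub>C a) (\<Delta> x) = x"
    and antipode_left: "tensor_lift (\<lambda>a b. S a * b) (\<Delta> x) = \<epsilon> x *\<^sub>C 1"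
    and antipode_right: "tensor_lift (\<lambda>a b. a * S b) (\<Delta> x) = \<epsilon> x *\<^sub>C 1"

definition hopf_subalgebra ::
  "('a::complex_algebra_1 \<Rightarrow> ('a, 'a) tensor) \<Rightarrow> ('a \<Rightarrow> 'a) \<Rightarrow> 'a set \<Rightarrow> bool"
  where "hopf_subalgebra \<Delta> S H \<longleftrightarrow>
    csubspace H \<and> 1 \<in> H \<and> (\<forall>x\<in>H. \<forall>y\<in>H. x * y \<in> H) \<and>
    (\<forall>x\<in>H. \<Delta> x \<in> cspan {a \<boxtimes> b | a b. a \<in> H \<and> b \<in> H}) \<and>
    (\<forall>x\<in>H. S x \<in> H)"

definition algebra_center :: "'a::complex_algebra_1 set"
  where "algebra_center = {z. \<forall>x. z * x = x * z}"

definition hopf_center ::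
  "('a::complex_algebra_1 \<Rightarrow> ('a, 'a) tensor) \<Rightarrow> ('a \<Rightarrow> 'a) \<Rightarrow> 'a set"
  where "hopf_center \<Delta> S = (GREATEST H. hopf_subalgebra \<Delta> S H \<and> H \<subseteq> algebra_center)"


section \<open>Simple complex Lie algebras and their root data\<close>

definition lie_bracket :: "('g::complex_vector \<Rightarrow> 'g \<Rightarrow> 'g) \<Rightarrow> bool"
  where "lie_bracket br \<longleftrightarrow> cbilinear br \<and> (\<forall>x. br x x = 0) \<and>
    (\<forall>x y z. br x (br y z) + br y (br z x) + br z (br x y) = 0)"

definition lie_ideal :: "('g::complex_vector \<Rightarrow> 'g \<Rightarrow> 'g) \<Rightarrow> 'g set \<Rightarrow> bool"
  where "lie_ideal br J \<longleftrightarrow> csubspace J \<and> (\<forall>x. \<forall>y\<in>J. br x y \<in> J)"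

definition simple_lie_algebra :: "('g::complex_vector \<Rightarrow> 'g \<Rightarrow> 'g) \<Rightarrow> bool"
  where "simple_lie_algebra br \<longleftrightarrow>
    lie_bracket br \<and> (\<exists>B. finite B \<and> cspan B = (UNIV :: 'g set)) \<and>
    (\<exists>x y. br x y \<noteq> 0) \<and> (\<forall>J. lie_ideal br J \<longrightarrow> J = {0} \<or> J = UNIV)"

text \<open>
  Cartan subalgebras of a semisimple Lie algebra: self-centralizing commutative subalgebras whose
  elements act diagonalizably in the adjoint representation.
\<close>

definition cartan_subalgebra :: "('g::complex_vector \<Rightarrow> 'g \<Rightarrow> 'g) \<Rightarrow> 'g set \<Rightarrow> bool"
  where "cartan_subalgebra br \<hh> \<longleftrightarrow>
    csubspace \<hh> \<and> (\<forall>x\<in>\<hh>. \<forall>y\<in>\<hh>. br x y = 0) \<and>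
    (\<forall>x. (\<forall>y\<in>\<hh>. br y x = 0) \<longrightarrow> x \<in> \<hh>) \<and>
    (\<forall>y\<in>\<hh>. cspan {x. \<exists>c. br y x = c *\<^sub>C x} = UNIV)"

text \<open>
  A functional on \<open>\<hh>\<close> is represented by any function on \<open>\<gg>\<close> with the given values on \<open>\<hh>\<close>; only
  these values are ever used. A weight with nonzero weight space is automatically linear on \<open>\<hh>\<close>.
\<close>

definition root_space ::
  "('g::complex_vector \<Rightarrow> 'g \<Rightarrow> 'g) \<Rightarrow> 'g set \<Rightarrow> ('g \<Rightarrow> complex) \<Rightarrow> 'g set"
  where "root_space br \<hh> \<chi> = {x. \<forall>y\<in>\<hh>. br y x = \<chi> y *\<^sub>C x}"

definition is_root ::
  "('g::complex_vector \<Rightarrow> 'g \<Rightarrow> 'g) \<Rightarrow> 'g set \<Rightarrow> ('g \<Rightarrow> complex) \<Rightarrow> bool"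
  where "is_root br \<hh> \<chi> \<longleftrightarrow> (\<exists>y\<in>\<hh>. \<chi> y \<noteq> 0) \<and> root_space br \<hh> \<chi> \<noteq> {0}"

definition simple_roots ::
  "('g::complex_vector \<Rightarrow> 'g \<Rightarrow> 'g) \<Rightarrow> 'g set \<Rightarrow> ('i::finite \<Rightarrow> 'g \<Rightarrow> complex) \<Rightarrow> bool"
  where "simple_roots br \<hh> \<alpha> \<longleftrightarrow>
    (\<forall>i. is_root br \<hh> (\<alpha> i)) \<and>
    (\<forall>c :: 'i \<Rightarrow> complex. (\<forall>y\<in>\<hh>. (\<Sum>i\<in>UNIV. c i * \<alpha> i y) = 0) \<longrightarrow> (\<forall>i. c i = 0)) \<and>
    (\<forall>\<beta>. is_root br \<hh> \<beta> \<longrightarrow>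
      (\<exists>n :: 'i \<Rightarrow> int. (\<forall>y\<in>\<hh>. \<beta> y = (\<Sum>i\<in>UNIV. of_int (n i) * \<alpha> i y)) \<and>
        ((\<forall>i. n i \<ge> 0) \<or> (\<forall>i. n i \<le> 0))))"

definition invariant_form ::
  "('g::complex_vector \<Rightarrow> 'g \<Rightarrow> 'g) \<Rightarrow> ('g \<Rightarrow> 'g \<Rightarrow> complex) \<Rightarrow> bool"
  where "invariant_form br B \<longleftrightarrow> cbilinear B \<and> (\<forall>x y. B x y = B y x) \<and>
    (\<forall>x y z. B (br x y) z = B x (br y z)) \<and> (\<forall>x. (\<forall>y. B x y = 0) \<longrightarrow> x = 0)"

text \<open>The bilinear form on the dual of \<open>\<hh>\<close> induced by a form that is nondegenerate on \<open>\<hh>\<close>.\<close>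

definition dual_form ::
  "'g set \<Rightarrow> ('g \<Rightarrow> 'g \<Rightarrow> complex) \<Rightarrow> ('g \<Rightarrow> complex) \<Rightarrow> ('g \<Rightarrow> complex) \<Rightarrow> complex"
  where "dual_form \<hh> B \<chi> \<mu> =
    (let t = (\<lambda>\<nu>. THE t. t \<in> \<hh> \<and> (\<forall>y\<in>\<hh>. B t y = \<nu> y)) in B (t \<chi>) (t \<mu>))"

text \<open>
  The square lengths of the roots are real, and the least of them (attained by the short roots) is 2;
  in the simply laced case all roots count as short.
\<close>

definition normalized_invariant_form ::
  "('g::complex_vector \<Rightarrow> 'g \<Rightarrow> 'g) \<Rightarrow> 'g set \<Rightarrow> ('g \<Rightarrow> 'g \<Rightarrow> complex) \<Rightarrow> bool"
  where "normalized_invariant_form br \<hh> B \<longleftrightarrow> invariant_form br B \<and>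
    (\<exists>\<beta>. is_root br \<hh> \<beta> \<and> dual_form \<hh> B \<beta> \<beta> = 2) \<and>
    (\<forall>\<beta>. is_root br \<hh> \<beta> \<longrightarrow> (\<exists>r\<ge>2. dual_form \<hh> B \<beta> \<beta> = complex_of_real r))"


section \<open>Algebras given by generators and relations\<close>

datatype 's free_word = Word "'s list"

instantiation free_word :: (type) monoid_add
begin

definition zero_free_word :: "'a free_word"
  where "0 = Word []"

fun plus_free_word :: "'a free_word \<Rightarrow> 'a free_word \<Rightarrow> 'a free_word"
  where "Word u + Word v = Word (u @ v)"

instance
proof
  fix a b c :: "'a free_word"
  show "a + b + c = a + (b + c)" by (cases a; cases b; cases c) simp
  show "0 + a = a" by (cases a) (simp add: zero_free_word_def)
  show "a + 0 = a" by (cases a) (simp add: zero_free_word_def)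
qed

end

text \<open>
  The free algebra is the monoid algebra of the free monoid (written additively, with concatenation
  as addition); its multiplication is the convolution product of \<^type>\<open>poly_mapping\<close>.
\<close>

type_synonym 's free_alg = "'s free_word \<Rightarrow>\<^sub>0 complex"

definition fa_var :: "'s \<Rightarrow> 's free_alg"
  where "fa_var s = Poly_Mapping.single (Word [s]) 1"

definition fa_const :: "complex \<Rightarrow> 's free_alg"
  where "fa_const c = Poly_Mapping.single 0 c"

inductive_set ideal_generated :: "'r::ring_1 set \<Rightarrow> 'r set" for R :: "'r set"
  where
    zero: "0 \<in> ideal_generated R"
  | rel: "x \<in> R \<Longrightarrow> x \<in> ideal_generated R"
  | diff: "x \<in> ideal_generated R \<Longrightarrow> y \<in> ideal_generated R \<Longrightarrow> x - y \<in> ideal_generated R"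
  | mult: "x \<in> ideal_generated R \<Longrightarrow> a * x * b \<in> ideal_generated R"

primrec word_eval :: "('s \<Rightarrow> 'u::complex_algebra_1) \<Rightarrow> 's free_word \<Rightarrow> 'u"
  where "word_eval g (Word w) = prod_list (map g w)"

definition fa_eval :: "('s \<Rightarrow> 'u::complex_algebra_1) \<Rightarrow> 's free_alg \<Rightarrow> 'u"
  where "fa_eval g p = (\<Sum>w\<in>Poly_Mapping.keys p. Poly_Mapping.lookup p w *\<^sub>C word_eval g w)"

text \<open>
  The algebra \<open>'u\<close> is presented by the generators \<open>g\<close> and the relations \<open>R\<close>: the evaluation map
  from the free algebra is onto and its kernel is the two-sided ideal generated by \<open>R\<close>.
\<close>

definition presented_by :: "('s \<Rightarrow> 'u::complex_algebra_1) \<Rightarrow> 's free_alg set \<Rightarrow> bool"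
  where "presented_by g R \<longleftrightarrow>
    range (fa_eval g) = UNIV \<and> {p. fa_eval g p = 0} = ideal_generated R"


section \<open>Quantized enveloping algebras\<close>

definition q_int :: "complex \<Rightarrow> nat \<Rightarrow> complex"
  where "q_int v n = (v ^ n - inverse v ^ n) / (v - inverse v)"

definition q_fact :: "complex \<Rightarrow> nat \<Rightarrow> complex"
  where "q_fact v n = (\<Prod>k=1..n. q_int v k)"

definition q_binom :: "complex \<Rightarrow> nat \<Rightarrow> nat \<Rightarrow> complex"
  where "q_binom v n k = q_fact v n / (q_fact v k * q_fact v (n - k))"

definition serre_element :: "complex \<Rightarrow> nat \<Rightarrow> 's free_alg \<Rightarrow> 's free_alg \<Rightarrow> 's free_alg"
  where "serre_element v m x y =
    (\<Sum>r=0..m. fa_const ((-1) ^ r * q_binom v m r) * x ^ (m - r) * y * x ^ r)"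

text \<open>The generators \<open>GKinv i\<close> stand for the inverses of the \<open>K\<^sub>i\<close>.\<close>

datatype 'i uq_gen = GE 'i | GF 'i | GK 'i | GKinv 'i

definition uq_relations ::
  "complex \<Rightarrow> ('i \<Rightarrow> nat) \<Rightarrow> ('i \<Rightarrow> 'i \<Rightarrow> int) \<Rightarrow> 'i uq_gen free_alg set"
  where "uq_relations q d a =
    (let E = (\<lambda>i. fa_var (GE i)); F = (\<lambda>i. fa_var (GF i));
         K = (\<lambda>i. fa_var (GK i)); K' = (\<lambda>i. fa_var (GKinv i));
         qi = (\<lambda>i. q ^ d i)
     in {K i * K' i - 1 | i. True} \<union> {K' i * K i - 1 | i. True}
      \<union> {K i * K j - K j * K i | i j. True}
      \<union> {K i * E j * K' i - fa_const (qi i powi a i j) * E j | i j. True}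
      \<union> {K i * F j * K' i - fa_const (qi i powi (- a i j)) * F j | i j. True}
      \<union> {E i * F i - F i * E i - fa_const (1 / (qi i - inverse (qi i))) * (K i - K' i) | i. True}
      \<union> {E i * F j - F j * E i | i j. i \<noteq> j}
      \<union> {serre_element (qi i) (nat (1 - a i j)) (E i) (E j) | i j. i \<noteq> j}
      \<union> {serre_element (qi i) (nat (1 - a i j)) (F i) (F j) | i j. i \<noteq> j})"

definition quantized_enveloping_algebra ::
  "complex \<Rightarrow> ('i \<Rightarrow> nat) \<Rightarrow> ('i \<Rightarrow> 'i \<Rightarrow> int) \<Rightarrow>
    ('i \<Rightarrow> 'u::complex_algebra_1) \<Rightarrow> ('i \<Rightarrow> 'u) \<Rightarrow> ('i \<Rightarrow> 'u) \<Rightarrow> ('i \<Rightarrow> 'u) \<Rightarrow> bool"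
  where "quantized_enveloping_algebra q d a E F K Kinv \<longleftrightarrow>
    presented_by (case_uq_gen E F K Kinv) (uq_relations q d a)"

end

theory Submission
  imports Defs
begin

text \<open>
  Let \<open>z\<close> lie in a central Hopf subalgebra, so that the first tensor factors of \<open>\<Delta> z\<close> can be taken
  central and hence of weight zero. Write \<open>z\<close> as a combination of monomials \<open>F\<^sub>v K\<^sub>\<nu> E\<^sub>w\<close> with \<open>v\<close> of
  length at most \<open>n\<close>. If \<open>n > 0\<close>, the component of \<open>\<Delta> z\<close> whose first factor has height \<open>- n\<close> is both
  zero and equal to the corresponding combination of the \<open>F\<^sub>v K\<^sub>\<nu> \<otimes> K\<^sub>\<nu> E\<^sub>w\<close> with \<open>v\<close> of length \<open>n\<close>,
  so these monomials cancel. Therefore \<open>z\<close> is a combination of the \<open>K\<^sub>\<nu> E\<^sub>w\<close>, by weight of the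
  \<open>K\<^sub>\<nu>\<close> alone, and by the grouplike property of those \<open>K\<^sub>\<nu>\<close> that are themselves central; only
  \<open>K\<^sub>0 = 1\<close> is, because the symmetrized Cartan matrix is nondegenerate and \<open>q\<close> is not a root of unity.

  No triangular decomposition is needed, only that the \<open>K\<^sub>\<nu>\<close> can be separated by linear functionals
  and that \<open>E\<^sub>i \<noteq> 0\<close>. Both follow from highest weight modules with arbitrary highest weight.
\<close>

section \<open>Linear maps and joint eigenspaces\<close>

text \<open>The obstacle is that the monomials F_v K_\<nu> E_w are only known to span, so
  coefficients of z cannot be compared. Instead, linear maps defined on the whole algebra are
  applied: their values on monomials are computable, and relations among monomials do no harm.
  Height, the coordinate sum of a weight in the root lattice, is well defined because distinct
  lattice weights give distinct characters of the K_i, for the same reason that only K_0 is central.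

  The highest weight modules live on functions on words in the F_i, where the Serre relations in the
  F_i fail. Instead of forming a quotient, one reads off the coefficient of the highest weight
  vector, to which the defining ideal contributes nothing.

  The Lie algebra enters through the matrix of the (\<alpha>_i, \<alpha>_j) = d_i a_ij, which is
  symmetric and nondegenerate with d_i > 0, and through a_ij <= 0 off the diagonal, which makes each
  Serre exponent 1 - a_ij positive and is proved with sl_2-strings.\<close>

lemma clinearI:
  "(\<And>x y. f (x + y) = f x + f y) \<Longrightarrow> (\<And>c x. f (c *\<^sub>C x) = c *\<^sub>C f x) \<Longrightarrow> clinear f"
  by (simp add: clinear_iff)

lemma clinear_add: "clinear f \<Longrightarrow> f (x + y) = f x + f y"
  and clinear_scale: "clinear f \<Longrightarrow> f (c *\<^sub>C x) = c *\<^sub>C f x"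
  by (simp_all add: clinear_iff)

lemmas scaleC_zero_left = complex_vector.scale_zero_left
  and scaleC_zero_right = complex_vector.scale_zero_right
  and scaleC_minus_left = complex_vector.scale_minus_left
  and scaleC_diff_left = complex_vector.scale_left_diff_distrib
  and scaleC_diff_right = complex_vector.scale_right_diff_distrib

lemma clinear_zero: "clinear f \<Longrightarrow> f 0 = 0"
  using clinear_scale[of f 0 0] by simp

lemma clinear_minus: "clinear f \<Longrightarrow> f (- x) = - f x"
  using clinear_scale[of f "-1" x] by (simp add: scaleC_minus_left scaleC_one)

lemma clinear_diff: "clinear f \<Longrightarrow> f (x - y) = f x - f y"
  using clinear_add[of f x "- y"] by (simp add: clinear_minus)

lemma clinear_sum: "clinear f \<Longrightarrow> f (\<Sum>i\<in>A. g i) = (\<Sum>i\<in>A. f (g i))"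
  by (induction A rule: infinite_finite_induct) (simp_all add: clinear_zero clinear_add)

lemmas clinear_simps = clinear_add clinear_scale clinear_zero clinear_minus clinear_diff

lemma clinear_id: "clinear (\<lambda>x. x)"
  and clinear_const_zero: "clinear (\<lambda>x. 0)"
  and clinear_compose: "clinear f \<Longrightarrow> clinear g \<Longrightarrow> clinear (\<lambda>x. f (g x))"
  and clinear_compose_add: "clinear f \<Longrightarrow> clinear h \<Longrightarrow> clinear (\<lambda>x. f x + h x)"
  and clinear_compose_diff: "clinear f \<Longrightarrow> clinear h \<Longrightarrow> clinear (\<lambda>x. f x - h x)"
  and clinear_compose_scale: "clinear f \<Longrightarrow> clinear (\<lambda>x. c *\<^sub>C f x)"
  by (simp_all add: clinear_iff scaleC_add_right scaleC_diff_right scaleC_scaleC mult.commute)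

lemma clinear_compose_sum: "(\<And>i. i \<in> A \<Longrightarrow> clinear (f i)) \<Longrightarrow> clinear (\<lambda>x. \<Sum>i\<in>A. f i x)"
  by (simp add: clinear_iff sum.distrib complex_vector.scale_sum_right)

lemma clinear_mult_left: "clinear (\<lambda>x. a * x)"
  and clinear_mult_right: "clinear (\<lambda>x. x * a)" for a :: "'a::complex_algebra_1"
  by (simp_all add: clinear_iff distrib_left distrib_right mult_scaleC_left mult_scaleC_right)

lemma csubspace_clinear_vimage:
  assumes "clinear f" "csubspace M" shows "csubspace {x. f x \<in> M}"
  using assms by (auto simp: complex_vector.subspace_def clinear_simps)

lemma clinear_span_image_subset:
  assumes "clinear f" "csubspace M" "\<And>x. x \<in> X \<Longrightarrow> f x \<in> M" "x \<in> cspan X"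
  shows "f x \<in> M"
  using complex_vector.span_minimal[OF _ csubspace_clinear_vimage[OF assms(1,2)], of X] assms(3,4)
  by auto

lemma clinear_eq_on_span:
  assumes "clinear f" "clinear g" "\<And>x. x \<in> X \<Longrightarrow> f x = g x" "x \<in> cspan X"
  shows "f x = g x"
  using clinear_span_image_subset[of "\<lambda>x. f x - g x" "{0}" X x] assms
  by (simp add: clinear_compose_diff complex_vector.subspace_single_0)

text \<open>With an arbitrary index set this covers root spaces under \<open>br\<close>, eigenspaces
  of a single operator, and weight spaces under conjugation by the K_i.\<close>

definition joint_eigenspace ::
  "('k \<Rightarrow> 'v::complex_vector \<Rightarrow> 'v) \<Rightarrow> 'k set \<Rightarrow> ('k \<Rightarrow> complex) \<Rightarrow> 'v set"
  where "joint_eigenspace A Y \<chi> = {x. \<forall>k\<in>Y. A k x = \<chi> k *\<^sub>C x}"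

lemma csubspace_joint_eigenspace:
  assumes "\<And>k. k \<in> Y \<Longrightarrow> clinear (A k)"
  shows "csubspace (joint_eigenspace A Y \<chi>)"
  using assms
  by (auto simp: complex_vector.subspace_def joint_eigenspace_def clinear_simps scaleC_add_right
      scaleC_scaleC mult.commute)

text \<open>Lagrange interpolation: \<open>P\<close> composes the factors (A_k - \<chi> k) /
  (\<chi>0 k - \<chi> k), with one separating index k chosen for each \<chi> in \<open>X\<close>.
  Being a polynomial in the operators, it preserves every subspace that they all preserve; this is
  the last clause.\<close>

lemma eigenspace_interpolation:
  assumes lin: "\<And>k. k \<in> Y \<Longrightarrow> clinear (A k)"
    and "finite X" and "\<And>\<chi>. \<chi> \<in> X \<Longrightarrow> \<exists>k\<in>Y. \<chi> k \<noteq> \<chi>0 k"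
  obtains P where "clinear P" "\<And>x. x \<in> joint_eigenspace A Y \<chi>0 \<Longrightarrow> P x = x"
    "\<And>\<chi> x. \<chi> \<in> X \<Longrightarrow> x \<in> joint_eigenspace A Y \<chi> \<Longrightarrow> P x = 0"
    "\<And>M x. csubspace M \<Longrightarrow> (\<And>k y. k \<in> Y \<Longrightarrow> y \<in> M \<Longrightarrow> A k y \<in> M) \<Longrightarrow> x \<in> M \<Longrightarrow> P x \<in> M"
  using assms(2,3)
proof (induction X arbitrary: thesis rule: finite_induct)
  case empty
  show ?case by (rule empty(1)[of "\<lambda>x. x"]) (simp_all add: clinear_id)
next
  case (insert \<chi> X)
  obtain P where P: "clinear P" "\<And>x. x \<in> joint_eigenspace A Y \<chi>0 \<Longrightarrow> P x = x"
    "\<And>\<chi> x. \<chi> \<in> X \<Longrightarrow> x \<in> joint_eigenspace A Y \<chi> \<Longrightarrow> P x = 0"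
    "\<And>M x. csubspace M \<Longrightarrow> (\<And>k y. k \<in> Y \<Longrightarrow> y \<in> M \<Longrightarrow> A k y \<in> M) \<Longrightarrow> x \<in> M \<Longrightarrow> P x \<in> M"
    using insert.IH insert.prems(2) by blast
  obtain k where k: "k \<in> Y" "\<chi> k \<noteq> \<chi>0 k" using insert.prems(2) by blast
  define Q where "Q x = (1 / (\<chi>0 k - \<chi> k)) *\<^sub>C (A k x - \<chi> k *\<^sub>C x)" for x
  have linQ: "clinear Q"
    unfolding Q_def
    by (intro clinear_compose_scale clinear_compose_diff clinear_id lin k)
  have Q_eig: "Q x = ((\<eta> k - \<chi> k) / (\<chi>0 k - \<chi> k)) *\<^sub>C x" if "x \<in> joint_eigenspace A Y \<eta>" for \<eta> x
    using that k by (simp add: joint_eigenspace_def Q_def scaleC_diff_left[symmetric] scaleC_scaleC)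
  show ?case
  proof (rule insert.prems(1)[of "\<lambda>x. P (Q x)"])
    show "clinear (\<lambda>x. P (Q x))" by (rule clinear_compose[OF P(1) linQ])
    show "P (Q x) = x" if "x \<in> joint_eigenspace A Y \<chi>0" for x
      using Q_eig[OF that] P(2)[OF that] k by (simp add: scaleC_one)
    show "P (Q x) = 0" if "\<eta> \<in> insert \<chi> X" "x \<in> joint_eigenspace A Y \<eta>" for \<eta> x
    proof (cases "\<eta> = \<chi>")
      case True
      then show ?thesis using Q_eig[OF that(2)] by (simp add: clinear_zero[OF P(1)])
    next
      case False
      then have "P x = 0" using P(3) that by blast
      then show ?thesis using Q_eig[OF that(2)] by (simp add: clinear_scale[OF P(1)])
    qed
    show "P (Q x) \<in> M"
      if "csubspace M" "\<And>k y. k \<in> Y \<Longrightarrow> y \<in> M \<Longrightarrow> A k y \<in> M" "x \<in> M" for M x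
      by (rule P(4)[OF that(1,2)])
        (use that k in \<open>simp_all add: Q_def complex_vector.subspace_scale complex_vector.subspace_diff\<close>)
  qed
qed

lemma direct_sum_projection:
  assumes "csubspace M" "csubspace N" "\<And>x. x \<in> M \<Longrightarrow> x \<in> N \<Longrightarrow> x = 0"
    and "\<And>x. \<exists>m\<in>M. \<exists>n\<in>N. x = m + n"
  obtains P where "clinear P" "\<And>x. x \<in> M \<Longrightarrow> P x = x" "\<And>x. x \<in> N \<Longrightarrow> P x = 0"
proof -
  have uniq: "m = m'" if "m \<in> M" "m' \<in> M" "n \<in> N" "n' \<in> N" "m + n = m' + n'" for m m' n n'
  proof -
    have "m - m' \<in> M" using that assms(1) by (simp add: complex_vector.subspace_diff)
    moreover have "m - m' = n' - n" using that(5) by (simp add: algebra_simps)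
    then have "m - m' \<in> N" using that assms(2) by (simp add: complex_vector.subspace_diff)
    ultimately show ?thesis using assms(3)[of "m - m'"] by simp
  qed
  define P where "P x = (THE m. m \<in> M \<and> (\<exists>n\<in>N. x = m + n))" for x
  have P: "P (m + n) = m" if "m \<in> M" "n \<in> N" for m n
    unfolding P_def by (rule the_equality) (use that uniq in blast)+
  show ?thesis
  proof (rule that[of P])
    show "clinear P"
    proof (rule clinearI)
      fix x y c
      obtain m n m' n' where x: "x = m + n" "m \<in> M" "n \<in> N" and y: "y = m' + n'" "m' \<in> M" "n' \<in> N"
        using assms(4) by meson
      have "P ((m + m') + (n + n')) = m + m'"
        by (rule P) (use x y assms(1,2) in \<open>auto simp: complex_vector.subspace_add\<close>)
      then show "P (x + y) = P x + P y" using x y by (simp add: P algebra_simps)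
      have "P (c *\<^sub>C m + c *\<^sub>C n) = c *\<^sub>C m"
        by (rule P) (use x assms(1,2) in \<open>auto simp: complex_vector.subspace_scale\<close>)
      then show "P (c *\<^sub>C x) = c *\<^sub>C P x" using x by (simp add: P scaleC_add_right)
    qed
    show "P x = x" if "x \<in> M" for x
      using P[OF that, of 0] assms(2) by (simp add: complex_vector.subspace_0)
    show "P x = 0" if "x \<in> N" for x
      using P[OF _ that, of 0] assms(1) by (simp add: complex_vector.subspace_0)
  qed
qed

section \<open>Tensor products of algebras\<close>

lemma pure_tensor_linear_right: "clinear (\<lambda>y. x \<boxtimes> y)"
  and pure_tensor_linear_left: "clinear (\<lambda>x. x \<boxtimes> y)"
  using cbilinear_pure_tensor by (auto simp: cbilinear_def)

lemma poly_mapping_sum_singles: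
  fixes p :: "'k \<Rightarrow>\<^sub>0 'b::comm_monoid_add"
  shows "p = (\<Sum>k\<in>Poly_Mapping.keys p. Poly_Mapping.single k (Poly_Mapping.lookup p k))"
  by (rule poly_mapping_eqI)
    (auto simp: lookup_sum lookup_single when_def in_keys_iff if_distrib cong: if_cong)

lemma poly_mapping_induct_singles [case_names single sum]:
  fixes p :: "'k \<Rightarrow>\<^sub>0 'b::comm_monoid_add"
  assumes "\<And>k c. Q (Poly_Mapping.single k c)" "\<And>p r. Q p \<Longrightarrow> Q r \<Longrightarrow> Q (p + r)"
  shows "Q p"
proof -
  have "Q (\<Sum>k\<in>A. Poly_Mapping.single k (Poly_Mapping.lookup p k))" if "finite A" for A
    using that
  proof (induction A rule: finite_induct)
    case empty
    show ?case using assms(1)[of undefined 0] by simp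
  qed (simp add: assms)
  then show ?thesis using poly_mapping_sum_singles[of p] finite_keys by metis
qed

text \<open>Scalars need no case of their own, since the coefficient of a pure tensor can be
  absorbed into its left factor.\<close>

lemma tensor_induct [case_names pure add]:
  assumes pure: "\<And>x y. Q (x \<boxtimes> y)" and add: "\<And>s t. Q s \<Longrightarrow> Q t \<Longrightarrow> Q (s + t)"
  shows "Q t"
proof -
  have "Q (abs_tensor p)" for p :: "'a \<times> 'b \<Rightarrow>\<^sub>0 complex"
  proof (induction p rule: poly_mapping_induct_singles)
    case (single k c)
    have "abs_tensor (Poly_Mapping.single k c) = (c *\<^sub>C fst k) \<boxtimes> snd k"
    proof -
      have "(c *\<^sub>C fst k) \<boxtimes> snd k = c *\<^sub>C (fst k \<boxtimes> snd k)"
        by (rule clinear_scale[OF pure_tensor_linear_left])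
      then show ?thesis by (simp add: pure_tensor.abs_eq scaleC_tensor.abs_eq)
    qed
    then show ?case using pure by simp
  next
    case (sum p r)
    then show ?case using add by (simp add: plus_tensor.abs_eq[symmetric])
  qed
  then show ?thesis using Quotient3_abs_rep[OF Quotient3_tensor, of t] by metis
qed

lemma cbilinearI: "(\<And>x. clinear (\<beta> x)) \<Longrightarrow> (\<And>y. clinear (\<lambda>x. \<beta> x y)) \<Longrightarrow> cbilinear \<beta>"
  by (simp add: cbilinear_def)

lemma tensor_linear_ext:
  assumes "clinear f" "clinear g" "\<And>x y. f (x \<boxtimes> y) = g (x \<boxtimes> y)"
  shows "f t = g t"
  by (induction t rule: tensor_induct) (simp_all add: assms clinear_add)

lemma tensor_lift_compose:
  assumes "cbilinear \<beta>" "clinear f"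
  shows "f (tensor_lift \<beta> t) = tensor_lift (\<lambda>x y. f (\<beta> x y)) t"
proof (rule tensor_linear_ext)
  have *: "cbilinear (\<lambda>x y. f (\<beta> x y))"
    using assms by (auto simp: cbilinear_def intro: clinear_compose)
  show "clinear (\<lambda>t. f (tensor_lift \<beta> t))"
    by (intro clinear_compose[OF assms(2)] clinear_tensor_lift assms)
  show "clinear (tensor_lift (\<lambda>x y. f (\<beta> x y)))" by (rule clinear_tensor_lift[OF *])
  show "f (tensor_lift \<beta> (a \<boxtimes> b)) = tensor_lift (\<lambda>x y. f (\<beta> x y)) (a \<boxtimes> b)" for a b
    by (simp add: assms *)
qed

lemma cbilinear_mult_pure: "cbilinear (\<lambda>a' b'. (a * a') \<boxtimes> (b * b'))"
  for a :: "'a::complex_algebra_1" and b :: "'b::complex_algebra_1"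
  by (intro cbilinearI clinear_compose[OF pure_tensor_linear_left clinear_mult_left]
      clinear_compose[OF pure_tensor_linear_right clinear_mult_left])

lemma cbilinear_pure_mult: "cbilinear (\<lambda>a b. (a * a') \<boxtimes> (b * b'))"
  for a' :: "'a::complex_algebra_1" and b' :: "'b::complex_algebra_1"
  by (intro cbilinearI clinear_compose[OF pure_tensor_linear_left clinear_mult_right]
      clinear_compose[OF pure_tensor_linear_right clinear_mult_right])

text \<open>\<open>tensor_lift\<close> is computable only on bilinear maps, so the outer lift in
  \<open>tensor_mult\<close> needs this before any product can be evaluated.\<close>

lemma cbilinear_tensor_mult_aux:
  "cbilinear (\<lambda>a b. tensor_lift (\<lambda>a' b'. (a * a') \<boxtimes> (b * b')) t)"
  for t :: "('a::complex_algebra_1, 'b::complex_algebra_1) tensor"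
proof (induction t rule: tensor_induct)
  case (pure x y)
  show ?case by (simp add: cbilinear_mult_pure cbilinear_pure_mult)
next
  case (add s t)
  then show ?case
    by (simp add: cbilinear_def clinear_add[OF clinear_tensor_lift[OF cbilinear_mult_pure]]
        clinear_compose_add)
qed

lemma tensor_mult_pure [simp]: "tensor_mult (a \<boxtimes> b) (c \<boxtimes> d) = (a * c) \<boxtimes> (b * d)"
  by (simp add: tensor_mult_def cbilinear_tensor_mult_aux cbilinear_mult_pure cbilinear_pure_mult)

lemma tensor_mult_linear_left: "clinear (\<lambda>s. tensor_mult s t)"
  unfolding tensor_mult_def by (rule clinear_tensor_lift[OF cbilinear_tensor_mult_aux])

lemma tensor_mult_linear_right: "clinear (\<lambda>t. tensor_mult s t)"
proof (induction s rule: tensor_induct)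
  case (pure x y)
  then show ?case
    by (simp add: tensor_mult_def cbilinear_tensor_mult_aux)
      (rule clinear_tensor_lift[OF cbilinear_mult_pure])
next
  case (add s t)
  then show ?case by (simp add: clinear_add[OF tensor_mult_linear_left] clinear_compose_add)
qed

text \<open>For \<Delta> (x E_i), which is \<Delta> x times a sum of two pure tensors: right
  multiplication moves from the tensor into the bilinear map.\<close>

lemma tensor_lift_mult_pure:
  assumes "cbilinear \<beta>"
  shows "tensor_lift \<beta> (tensor_mult s (c \<boxtimes> e)) = tensor_lift (\<lambda>x y. \<beta> (x * c) (y * e)) s"
proof (rule tensor_linear_ext)
  have *: "cbilinear (\<lambda>x y. \<beta> (x * c) (y * e))"
  proof (rule cbilinearI)
    show "clinear (\<lambda>y. \<beta> (x * c) (y * e))" for x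
      by (rule clinear_compose[OF _ clinear_mult_right]) (use assms in \<open>simp add: cbilinear_def\<close>)
    show "clinear (\<lambda>x. \<beta> (x * c) (y * e))" for y
      by (rule clinear_compose[OF _ clinear_mult_right, of "\<lambda>x. \<beta> x (y * e)"])
        (use assms in \<open>simp add: cbilinear_def\<close>)
  qed
  show "clinear (\<lambda>s. tensor_lift \<beta> (tensor_mult s (c \<boxtimes> e)))"
    by (rule clinear_compose[OF clinear_tensor_lift[OF assms] tensor_mult_linear_left])
  show "clinear (tensor_lift (\<lambda>x y. \<beta> (x * c) (y * e)))" by (rule clinear_tensor_lift[OF *])
  show "tensor_lift \<beta> (tensor_mult (x \<boxtimes> y) (c \<boxtimes> e))
      = tensor_lift (\<lambda>x y. \<beta> (x * c) (y * e)) (x \<boxtimes> y)" for x y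
    by (simp add: assms *)
qed

lemma tensor_lift_zero: "tensor_lift (\<lambda>x y. 0) t = 0"
  by (simp add: tensor_lift_def tensor_eval_def scaleC_zero_right)

lemma tensor_mult_assoc: "tensor_mult (tensor_mult r s) t = tensor_mult r (tensor_mult s t)"
proof (induction r rule: tensor_induct)
  case (pure a b)
  show ?case
  proof (induction s rule: tensor_induct)
    case (pure c d)
    show ?case
      by (induction t rule: tensor_induct)
        (simp_all add: clinear_add[OF tensor_mult_linear_right] mult.assoc)
  qed (simp_all add: clinear_add[OF tensor_mult_linear_right] clinear_add[OF tensor_mult_linear_left])
qed (simp_all add: clinear_add[OF tensor_mult_linear_left])

lemma tensor_mult_one_right: "tensor_mult t (1 \<boxtimes> 1) = t"
  by (induction t rule: tensor_induct) (simp_all add: clinear_add[OF tensor_mult_linear_left])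

section \<open>Simultaneous diagonalization and bilinear forms\<close>

text \<open>A joint eigenvector for \<open>Y\<close> splits into eigenvectors of
  \<open>A k0\<close>, and each component is again a joint eigenvector for \<open>Y\<close> because
  it is the value of a polynomial in \<open>A k0\<close>, which commutes with the other
  operators.\<close>

lemma joint_eigenspaces_span_insert:
  assumes lin: "\<And>k. k \<in> insert k0 Y \<Longrightarrow> clinear (A k)"
    and comm: "\<And>k x. k \<in> Y \<Longrightarrow> A k (A k0 x) = A k0 (A k x)"
    and diag: "cspan {x. \<exists>c. A k0 x = c *\<^sub>C x} = UNIV"
    and span: "cspan (\<Union>\<chi>. joint_eigenspace A Y \<chi>) = UNIV"
  shows "cspan (\<Union>\<chi>. joint_eigenspace A (insert k0 Y) \<chi>) = UNIV"
proof -
  let ?W = "cspan (\<Union>\<chi>. joint_eigenspace A (insert k0 Y) \<chi>)"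
  have "x \<in> ?W" if x: "x \<in> joint_eigenspace A Y \<chi>" for x \<chi>
  proof -
    have "x \<in> cspan {x. \<exists>c. A k0 x = c *\<^sub>C x}" using diag by blast
    then obtain T r where T: "finite T" "T \<subseteq> {x. \<exists>c. A k0 x = c *\<^sub>C x}"
      and xsum: "x = (\<Sum>v\<in>T. r v *\<^sub>C v)"
      unfolding complex_vector.span_explicit by auto
    then have "\<forall>v\<in>T. \<exists>c. A k0 v = c *\<^sub>C v" by blast
    then obtain e where e: "\<And>v. v \<in> T \<Longrightarrow> A k0 v = e v *\<^sub>C v" by metis
    define C where "C = e ` T"
    have finC: "finite C" using T C_def by simp
    define y where "y c = (\<Sum>v\<in>{v\<in>T. e v = c}. r v *\<^sub>C v)" for c
    have xy: "x = (\<Sum>c\<in>C. y c)"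
      unfolding xsum y_def C_def by (rule sum.image_gen[OF T(1)])
    have Ay: "A k0 (y c) = c *\<^sub>C y c" for c
      unfolding y_def clinear_sum[OF lin[OF insertI1]] complex_vector.scale_sum_right
      by (rule sum.cong) (auto simp: clinear_scale[OF lin[OF insertI1]] e scaleC_scaleC mult.commute)
    \<comment> \<open>Interpolation for the single operator \<open>A k0\<close> gives
      \<open>P\<close> with P x = y c; the eigenspace for \<open>Y\<close> is stable under
      \<open>A k0\<close>, hence under \<open>P\<close>.\<close>
    have "y c \<in> joint_eigenspace A Y \<chi>" if "c \<in> C" for c
    proof -
      obtain P where P: "clinear P"
        "\<And>x. x \<in> joint_eigenspace A {k0} (\<lambda>_. c) \<Longrightarrow> P x = x"
        "\<And>\<chi> x. \<chi> \<in> (\<lambda>c _. c) ` (C - {c}) \<Longrightarrow> x \<in> joint_eigenspace A {k0} \<chi> \<Longrightarrow> P x = 0"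
        "\<And>M x. csubspace M \<Longrightarrow> (\<And>k y. k \<in> {k0} \<Longrightarrow> y \<in> M \<Longrightarrow> A k y \<in> M) \<Longrightarrow> x \<in> M \<Longrightarrow> P x \<in> M"
        by (rule eigenspace_interpolation[of "{k0}" A "(\<lambda>c _. c) ` (C - {c})" "\<lambda>_. c"])
          (use lin finC in auto)
      have "P x = (\<Sum>c'\<in>C. P (y c'))" unfolding xy by (rule clinear_sum[OF P(1)])
      also have "\<dots> = (\<Sum>c'\<in>C. if c' = c then y c else 0)"
      proof (rule sum.cong[OF refl])
        fix c' assume c': "c' \<in> C"
        show "P (y c') = (if c' = c then y c else 0)"
          using P(2)[of "y c"] P(3)[of "\<lambda>_. c'" "y c'"] c' Ay by (auto simp: joint_eigenspace_def)
      qed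
      also have "\<dots> = y c" using finC that by simp
      finally have "P x = y c" .
      moreover have "P x \<in> joint_eigenspace A Y \<chi>"
        by (rule P(4)[OF csubspace_joint_eigenspace])
          (use lin comm x in \<open>auto simp: joint_eigenspace_def clinear_scale[OF lin[OF insertI1]]\<close>)
      ultimately show ?thesis by simp
    qed
    \<comment> \<open>The weight is changed at \<open>k0\<close> only if \<open>k0\<close> is new;
      otherwise \<chi> already prescribes its eigenvalue.\<close>
    then have "y c \<in> joint_eigenspace A (insert k0 Y) (\<chi>(k0 := if k0 \<in> Y then \<chi> k0 else c)) \<or> y c = 0"
      if "c \<in> C" for c
      using that Ay[of c] unfolding joint_eigenspace_def
      by (smt (verit, ccfv_threshold) fun_upd_apply insertE mem_Collect_eq)
    then have "y c \<in> ?W" if "c \<in> C" for c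
      using that by (metis UNIV_I UN_iff complex_vector.span_base complex_vector.span_zero)
    then show ?thesis unfolding xy by (rule complex_vector.span_sum)
  qed
  then have "(\<Union>\<chi>. joint_eigenspace A Y \<chi>) \<subseteq> ?W" by blast
  from complex_vector.span_minimal[OF this complex_vector.subspace_span] show ?thesis
    using span by blast
qed

lemma joint_eigenspaces_span:
  assumes "finite Y" "\<And>k. k \<in> Y \<Longrightarrow> clinear (A k)"
    and "\<And>k l x. k \<in> Y \<Longrightarrow> l \<in> Y \<Longrightarrow> A k (A l x) = A l (A k x)"
    and "\<And>k. k \<in> Y \<Longrightarrow> cspan {x. \<exists>c. A k x = c *\<^sub>C x} = UNIV"
  shows "cspan (\<Union>\<chi>. joint_eigenspace A Y \<chi>) = UNIV"
  using assms
proof (induction Y rule: finite_induct)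
  case empty
  have "(\<Union>\<chi>. joint_eigenspace A {} \<chi>) = UNIV" by (auto simp: joint_eigenspace_def)
  then show ?case by (simp add: complex_vector.span_UNIV)
next
  case (insert k Y)
  show ?case
    by (rule joint_eigenspaces_span_insert) (use insert in auto)
qed

section \<open>Finite-dimensional subspaces and functionals represented by a form\<close>

lemma finite_spanning_basis:
  assumes "finite D" "cspan D = (UNIV :: 'g::complex_vector set)" "csubspace (h :: 'g set)"
  obtains C where "finite C" "C \<subseteq> h" "complex_vector.independent C" "cspan C = h"
proof -
  obtain C where C: "C \<subseteq> h" "complex_vector.independent C" "h \<subseteq> cspan C"
    using complex_vector.maximal_independent_subset[of h] by blast
  have "finite C"
    using complex_vector.independent_span_bound[OF assms(1) C(2)] assms(2) by auto
  moreover have "cspan C = h"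
    using C complex_vector.span_minimal[OF C(1) assms(3)] by blast
  ultimately show ?thesis using that C by blast
qed

text \<open>Dimension count: the image of \<open>C\<close> is independent of the same size, so a
  vector outside its span would give an independent set in the span of \<open>C\<close> with more
  elements than \<open>C\<close>.\<close>

lemma injective_endomorphism_surjective:
  fixes T :: "'g::complex_vector \<Rightarrow> 'g"
  assumes C: "finite C" "complex_vector.independent C" and T: "clinear T"
    and into: "\<And>x. x \<in> cspan C \<Longrightarrow> T x \<in> cspan C"
    and inj: "\<And>x. x \<in> cspan C \<Longrightarrow> T x = 0 \<Longrightarrow> x = 0"
    and y: "y \<in> cspan C"
  shows "\<exists>x\<in>cspan C. T x = y"
proof -
  have inj_on: "inj_on T (cspan C)"
  proof (rule inj_onI)
    fix x x' assume "x \<in> cspan C" "x' \<in> cspan C" "T x = T x'"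
    then show "x = x'"
      using inj[of "x - x'"] by (simp add: clinear_diff[OF T] complex_vector.span_diff)
  qed
  have indep: "complex_vector.independent (T ` C)"
    using inj_on C(2) T module_hom.independent_injective_image[of scaleC scaleC T C]
    by (simp add: Vector_Spaces.linear_def cspan_def)
  have card: "card (T ` C) = card C"
    using inj_on by (simp add: card_image inj_on_subset complex_vector.span_superset)
  have "y \<in> cspan (T ` C)"
  proof (rule ccontr)
    assume n: "y \<notin> cspan (T ` C)"
    then have "complex_vector.independent (insert y (T ` C))"
      using indep by (simp add: complex_vector.independent_insert)
    moreover have "insert y (T ` C) \<subseteq> cspan C"
      using y into complex_vector.span_superset by blast
    ultimately have "card (insert y (T ` C)) \<le> card C"
      using complex_vector.independent_span_bound[OF C(1)] by blast
    moreover have "y \<notin> T ` C" using n complex_vector.span_superset by blast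
    ultimately show False using C(1) card by simp
  qed
  then obtain X r where "finite X" "X \<subseteq> T ` C" "y = (\<Sum>v\<in>X. r v *\<^sub>C v)"
    unfolding complex_vector.span_explicit by auto
  moreover have "\<exists>x\<in>cspan C. T x = (\<Sum>v\<in>X. r v *\<^sub>C v)" if "finite X" "X \<subseteq> T ` C" for X
    using that
  proof (induction X rule: finite_induct)
    case empty
    show ?case using clinear_zero[OF T] complex_vector.span_zero by force
  next
    case (insert v X)
    obtain x where x: "x \<in> cspan C" "T x = (\<Sum>v\<in>X. r v *\<^sub>C v)" using insert by blast
    obtain b where b: "b \<in> C" "v = T b" using insert by blast
    have "T (r v *\<^sub>C b + x) = (\<Sum>v\<in>insert v X. r v *\<^sub>C v)"
      using insert x b by (simp add: clinear_add[OF T] clinear_scale[OF T])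
    moreover have "r v *\<^sub>C b + x \<in> cspan C"
      using b x by (simp add: complex_vector.span_add complex_vector.span_base complex_vector.span_scale)
    ultimately show ?case by blast
  qed
  ultimately show ?thesis by blast
qed

text \<open>The map t |-> \<Sum> B(t,b) b over the basis is injective by nondegeneracy, hence onto,
  and a preimage of \<Sum> \<nu>(b) b represents \<nu>. Linearity of \<nu> is asked only on the
  span, because functionals on \<hh> are encoded as functions on the whole Lie algebra.\<close>

lemma bilinear_form_represents:
  fixes B :: "'g::complex_vector \<Rightarrow> 'g \<Rightarrow> complex"
  assumes C: "finite C" "complex_vector.independent C" and B: "cbilinear B"
    and nondeg: "\<And>x. x \<in> cspan C \<Longrightarrow> (\<forall>y\<in>cspan C. B x y = 0) \<Longrightarrow> x = 0"
    and \<nu>: "\<And>x y. x \<in> cspan C \<Longrightarrow> y \<in> cspan C \<Longrightarrow> \<nu> (x + y) = \<nu> x + \<nu> y"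
      "\<And>c x. x \<in> cspan C \<Longrightarrow> \<nu> (c *\<^sub>C x) = c * \<nu> x"
  shows "\<exists>t\<in>cspan C. \<forall>y\<in>cspan C. B t y = \<nu> y"
proof -
  have Bl: "clinear (\<lambda>x. B x y)" and Br: "clinear (B x)" for x y
    using B by (simp_all add: cbilinear_def)
  define T where "T t = (\<Sum>b\<in>C. B t b *\<^sub>C b)" for t
  have uniq: "\<forall>b\<in>C. f b = g b" if "(\<Sum>b\<in>C. f b *\<^sub>C b) = (\<Sum>b\<in>C. g b *\<^sub>C b)" for f g
    using complex_vector.independentD[OF C(2,1) order_refl, of "\<lambda>b. f b - g b"] that
    by (simp add: scaleC_diff_left sum_subtractf)
  have ext: "\<forall>y\<in>cspan C. f y = g y"
    if fg: "\<And>x y. x \<in> cspan C \<Longrightarrow> y \<in> cspan C \<Longrightarrow> f (x + y) = f x + f y"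
      "\<And>c x. x \<in> cspan C \<Longrightarrow> f (c *\<^sub>C x) = c * f x"
      "\<And>x y. x \<in> cspan C \<Longrightarrow> y \<in> cspan C \<Longrightarrow> g (x + y) = g x + g y"
      "\<And>c x. x \<in> cspan C \<Longrightarrow> g (c *\<^sub>C x) = c * g x"
      and "\<forall>b\<in>C. f b = g b" for f g :: "'g \<Rightarrow> complex"
  proof
    fix y assume "y \<in> cspan C"
    then have "y \<in> cspan C \<and> f y = g y"
    proof (induction rule: complex_vector.span_induct_alt)
      case base
      show ?case using fg(2)[of 0 0] fg(4)[of 0 0] by (simp add: complex_vector.span_zero)
    next
      case (step c x y)
      then have "x \<in> cspan C" by (simp add: complex_vector.span_base)
      then show ?case
        using step that(5) by (simp add: fg complex_vector.span_scale complex_vector.span_add)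
    qed
    then show "f y = g y" ..
  qed
  have "clinear T" unfolding T_def
    by (intro clinear_compose_sum clinearI)
      (simp_all add: clinear_add[OF Bl] clinear_scale[OF Bl] scaleC_add_left scaleC_scaleC scaleC_complex_def)
  moreover have "T x \<in> cspan C" for x
    unfolding T_def by (intro complex_vector.span_sum complex_vector.span_scale complex_vector.span_base)
  moreover have "x = 0" if "x \<in> cspan C" "T x = 0" for x
  proof (rule nondeg[OF that(1)])
    have "\<forall>b\<in>C. B x b = 0" using uniq[of "B x" "\<lambda>_. 0"] that(2) by (simp add: T_def)
    then show "\<forall>y\<in>cspan C. B x y = 0"
      by (intro ext) (simp_all add: clinear_add[OF Br] clinear_scale[OF Br] scaleC_complex_def)
  qed
  moreover have "(\<Sum>b\<in>C. \<nu> b *\<^sub>C b) \<in> cspan C"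
    by (intro complex_vector.span_sum complex_vector.span_scale complex_vector.span_base)
  ultimately obtain t where t: "t \<in> cspan C" "T t = (\<Sum>b\<in>C. \<nu> b *\<^sub>C b)"
    using injective_endomorphism_surjective[OF C] by blast
  have "\<forall>b\<in>C. B t b = \<nu> b" using uniq t(2) by (simp add: T_def)
  then have "\<forall>y\<in>cspan C. B t y = \<nu> y"
    by (intro ext) (simp_all add: \<nu> clinear_add[OF Br] clinear_scale[OF Br] scaleC_complex_def)
  then show ?thesis using t(1) by blast
qed

section \<open>Root data of simple Lie algebras\<close>

locale root_data =
  fixes br :: "'g::complex_vector \<Rightarrow> 'g \<Rightarrow> 'g" and \<hh> :: "'g set"
    and \<alpha> :: "'i::finite \<Rightarrow> 'g \<Rightarrow> complex" and B :: "'g \<Rightarrow> 'g \<Rightarrow> complex"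
  assumes simple: "simple_lie_algebra br"
    and cartan: "cartan_subalgebra br \<hh>"
    and simple_roots: "simple_roots br \<hh> \<alpha>"
    and form: "normalized_invariant_form br \<hh> B"
begin

lemma br_linear_right: "clinear (br x)"
  and br_linear_left: "clinear (\<lambda>x. br x y)"
  using simple by (simp_all add: simple_lie_algebra_def lie_bracket_def cbilinear_def)

lemma br_self: "br x x = 0"
  using simple by (simp add: simple_lie_algebra_def lie_bracket_def)

lemma br_anti: "br x y = - br y x"
proof -
  have "br x y + br y x = 0"
    using br_self[of "x + y"] br_self[of x] br_self[of y]
    by (simp add: clinear_add[OF br_linear_right] clinear_add[OF br_linear_left] add.commute)
  then show ?thesis by (simp only: eq_neg_iff_add_eq_0)
qed

lemma jacobi: "br x (br y z) = br (br x y) z + br y (br x z)"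
proof -
  have "br x (br y z) + br y (br z x) + br z (br x y) = 0"
    using simple by (simp add: simple_lie_algebra_def lie_bracket_def)
  moreover have "br y (br z x) = - br y (br x z)"
    using br_anti[of z x] by (simp add: clinear_minus[OF br_linear_right])
  moreover have "br z (br x y) = - br (br x y) z" by (rule br_anti)
  ultimately show ?thesis by (simp add: algebra_simps)
qed

lemma \<hh>_subspace: "csubspace \<hh>"
  and \<hh>_commute: "x \<in> \<hh> \<Longrightarrow> y \<in> \<hh> \<Longrightarrow> br x y = 0"
  and \<hh>_self_centralizing: "(\<And>y. y \<in> \<hh> \<Longrightarrow> br y x = 0) \<Longrightarrow> x \<in> \<hh>"
  and \<hh>_diagonalizable: "y \<in> \<hh> \<Longrightarrow> cspan {x. \<exists>c. br y x = c *\<^sub>C x} = UNIV"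
  using cartan unfolding cartan_subalgebra_def by blast+

lemma B_linear_right: "clinear (B x)"
  and B_linear_left: "clinear (\<lambda>x. B x y)"
  and B_sym: "B x y = B y x"
  and B_invariant: "B (br x y) z = B x (br y z)"
  and B_nondegenerate: "(\<And>y. B x y = 0) \<Longrightarrow> x = 0"
  using form unfolding normalized_invariant_form_def invariant_form_def cbilinear_def by blast+

lemma finite_spanning: "\<exists>D. finite D \<and> cspan D = (UNIV :: 'g set)"
  using simple by (simp add: simple_lie_algebra_def)

lemma \<hh>_basis:
  obtains C where "finite C" "C \<subseteq> \<hh>" "complex_vector.independent C" "cspan C = \<hh>"
  using finite_spanning finite_spanning_basis \<hh>_subspace by blast

text \<open>Simultaneous diagonalization works for finitely many operators, so it is applied to a
  basis of \<hh>.\<close>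

lemma root_space_decomposition: "cspan (\<Union>\<chi>. root_space br \<hh> \<chi>) = UNIV"
proof -
  obtain C where C: "finite C" "C \<subseteq> \<hh>" "cspan C = \<hh>" using \<hh>_basis by metis
  have comm: "br k (br l x) = br l (br k x)" if "k \<in> \<hh>" "l \<in> \<hh>" for k l x
    using jacobi[of k l x] \<hh>_commute[OF that] by (simp add: clinear_zero[OF br_linear_left])
  have "cspan (\<Union>\<chi>. joint_eigenspace br C \<chi>) = UNIV"
    by (rule joint_eigenspaces_span) (use C comm br_linear_right \<hh>_diagonalizable in blast)+
  moreover have "\<exists>\<chi>. x \<in> root_space br \<hh> \<chi>" if x: "x \<in> joint_eigenspace br C \<chi>0" for x \<chi>0
  proof -
    \<comment> \<open>A joint eigenvector for the basis is an eigenvector of every element of \<hh>;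
      collecting the eigenvalues defines the weight on all of \<hh>.\<close>
    have "\<exists>c. br y x = c *\<^sub>C x" if "y \<in> \<hh>" for y
      using that unfolding C(3)[symmetric]
    proof (induction rule: complex_vector.span_induct_alt)
      case base
      have "br 0 x = 0 *\<^sub>C x" by (simp add: clinear_zero[OF br_linear_left] scaleC_zero_left)
      then show ?case by blast
    next
      case (step c k y)
      then obtain e where "br y x = e *\<^sub>C x" by blast
      moreover have "br k x = \<chi>0 k *\<^sub>C x" using x step by (simp add: joint_eigenspace_def)
      ultimately have "br (c *\<^sub>C k + y) x = (c * \<chi>0 k + e) *\<^sub>C x"
        by (simp add: clinear_add[OF br_linear_left] clinear_scale[OF br_linear_left]
            scaleC_add_left scaleC_scaleC)
      then show ?case by blast
    qed
    then have "\<exists>\<chi>. \<forall>y\<in>\<hh>. br y x = \<chi> y *\<^sub>C x" by metis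
    then show ?thesis by (simp add: root_space_def)
  qed
  then have "(\<Union>\<chi>. joint_eigenspace br C \<chi>) \<subseteq> (\<Union>\<chi>. root_space br \<hh> \<chi>)" by blast
  ultimately show ?thesis using complex_vector.span_mono by blast
qed

section \<open>The invariant form on the Cartan subalgebra and the Gram matrix\<close>

lemma linear_zero_on_root_spaces:
  assumes "clinear f" "\<And>\<chi> x. x \<in> root_space br \<hh> \<chi> \<Longrightarrow> f x = 0"
  shows "f x = 0"
  using clinear_eq_on_span[OF assms(1) clinear_const_zero, of "\<Union>\<chi>. root_space br \<hh> \<chi>" x]
    assms(2) root_space_decomposition by blast

text \<open>Invariance moves \<open>br k\<close> from one argument to the other with a sign, so
  (\<chi> k + \<mu> k) B(x,y) = 0.\<close>

lemma root_spaces_orthogonal: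
  assumes "x \<in> root_space br \<hh> \<chi>" "y \<in> root_space br \<hh> \<mu>" "k \<in> \<hh>" "\<chi> k + \<mu> k \<noteq> 0"
  shows "B x y = 0"
proof -
  have "\<chi> k * B x y = B (br k x) y"
    using assms by (simp add: root_space_def clinear_scale[OF B_linear_left] scaleC_complex_def)
  also have "\<dots> = - B x (br k y)"
    using B_invariant[of x k y] br_anti[of k x] by (simp add: clinear_minus[OF B_linear_left])
  also have "\<dots> = - (\<mu> k * B x y)"
    using assms by (simp add: root_space_def clinear_scale[OF B_linear_right] scaleC_complex_def)
  finally have "(\<chi> k + \<mu> k) * B x y = 0" by (simp add: algebra_simps)
  then show ?thesis using assms by simp
qed

lemma \<hh>_root_space_0: "\<hh> = root_space br \<hh> (\<lambda>_. 0)"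
  using \<hh>_commute \<hh>_self_centralizing by (auto simp: root_space_def scaleC_zero_left)

text \<open>\<hh> is the weight space of weight 0 and so orthogonal to all the others; a vector
  orthogonal to \<hh> would lie in the radical of \<open>B\<close>.\<close>

lemma B_nondegenerate_\<hh>:
  assumes x: "x \<in> \<hh>" and "\<And>y. y \<in> \<hh> \<Longrightarrow> B x y = 0" shows "x = 0"
proof (rule B_nondegenerate)
  show "B x y = 0" for y
  proof (rule linear_zero_on_root_spaces[OF B_linear_right])
    fix \<mu> y assume y: "y \<in> root_space br \<hh> \<mu>"
    show "B x y = 0"
    proof (cases "\<exists>k\<in>\<hh>. \<mu> k \<noteq> 0")
      case True
      then show ?thesis using root_spaces_orthogonal[of x "\<lambda>_. 0" y \<mu>] x y \<hh>_root_space_0 by auto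
    next
      case False
      then have "y \<in> \<hh>" using y \<hh>_root_space_0 by (auto simp: root_space_def)
      then show ?thesis by (rule assms(2))
    qed
  qed
qed

text \<open>The vector usually written t_\<nu>, without the factor 2/(\<nu>,\<nu>) of the normalized
  coroot. The description is the one used inside \<open>dual_form\<close>.\<close>

definition coroot :: "('g \<Rightarrow> complex) \<Rightarrow> 'g"
  where "coroot \<nu> = (THE t. t \<in> \<hh> \<and> (\<forall>y\<in>\<hh>. B t y = \<nu> y))"

lemma dual_form_coroot: "dual_form \<hh> B \<chi> \<mu> = B (coroot \<chi>) (coroot \<mu>)"
  by (simp add: dual_form_def coroot_def Let_def)

lemma dual_form_sym: "dual_form \<hh> B \<chi> \<mu> = dual_form \<hh> B \<mu> \<chi>"
  by (simp add: dual_form_coroot B_sym)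

text \<open>\<beta>(y) is the eigenvalue of \<open>br y\<close> on one fixed nonzero root vector,
  and \<open>br y\<close> is linear in y.\<close>

lemma root_linear:
  assumes "is_root br \<hh> \<beta>"
  shows "x \<in> \<hh> \<Longrightarrow> y \<in> \<hh> \<Longrightarrow> \<beta> (x + y) = \<beta> x + \<beta> y" "x \<in> \<hh> \<Longrightarrow> \<beta> (c *\<^sub>C x) = c * \<beta> x"
proof -
  have "0 \<in> root_space br \<hh> \<beta>"
    by (simp add: root_space_def clinear_zero[OF br_linear_right] scaleC_zero_right)
  then obtain v where v: "v \<in> root_space br \<hh> \<beta>" "v \<noteq> 0"
    using assms by (auto simp: is_root_def)
  have eig: "br y v = \<beta> y *\<^sub>C v" if "y \<in> \<hh>" for y using v(1) that by (simp add: root_space_def)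
  show "\<beta> (x + y) = \<beta> x + \<beta> y" if xy: "x \<in> \<hh>" "y \<in> \<hh>"
  proof -
    have "x + y \<in> \<hh>" using xy \<hh>_subspace by (simp add: complex_vector.subspace_add)
    then have "\<beta> (x + y) *\<^sub>C v = (\<beta> x + \<beta> y) *\<^sub>C v"
      using eig xy by (metis clinear_add[OF br_linear_left] scaleC_add_left)
    then show ?thesis using v(2) by simp
  qed
  show "\<beta> (c *\<^sub>C x) = c * \<beta> x" if x: "x \<in> \<hh>"
  proof -
    have "c *\<^sub>C x \<in> \<hh>" using x \<hh>_subspace by (simp add: complex_vector.subspace_scale)
    then have "\<beta> (c *\<^sub>C x) *\<^sub>C v = (c * \<beta> x) *\<^sub>C v"
      using eig x by (metis clinear_scale[OF br_linear_left] scaleC_scaleC)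
    then show ?thesis using v(2) by simp
  qed
qed

lemma coroot:
  assumes "is_root br \<hh> \<beta>"
  shows "coroot \<beta> \<in> \<hh>" "y \<in> \<hh> \<Longrightarrow> B (coroot \<beta>) y = \<beta> y"
proof -
  obtain C where C: "finite C" "complex_vector.independent C" "cspan C = \<hh>" using \<hh>_basis by metis
  have "\<exists>t\<in>\<hh>. \<forall>y\<in>\<hh>. B t y = \<beta> y"
    unfolding C(3)[symmetric]
    by (rule bilinear_form_represents[OF C(1,2)])
      (use B_linear_left B_linear_right B_nondegenerate_\<hh> root_linear[OF assms]
        in \<open>simp_all add: C(3) cbilinear_def\<close>)
  then obtain t where t: "t \<in> \<hh>" "\<forall>y\<in>\<hh>. B t y = \<beta> y" by blast
  have "coroot \<beta> = t"
    unfolding coroot_def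
  proof (rule the_equality)
    fix s assume s: "s \<in> \<hh> \<and> (\<forall>y\<in>\<hh>. B s y = \<beta> y)"
    have "s - t = 0"
      by (rule B_nondegenerate_\<hh>)
        (use s t \<hh>_subspace in \<open>simp_all add: complex_vector.subspace_diff clinear_diff[OF B_linear_left]\<close>)
    then show "s = t" by simp
  qed (use t in blast)
  then show "coroot \<beta> \<in> \<hh>" "y \<in> \<hh> \<Longrightarrow> B (coroot \<beta>) y = \<beta> y" using t by simp_all
qed

lemma simple_root: "is_root br \<hh> (\<alpha> i)"
  using simple_roots by (simp add: simple_roots_def)

lemma simple_roots_independent:
  "(\<And>y. y \<in> \<hh> \<Longrightarrow> (\<Sum>i\<in>UNIV. c i * \<alpha> i y) = 0) \<Longrightarrow> c i = 0"
  using simple_roots unfolding simple_roots_def by blast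

lemma root_simple_combination:
  assumes "is_root br \<hh> \<beta>"
  obtains n :: "'i \<Rightarrow> int" where "\<And>y. y \<in> \<hh> \<Longrightarrow> \<beta> y = (\<Sum>i\<in>UNIV. of_int (n i) * \<alpha> i y)"
    "(\<forall>i. n i \<ge> 0) \<or> (\<forall>i. n i \<le> 0)"
  using simple_roots assms unfolding simple_roots_def by blast

lemma center_trivial: assumes "\<And>y. br y x = 0" shows "x = 0"
proof -
  define J where "J = {x. \<forall>y. br y x = 0}"
  have "csubspace J"
    by (auto simp: J_def complex_vector.subspace_def clinear_zero[OF br_linear_right]
        clinear_add[OF br_linear_right] clinear_scale[OF br_linear_right] scaleC_zero_right)
  then have "lie_ideal br J"
    unfolding lie_ideal_def by (auto simp: J_def clinear_zero[OF br_linear_right])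
  then have "J = {0} \<or> J = UNIV" using simple by (simp add: simple_lie_algebra_def)
  moreover have "J \<noteq> UNIV" using simple by (auto simp: simple_lie_algebra_def J_def)
  ultimately show ?thesis using assms by (auto simp: J_def)
qed

text \<open>A relation between the columns gives t = \<Sum> c_j t_{\<alpha>_j} on which all simple
  roots vanish, hence all roots. Then t is central, so t = 0, and independence of the simple roots
  gives c = 0.\<close>

lemma gram_nondegenerate:
  assumes "\<And>i. (\<Sum>j\<in>UNIV. c j * dual_form \<hh> B (\<alpha> i) (\<alpha> j)) = 0"
  shows "c j = 0"
proof -
  define t where "t = (\<Sum>j\<in>UNIV. c j *\<^sub>C coroot (\<alpha> j))"
  have t\<hh>: "t \<in> \<hh>"
    unfolding t_def
    by (intro complex_vector.subspace_sum complex_vector.subspace_scale \<hh>_subspace coroot simple_root)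
  have \<alpha>t: "\<alpha> i t = 0" for i
  proof -
    have "\<alpha> i t = B (coroot (\<alpha> i)) t" using coroot(2)[OF simple_root t\<hh>] by simp
    also have "\<dots> = (\<Sum>j\<in>UNIV. c j * dual_form \<hh> B (\<alpha> i) (\<alpha> j))"
      by (simp add: t_def clinear_sum[OF B_linear_right] clinear_scale[OF B_linear_right]
          scaleC_complex_def dual_form_coroot)
    finally show ?thesis using assms by simp
  qed
  have "br t x = 0" for x
  proof (rule linear_zero_on_root_spaces[OF br_linear_right])
    fix \<mu> x assume x: "x \<in> root_space br \<hh> \<mu>"
    show "br t x = 0"
    proof (cases "x = 0 \<or> (\<forall>k\<in>\<hh>. \<mu> k = 0)")
      case True
      then show ?thesis
        using x t\<hh> by (auto simp: root_space_def clinear_zero[OF br_linear_right] scaleC_zero_left)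
    next
      case False
      then have "is_root br \<hh> \<mu>" using x by (auto simp: is_root_def)
      then obtain n :: "'i \<Rightarrow> int" where "\<mu> t = (\<Sum>i\<in>UNIV. of_int (n i) * \<alpha> i t)"
        using root_simple_combination t\<hh> by metis
      then show ?thesis using x t\<hh> \<alpha>t by (simp add: root_space_def scaleC_zero_left)
    qed
  qed
  then have "br x t = 0" for x using br_anti[of x t] by simp
  then have "t = 0" by (rule center_trivial)
  have "(\<Sum>j\<in>UNIV. c j * \<alpha> j y) = 0" if "y \<in> \<hh>" for y
  proof -
    have "(\<Sum>j\<in>UNIV. c j * \<alpha> j y) = B t y"
      by (simp add: t_def clinear_sum[OF B_linear_left] clinear_scale[OF B_linear_left]
          scaleC_complex_def coroot(2)[OF simple_root that])
    then show ?thesis using \<open>t = 0\<close> by (simp add: clinear_zero[OF B_linear_left])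
  qed
  then show ?thesis by (rule simple_roots_independent)
qed

lemma root_length:
  assumes "is_root br \<hh> \<beta>" obtains r where "r \<ge> 2" "dual_form \<hh> B \<beta> \<beta> = complex_of_real r"
  using form assms unfolding normalized_invariant_form_def by blast

section \<open>Root strings and the sign of the off-diagonal Cartan integers\<close>

lemma root_space_bracket:
  assumes "x \<in> root_space br \<hh> \<chi>" "y \<in> root_space br \<hh> \<mu>"
  shows "br x y \<in> root_space br \<hh> (\<lambda>k. \<chi> k + \<mu> k)"
  using assms
  by (simp add: root_space_def jacobi clinear_scale[OF br_linear_left]
      clinear_scale[OF br_linear_right] scaleC_add_left)

lemma root_vector:
  assumes "is_root br \<hh> \<beta>" obtains e where "e \<in> root_space br \<hh> \<beta>" "e \<noteq> 0"
proof -
  have "0 \<in> root_space br \<hh> \<beta>"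
    by (simp add: root_space_def clinear_zero[OF br_linear_right] scaleC_zero_right)
  then show ?thesis using assms that by (auto simp: is_root_def)
qed

text \<open>By nondegeneracy e pairs nontrivially with some weight vector f, and orthogonality
  forces its weight to be -\<beta>. That [e,f] equals B(e,f) t_\<beta> is tested against \<hh>. The
  triple stays unnormalized, hence the factor c.\<close>

lemma sl2_triple:
  assumes \<beta>: "is_root br \<hh> \<beta>" and e: "e \<in> root_space br \<hh> \<beta>" "e \<noteq> 0"
  obtains f c where "f \<in> root_space br \<hh> (\<lambda>k. - \<beta> k)" "c \<noteq> 0" "br e f = c *\<^sub>C coroot \<beta>"
proof -
  obtain f \<chi> where f: "f \<in> root_space br \<hh> \<chi>" "B e f \<noteq> 0"
    using linear_zero_on_root_spaces[OF B_linear_right[of e]] B_nondegenerate[of e] e(2) by blast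
  have \<chi>: "\<chi> k = - \<beta> k" if "k \<in> \<hh>" for k
  proof -
    have "\<beta> k + \<chi> k = 0" using root_spaces_orthogonal[OF e(1) f(1) that] f(2) by blast
    then show ?thesis by (simp add: eq_neg_iff_add_eq_0 add.commute)
  qed
  have f': "f \<in> root_space br \<hh> (\<lambda>k. - \<beta> k)" using f(1) \<chi> by (simp add: root_space_def)
  have ef: "br e f \<in> \<hh>" using root_space_bracket[OF e(1) f'] \<hh>_root_space_0 by simp
  have "br e f - B e f *\<^sub>C coroot \<beta> = 0"
  proof (rule B_nondegenerate_\<hh>)
    show "br e f - B e f *\<^sub>C coroot \<beta> \<in> \<hh>"
      using ef coroot(1)[OF \<beta>] \<hh>_subspace
      by (simp add: complex_vector.subspace_diff complex_vector.subspace_scale)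
    show "B (br e f - B e f *\<^sub>C coroot \<beta>) y = 0" if y: "y \<in> \<hh>" for y
    proof -
      have "br f y = \<beta> y *\<^sub>C f"
        using f' y br_anti[of f y] by (simp add: root_space_def scaleC_minus_left)
      then show ?thesis
        by (simp add: clinear_diff[OF B_linear_left] clinear_scale[OF B_linear_left] B_invariant
            clinear_scale[OF B_linear_right] coroot(2)[OF \<beta> y] scaleC_complex_def)
    qed
  qed
  then show ?thesis using that[of f "B e f"] f' f(2) by simp
qed

text \<open>Eigenvectors with distinct eigenvalues are independent, and an infinite independent set
  contradicts finite dimension.\<close>

lemma no_infinite_eigenvector_family:
  fixes x :: "nat \<Rightarrow> 'g"
  assumes T: "clinear T" and eig: "\<And>k. T (x k) = e k *\<^sub>C x k" and "inj e" and nz: "\<And>k. x k \<noteq> 0"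
  shows False
proof -
  have injx: "inj x"
  proof (rule injI)
    fix j k assume "x j = x k"
    then have "e j *\<^sub>C x k = e k *\<^sub>C x k" using eig by metis
    then show "j = k" using nz[of k] \<open>inj e\<close> by (simp add: inj_eq)
  qed
  have "complex_vector.independent (range x)"
    unfolding complex_vector.dependent_def
  proof
    assume "\<exists>a\<in>range x. a \<in> cspan (range x - {a})"
    then obtain k where "x k \<in> cspan (range x - {x k})" by blast
    then obtain X r where X: "finite X" "X \<subseteq> range x - {x k}" "x k = (\<Sum>v\<in>X. r v *\<^sub>C v)"
      unfolding complex_vector.span_explicit by auto
    \<comment> \<open>The eigenvalues become weights on the one-point type \<open>unit\<close>, so
      that interpolation applies to the single operator \<open>T\<close>.\<close>
    define E where "E = (\<lambda>j (_::unit). e j) ` (x -` X)"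
    have finE: "finite E" using X(1) injx by (simp add: E_def finite_vimageI)
    have neE: "\<exists>u\<in>UNIV. \<chi> u \<noteq> e k" if "\<chi> \<in> E" for \<chi>
    proof -
      have "\<exists>j. x j \<in> X \<and> \<chi> = (\<lambda>_. e j)" using that unfolding E_def by blast
      then obtain j where "x j \<in> X" "\<chi> = (\<lambda>_. e j)" by blast
      then show ?thesis using X(2) \<open>inj e\<close> by (auto simp: inj_eq)
    qed
    obtain P where P: "clinear P"
      "\<And>v. v \<in> joint_eigenspace (\<lambda>_::unit. T) UNIV (\<lambda>_. e k) \<Longrightarrow> P v = v"
      "\<And>\<chi> v. \<chi> \<in> E \<Longrightarrow> v \<in> joint_eigenspace (\<lambda>_. T) UNIV \<chi> \<Longrightarrow> P v = 0"
      by (rule eigenspace_interpolation[of UNIV "\<lambda>_::unit. T" E "\<lambda>_. e k", OF T finE neE]) (assumption | blast)+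
    have "P v = 0" if v: "v \<in> X" for v
    proof -
      obtain j where "v = x j" using v X(2) by blast
      then show ?thesis
        using P(3)[of "\<lambda>_. e j" v] v eig by (auto simp: E_def joint_eigenspace_def)
    qed
    then have "P (x k) = 0"
      unfolding X(3) clinear_sum[OF P(1)] by (simp add: clinear_scale[OF P(1)] scaleC_zero_right)
    moreover have "P (x k) = x k" by (rule P(2)) (simp add: joint_eigenspace_def eig)
    ultimately show False using nz by simp
  qed
  moreover obtain D where "finite D" "cspan D = (UNIV :: 'g set)" using finite_spanning by blast
  ultimately have "finite (range x)" using complex_vector.independent_span_bound by blast
  then show False using finite_imageD[OF _ injx] by simp
qed

text \<open>By independence the expansion of \<alpha>_j - \<alpha>_i in simple roots is unique; it
  has the coefficients 1 and -1, while a root has coefficients of one sign.\<close>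

lemma simple_roots_difference_not_root:
  assumes "i \<noteq> j" "x \<in> root_space br \<hh> (\<lambda>k. - \<alpha> i k + \<alpha> j k)"
  shows "x = 0"
proof (rule ccontr)
  assume nz: "x \<noteq> 0"
  let ?\<beta> = "\<lambda>k. - \<alpha> i k + \<alpha> j k"
  define \<delta> :: "'i \<Rightarrow> complex" where "\<delta> = (\<lambda>l. if l = i then -1 else if l = j then 1 else 0)"
  have \<delta>: "?\<beta> y = (\<Sum>l\<in>UNIV. \<delta> l * \<alpha> l y)" for y
  proof -
    have "(\<Sum>l\<in>UNIV. \<delta> l * \<alpha> l y)
        = (\<Sum>l\<in>UNIV. (if l = i then - \<alpha> i y else 0) + (if l = j then \<alpha> j y else 0))"
      by (rule sum.cong) (use assms(1) in \<open>auto simp: \<delta>_def\<close>)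
    then show ?thesis by (simp add: sum.distrib)
  qed
  have "\<exists>y\<in>\<hh>. ?\<beta> y \<noteq> 0"
    using simple_roots_independent[of \<delta> i] by (metis \<delta> \<delta>_def neg_equal_0_iff_equal one_neq_zero)
  then have "is_root br \<hh> ?\<beta>" using nz assms(2) by (auto simp: is_root_def)
  then obtain n :: "'i \<Rightarrow> int" where n: "\<And>y. y \<in> \<hh> \<Longrightarrow> ?\<beta> y = (\<Sum>l\<in>UNIV. of_int (n l) * \<alpha> l y)"
    "(\<forall>l. n l \<ge> 0) \<or> (\<forall>l. n l \<le> 0)"
    using root_simple_combination by blast
  have "(\<Sum>l\<in>UNIV. (of_int (n l) - \<delta> l) * \<alpha> l y) = 0" if "y \<in> \<hh>" for y
    using n(1)[OF that] \<delta>[of y] by (simp add: left_diff_distrib sum_subtractf)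
  from simple_roots_independent[OF this] have "of_int (n l) = \<delta> l" for l
    by (metis eq_iff_diff_eq_0)
  from this[of i] this[of j] have "of_int (n i) = (-1::complex)" "of_int (n j) = (1::complex)"
    using assms(1) by (simp_all add: \<delta>_def)
  then have "n i = -1" "n j = 1" using of_int_eq_iff[where ?'a = complex]
    by (metis of_int_1 of_int_minus)+
  then show False using n(2) by (metis neg_0_le_iff_le not_one_le_zero)
qed

text \<open>
  By \<open>simple_roots_difference_not_root\<close> a vector of weight \<open>\<alpha> j\<close> is a lowest weight vector for the
  \<open>sl\<^sub>2\<close> of \<open>\<alpha> i\<close>. Positive lowest weight would make the string above it infinite.
\<close>

lemma cartan_integer_nonpos:
  fixes m :: int
  assumes ij: "i \<noteq> j"
    and m: "of_int m = 2 * dual_form \<hh> B (\<alpha> i) (\<alpha> j) / dual_form \<hh> B (\<alpha> i) (\<alpha> i)"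
  shows "m \<le> 0"
proof (rule ccontr)
  assume "\<not> m \<le> 0"
  obtain e where e: "e \<in> root_space br \<hh> (\<alpha> i)" "e \<noteq> 0" using root_vector[OF simple_root] .
  obtain f c where f: "f \<in> root_space br \<hh> (\<lambda>k. - \<alpha> i k)" "c \<noteq> 0" "br e f = c *\<^sub>C coroot (\<alpha> i)"
    using sl2_triple[OF simple_root e] .
  obtain v where v: "v \<in> root_space br \<hh> (\<alpha> j)" "v \<noteq> 0" using root_vector[OF simple_root] .
  define t where "t = br e f"
  obtain r where r: "r \<ge> 2" "dual_form \<hh> B (\<alpha> i) (\<alpha> i) = complex_of_real r"
    using root_length[OF simple_root] .
  \<comment> \<open>With this s, the element t = [e,f] is s times the standard Cartan element of the
    sl_2: \<alpha>_i(t) = 2s and \<alpha>_j(t) = m s.\<close>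
  define s where "s = c * complex_of_real r / 2"
  have s: "s \<noteq> 0" using f(2) r(1) by (simp add: s_def)
  have t\<hh>: "t \<in> \<hh>"
    using coroot(1)[OF simple_root] \<hh>_subspace by (simp add: t_def f(3) complex_vector.subspace_scale)
  have B\<alpha>: "\<alpha> l t = c * dual_form \<hh> B (\<alpha> i) (\<alpha> l)" for l
    by (simp add: t_def f(3) root_linear(2)[OF simple_root] coroot(1)[OF simple_root]
        coroot(2)[OF simple_root, symmetric] dual_form_coroot B_sym)
  have \<alpha>i: "\<alpha> i t = 2 * s" by (simp add: B\<alpha> r s_def)
  have \<alpha>j: "\<alpha> j t = of_int m * s" using m r by (simp add: B\<alpha> s_def)
  define x where "x n = ((br e) ^^ n) v" for n
  have x0: "x 0 = v" and xS: "x (Suc n) = br e (x n)" for n by (simp_all add: x_def)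
  have x_wt: "x n \<in> root_space br \<hh> (\<lambda>k. of_nat n * \<alpha> i k + \<alpha> j k)" for n
  proof (induction n)
    case 0
    then show ?case using v by (simp add: x0)
  next
    case (Suc n)
    show ?case using root_space_bracket[OF e(1) Suc] by (simp add: xS algebra_simps)
  qed
  have eig: "br t (x n) = (of_int (m + 2 * int n) * s) *\<^sub>C x n" for n
    using x_wt[of n] t\<hh> by (simp add: root_space_def \<alpha>i \<alpha>j algebra_simps)
  \<comment> \<open>The lowest weight version of the sl_2 string formula, f e^(n+1) v = -(n+1)(m+n)
    e^n v, with the scaling s.\<close>
  have fx: "br f (x (Suc n)) = - (of_int (int (Suc n) * (m + int n)) * s) *\<^sub>C x n" for n
  proof (induction n)
    case 0
    have "br f v = 0"
      by (rule simple_roots_difference_not_root[OF ij]) (use root_space_bracket[OF f(1) v(1)] in simp)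
    then have "br f (x (Suc 0)) = br (br f e) v"
      by (simp add: xS x0 jacobi[of f e v] clinear_zero[OF br_linear_right])
    also have "\<dots> = - br t v"
      using br_anti[of f e] by (simp add: t_def clinear_minus[OF br_linear_left])
    finally show ?case using eig[of 0] by (simp add: x0 scaleC_minus_left)
  next
    case (Suc n)
    have "br f (x (Suc (Suc n))) = br (br f e) (x (Suc n)) + br e (br f (x (Suc n)))"
      by (simp only: xS[of "Suc n"] jacobi[of f e "x (Suc n)"])
    also have "br (br f e) (x (Suc n)) = - br t (x (Suc n))"
      using br_anti[of f e] by (simp add: t_def clinear_minus[OF br_linear_left])
    also have "br e (br f (x (Suc n))) = - (of_int (int (Suc n) * (m + int n)) * s) *\<^sub>C x (Suc n)"
      by (simp only: Suc clinear_scale[OF br_linear_right] xS[symmetric])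
    also have "- br t (x (Suc n)) + - (of_int (int (Suc n) * (m + int n)) * s) *\<^sub>C x (Suc n)
       = - ((of_int (m + 2 * int (Suc n)) * s) + of_int (int (Suc n) * (m + int n)) * s) *\<^sub>C x (Suc n)"
      by (simp only: eig scaleC_minus_left minus_add_distrib scaleC_add_left)
    also have "(of_int (m + 2 * int (Suc n)) * s) + of_int (int (Suc n) * (m + int n)) * s
       = of_int (int (Suc (Suc n)) * (m + int (Suc n))) * s"
      by (simp add: algebra_simps)
    finally show ?case .
  qed
  have "x n \<noteq> 0" for n
  proof (induction n)
    case 0
    then show ?case using v by (simp add: x0)
  next
    case (Suc n)
    \<comment> \<open>As m > 0, the scalar (n+1)(m+n) never vanishes, so the string does not
      terminate.\<close>
    have "int (Suc n) * (m + int n) \<noteq> 0" using \<open>\<not> m \<le> 0\<close> by simp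
    then have "of_int (int (Suc n) * (m + int n)) * s \<noteq> 0"
      using s by (simp only: mult_eq_0_iff of_int_eq_0_iff) simp
    then have "br f (x (Suc n)) \<noteq> 0" using Suc unfolding fx by simp
    then show ?case using clinear_zero[OF br_linear_right[of f]] by metis
  qed
  moreover have "inj (\<lambda>n. of_int (m + 2 * int n) * s)"
    using s by (intro injI) (simp only: mult_cancel_right of_int_eq_iff, simp)
  ultimately show False
    using no_infinite_eigenvector_family[OF br_linear_right, of t x "\<lambda>n. of_int (m + 2 * int n) * s"]
      eig by blast
qed

end

section \<open>Gaussian binomial coefficients and Serre elements\<close>

lemma q_fact_Suc: "q_fact v (Suc n) = q_fact v n * q_int v (Suc n)"
  by (simp add: q_fact_def)

lemma q_fact_nonzero: "(\<And>k. k > 0 \<Longrightarrow> q_int v k \<noteq> 0) \<Longrightarrow> q_fact v n \<noteq> 0"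
  by (simp add: q_fact_def)

lemma q_int_inverse: "q_int (inverse v) n = q_int v n"
proof -
  have "q_int (inverse v) n = - (v ^ n - inverse v ^ n) / - (v - inverse v)" by (simp add: q_int_def)
  then show ?thesis by (simp only: minus_divide_divide q_int_def)
qed

lemma q_binom_inverse: "q_binom (inverse v) n k = q_binom v n k"
  by (simp add: q_binom_def q_fact_def q_int_inverse)

lemma q_int_add:
  assumes "v \<noteq> 0" shows "q_int v (a + b) = v ^ b * q_int v a + inverse v ^ a * q_int v b"
proof -
  have "v ^ (a + b) - inverse v ^ (a + b)
      = v ^ b * (v ^ a - inverse v ^ a) + inverse v ^ a * (v ^ b - inverse v ^ b)"
    by (simp add: algebra_simps power_add)
  then show ?thesis by (simp add: q_int_def add_divide_distrib)
qed

lemma q_binom_0: "(\<And>k. k > 0 \<Longrightarrow> q_int v k \<noteq> 0) \<Longrightarrow> q_binom v n 0 = 1"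
  and q_binom_self: "(\<And>k. k > 0 \<Longrightarrow> q_int v k \<noteq> 0) \<Longrightarrow> q_binom v n n = 1"
  using q_fact_nonzero[of v n] by (simp_all add: q_binom_def q_fact_def)

text \<open>Divide [n+1] = v^(r+1) [n-r] + v^(-(n-r)) [r+1] by the common factorials.\<close>

lemma q_binom_pascal:
  assumes v: "v \<noteq> 0" and nz: "\<And>k. k > 0 \<Longrightarrow> q_int v k \<noteq> 0" and "r < n"
  shows "q_binom v (Suc n) (Suc r) = v ^ Suc r * q_binom v n (Suc r) + inverse v ^ (n - r) * q_binom v n r"
proof -
  obtain k where k: "n - r = Suc k" "n - Suc r = k" "n = Suc k + r"
    using assms(3) by (metis Suc_diff_Suc add.commute le_add_diff_inverse less_imp_le_nat)
  have f: "q_fact v j \<noteq> 0" for j using q_fact_nonzero nz by blast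
  have *: "q_int v (Suc n) = v ^ Suc r * q_int v (Suc k) + inverse v ^ Suc k * q_int v (Suc r)"
    using q_int_add[OF v, of "Suc k" "Suc r"] k(3) by simp
  have "q_binom v (Suc n) (Suc r)
      = q_fact v n * q_int v (Suc n) / (q_fact v (Suc r) * q_fact v (Suc k))"
    using k by (simp add: q_binom_def q_fact_Suc)
  also have "\<dots> = v ^ Suc r * (q_fact v n / (q_fact v (Suc r) * q_fact v k))
      + inverse v ^ Suc k * (q_fact v n / (q_fact v r * q_fact v (Suc k)))"
    unfolding * q_fact_Suc using f[of r] f[of k] nz[of "Suc r"] nz[of "Suc k"]
    by (simp add: divide_simps) (simp add: algebra_simps)
  finally show ?thesis by (simp only: q_binom_def k(1,2))
qed

text \<open>The q-analogue of \<Sum>_{r <= s} (-1)^r C(n+1,r) = (-1)^s C(n,s). The closed form of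
  the partial sums lets the Pascal rule telescope; at s = n it cancels the one term that is left of
  the full sum.\<close>

lemma q_binom_alternating_partial_sum:
  assumes v: "v \<noteq> 0" and nz: "\<And>k. k > 0 \<Longrightarrow> q_int v k \<noteq> 0" and "s \<le> n"
  shows "(\<Sum>r=0..s. (-1) ^ r * q_binom v (Suc n) r * v ^ (n * r))
    = (-1) ^ s * v ^ (Suc n * s) * q_binom v n s"
  using assms(3)
proof (induction s)
  case 0
  then show ?case by (simp add: q_binom_0 nz)
next
  case (Suc r)
  have "n * Suc r = Suc n * r + (n - r)" using Suc.prems by (simp add: algebra_simps)
  then have "v ^ (n * Suc r) * inverse v ^ (n - r) = v ^ (Suc n * r) * (v ^ (n - r) * inverse v ^ (n - r))"
    by (simp only: power_add mult.assoc)
  then have "v ^ (n * Suc r) * inverse v ^ (n - r) = v ^ (Suc n * r)"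
    using v by (simp only: power_mult_distrib[symmetric]) simp
  moreover have "v ^ (n * Suc r) * v ^ Suc r = v ^ (Suc n * Suc r)"
    by (simp only: power_add[symmetric]) (simp add: algebra_simps)
  ultimately have *: "v ^ (n * Suc r) * q_binom v (Suc n) (Suc r)
      = v ^ (Suc n * Suc r) * q_binom v n (Suc r) + v ^ (Suc n * r) * q_binom v n r"
    using Suc.prems by (simp only: q_binom_pascal[OF v nz] Suc_le_eq distrib_left mult.assoc[symmetric])
  have "(\<Sum>r=0..Suc r. (-1) ^ r * q_binom v (Suc n) r * v ^ (n * r))
      = (-1) ^ r * v ^ (Suc n * r) * q_binom v n r
        - (-1) ^ r * (v ^ (n * Suc r) * q_binom v (Suc n) (Suc r))"
    using Suc by (simp only: sum.atLeast0_atMost_Suc Suc_leD) simp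
  also have "\<dots> = (-1) ^ Suc r * v ^ (Suc n * Suc r) * q_binom v n (Suc r)"
    by (simp only: *) (simp add: algebra_simps)
  finally show ?case .
qed

lemma q_binom_alternating_sum:
  assumes v: "v \<noteq> 0" and nz: "\<And>k. k > 0 \<Longrightarrow> q_int v k \<noteq> 0"
  shows "(\<Sum>r=0..Suc n. (-1) ^ r * q_binom v (Suc n) r * v ^ (n * r)) = 0"
  using q_binom_alternating_partial_sum[OF v nz order_refl, of n]
  by (simp add: q_binom_self nz mult.commute)

section \<open>Serre elements in an arbitrary algebra and what commutes with them\<close>

definition serre :: "complex \<Rightarrow> nat \<Rightarrow> 'a::complex_algebra_1 \<Rightarrow> 'a \<Rightarrow> 'a"
  where "serre v m x y = (\<Sum>r=0..m. ((-1) ^ r * q_binom v m r) *\<^sub>C (x ^ (m - r) * y * x ^ r))"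

lemmas scaleC_algebra_simps = mult_scaleC_left mult_scaleC_right scaleC_scaleC mult.assoc

lemma commute_power: "e * x = x * e \<Longrightarrow> e * x ^ n = x ^ n * e" for e x :: "'a::monoid_mult"
  by (metis power_commuting_commutes)

lemma scaled_commute_power:
  fixes k x :: "'a::complex_algebra_1"
  assumes "k * x = c *\<^sub>C (x * k)" shows "k * x ^ n = c ^ n *\<^sub>C (x ^ n * k)"
proof (induction n)
  case 0
  then show ?case by (simp add: scaleC_one)
next
  case (Suc n)
  have "k * x ^ Suc n = (k * x) * x ^ n" by (simp add: mult.assoc)
  also have "\<dots> = c *\<^sub>C (x * (k * x ^ n))" by (simp add: assms scaleC_algebra_simps)
  also have "\<dots> = c ^ Suc n *\<^sub>C (x ^ Suc n * k)" by (simp add: Suc scaleC_algebra_simps)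
  finally show ?case .
qed

lemma commute_inverse_scaled:
  fixes x :: "'a::complex_algebra_1"
  assumes "k * k' = 1" "k' * k = 1" "c \<noteq> 0" "k * x = c *\<^sub>C (x * k)"
  shows "k' * x = inverse c *\<^sub>C (x * k')"
proof -
  have "k' * x = inverse c *\<^sub>C (k' * (c *\<^sub>C (x * k)) * k')"
    using assms(1,3) by (simp add: scaleC_algebra_simps scaleC_one)
  also have "\<dots> = inverse c *\<^sub>C (k' * k * x * k')" by (simp add: assms(4)[symmetric] mult.assoc)
  finally show ?thesis using assms(2) by simp
qed

lemma serre_commute:
  fixes e x y :: "'a::complex_algebra_1"
  assumes ex: "e * x = x * e" and ey: "e * y = y * e"
  shows "e * serre v m x y = serre v m x y * e"
proof -
  have "e * (x ^ i * y * x ^ j) = x ^ i * y * x ^ j * e" for i j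
    using commute_power[OF ex, of i] commute_power[OF ex, of j] ey by (metis mult.assoc)
  then show ?thesis
    by (simp add: serre_def sum_distrib_left sum_distrib_right mult_scaleC_left mult_scaleC_right)
qed

lemma serre_scaled_commute:
  fixes e x y :: "'a::complex_algebra_1"
  assumes kx: "k * x = c *\<^sub>C (x * k)" and ky: "k * y = d *\<^sub>C (y * k)"
  shows "k * serre v m x y = (c ^ m * d) *\<^sub>C (serre v m x y * k)"
proof -
  have "k * (x ^ (m - r) * y * x ^ r) = (c ^ m * d) *\<^sub>C (x ^ (m - r) * y * x ^ r * k)" if "r \<le> m" for r
  proof -
    have "k * (x ^ (m - r) * y * x ^ r) = (k * x ^ (m - r)) * y * x ^ r" by (simp add: mult.assoc)
    also have "\<dots> = c ^ (m - r) *\<^sub>C (x ^ (m - r) * (k * y) * x ^ r)"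
      by (simp add: scaled_commute_power[OF kx] scaleC_algebra_simps)
    also have "\<dots> = (c ^ (m - r) * d) *\<^sub>C (x ^ (m - r) * y * (k * x ^ r))"
      by (simp add: ky scaleC_algebra_simps)
    also have "\<dots> = (c ^ (m - r) * d * c ^ r) *\<^sub>C (x ^ (m - r) * y * x ^ r * k)"
      by (simp add: scaled_commute_power[OF kx] scaleC_algebra_simps)
    also have "c ^ (m - r) * d * c ^ r = c ^ m * d"
      using that by (simp add: mult.commute mult.left_commute flip: power_add)
    finally show ?thesis .
  qed
  then show ?thesis
    by (simp add: serre_def sum_distrib_left sum_distrib_right mult_scaleC_left mult_scaleC_right
        complex_vector.scale_sum_right scaleC_scaleC mult.commute)
qed

text \<open>Models e = E_j, x = F_i, y = F_j (and the same with E and F exchanged). Moving k and k'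
  to the right across x^r gives v^(nr) and v^(-nr), so the extra terms are multiples of x^(n+1) k
  and x^(n+1) k' whose coefficients are the alternating sums for v and for its inverse.\<close>

lemma serre_commute_simple_y:
  fixes e x y k k' :: "'a::complex_algebra_1"
  assumes v: "v \<noteq> 0" and nz: "\<And>k. k > 0 \<Longrightarrow> q_int v k \<noteq> 0"
    and ex: "e * x = x * e" and ey: "e * y = y * e + c *\<^sub>C (k - k')"
    and kx: "k * x = v ^ n *\<^sub>C (x * k)" and kx': "k' * x = inverse v ^ n *\<^sub>C (x * k')"
  shows "e * serre v (Suc n) x y = serre v (Suc n) x y * e"
proof -
  let ?m = "Suc n"
  have term_eq: "e * (x ^ (?m - r) * y * x ^ r) = x ^ (?m - r) * y * x ^ r * e
      + (c * v ^ (n * r)) *\<^sub>C (x ^ ?m * k) - (c * inverse v ^ (n * r)) *\<^sub>C (x ^ ?m * k')"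
    if "r \<le> ?m" for r
  proof -
    have xx: "x ^ (?m - r) * (x ^ r * z) = x ^ ?m * z" for z
      using that by (simp add: mult.assoc[symmetric] power_add[symmetric])
    have "e * (x ^ (?m - r) * y * x ^ r) = (e * x ^ (?m - r)) * y * x ^ r" by (simp add: mult.assoc)
    also have "\<dots> = x ^ (?m - r) * (e * y) * x ^ r"
      by (simp only: commute_power[OF ex] mult.assoc)
    also have "\<dots> = x ^ (?m - r) * y * (e * x ^ r)
        + c *\<^sub>C (x ^ (?m - r) * (k * x ^ r)) - c *\<^sub>C (x ^ (?m - r) * (k' * x ^ r))"
      by (simp add: ey algebra_simps mult_scaleC_left mult_scaleC_right scaleC_diff_right)
    also have "x ^ (?m - r) * y * (e * x ^ r) = x ^ (?m - r) * y * x ^ r * e"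
      by (simp only: commute_power[OF ex] mult.assoc)
    also have "x ^ (?m - r) * (k * x ^ r) = v ^ (n * r) *\<^sub>C (x ^ ?m * k)"
      by (simp only: scaled_commute_power[OF kx] mult_scaleC_right xx power_mult)
    also have "x ^ (?m - r) * (k' * x ^ r) = inverse v ^ (n * r) *\<^sub>C (x ^ ?m * k')"
      by (simp only: scaled_commute_power[OF kx'] mult_scaleC_right xx power_mult)
    finally show ?thesis by (simp only: scaleC_scaleC)
  qed
  define w where "w r = (-1) ^ r * q_binom v ?m r" for r
  have "e * serre v ?m x y = (\<Sum>r=0..?m. w r *\<^sub>C (e * (x ^ (?m - r) * y * x ^ r)))"
    by (simp only: serre_def sum_distrib_left mult_scaleC_right w_def)
  also have "\<dots> = (\<Sum>r=0..?m. w r *\<^sub>C (x ^ (?m - r) * y * x ^ r * e)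
      + (c * (w r * v ^ (n * r))) *\<^sub>C (x ^ ?m * k)
      - (c * (w r * inverse v ^ (n * r))) *\<^sub>C (x ^ ?m * k'))"
    by (rule sum.cong[OF refl], subst term_eq)
      (simp_all add: scaleC_add_right scaleC_diff_right scaleC_scaleC mult.left_commute)
  also have "\<dots> = serre v ?m x y * e
      + (c * (\<Sum>r=0..?m. w r * v ^ (n * r))) *\<^sub>C (x ^ ?m * k)
      - (c * (\<Sum>r=0..?m. w r * inverse v ^ (n * r))) *\<^sub>C (x ^ ?m * k')"
    by (simp only: sum.distrib sum_subtractf complex_vector.scale_sum_left[symmetric]
        sum_distrib_left[symmetric] serre_def sum_distrib_right mult_scaleC_left w_def)
  also have "(\<Sum>r=0..?m. w r * v ^ (n * r)) = 0"
    unfolding w_def by (rule q_binom_alternating_sum[OF v nz])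
  also have "(\<Sum>r=0..?m. w r * inverse v ^ (n * r)) = 0"
    using q_binom_alternating_sum[of "inverse v" n] v nz
    by (simp only: w_def q_binom_inverse q_int_inverse) simp
  finally show ?thesis by (simp add: scaleC_zero_left)
qed

lemma q_int_Suc_scaled:
  assumes "v \<noteq> 0" "v - inverse v \<noteq> 0"
  shows "1 + q_int v (Suc p) * inverse v ^ (p + 2) = q_int v (Suc (Suc p)) * inverse v ^ Suc p"
    and "1 + q_int v (Suc p) * v ^ (p + 2) = q_int v (Suc (Suc p)) * v ^ Suc p"
proof -
  have 1: "1 + q_int u (Suc p) * inverse u ^ (p + 2) = q_int u (Suc (Suc p)) * inverse u ^ Suc p"
    if u: "u \<noteq> 0" "u - inverse u \<noteq> 0" for u
  proof -
    have "inverse u ^ Suc p * q_int u (Suc (Suc p))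
       = inverse u ^ Suc p * (u ^ Suc p * q_int u 1 + inverse u ^ 1 * q_int u (Suc p))"
      using q_int_add[OF u(1), of 1 "Suc p"] by simp
    also have "\<dots> = (inverse u ^ Suc p * u ^ Suc p) * q_int u 1 + q_int u (Suc p) * inverse u ^ (p + 2)"
      by (simp add: algebra_simps)
    also have "inverse u ^ Suc p * u ^ Suc p = 1" using u(1) by (simp only: power_mult_distrib[symmetric]) simp
    also have "q_int u 1 = 1" using u(2) by (simp add: q_int_def)
    finally show ?thesis by (simp add: mult.commute)
  qed
  show "1 + q_int v (Suc p) * inverse v ^ (p + 2) = q_int v (Suc (Suc p)) * inverse v ^ Suc p"
    using 1 assms by blast
  have "inverse v - v \<noteq> 0" using assms(2) by auto
  then show "1 + q_int v (Suc p) * v ^ (p + 2) = q_int v (Suc (Suc p)) * v ^ Suc p"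
    using 1[of "inverse v"] assms(1) unfolding q_int_inverse inverse_inverse_eq by simp
qed

text \<open>The quantum sl_2 formula for the commutator of E with a power of F, with k and k' in
  place of K and its inverse and the normalizing constant c left free.\<close>

lemma commutator_power:
  fixes e x k k' :: "'a::complex_algebra_1"
  assumes v: "v \<noteq> 0" "v - inverse v \<noteq> 0"
    and ex: "e * x = x * e + c *\<^sub>C (k - k')"
    and kx: "k * x = inverse v ^ 2 *\<^sub>C (x * k)" and kx': "k' * x = v ^ 2 *\<^sub>C (x * k')"
  shows "e * x ^ Suc p = x ^ Suc p * e
    + (c * q_int v (Suc p)) *\<^sub>C (x ^ p * (inverse v ^ p *\<^sub>C k - v ^ p *\<^sub>C k'))"
proof (induction p)
  case 0
  then show ?case using v(2) by (simp add: ex q_int_def scaleC_one)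
next
  case (Suc p)
  let ?X = "x ^ Suc p"
  have "e * x ^ Suc (Suc p) = (e * ?X) * x" by (simp only: power_Suc2[of x "Suc p"] mult.assoc)
  also have "\<dots> = ?X * (e * x)
      + (c * q_int v (Suc p)) *\<^sub>C (x ^ p * (inverse v ^ p *\<^sub>C (k * x) - v ^ p *\<^sub>C (k' * x)))"
    by (simp only: Suc distrib_right left_diff_distrib mult_scaleC_left mult.assoc)
  also have "x ^ p * (inverse v ^ p *\<^sub>C (k * x) - v ^ p *\<^sub>C (k' * x))
      = inverse v ^ (p + 2) *\<^sub>C (?X * k) - v ^ (p + 2) *\<^sub>C (?X * k')"
    by (simp only: kx kx' scaleC_scaleC right_diff_distrib mult_scaleC_right power_add
        mult.assoc[symmetric] power_Suc2)
  also have "?X * (e * x) = x ^ Suc (Suc p) * e + c *\<^sub>C (?X * k) - c *\<^sub>C (?X * k')"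
    by (simp only: ex distrib_left right_diff_distrib mult_scaleC_right scaleC_diff_right
        mult.assoc[symmetric] power_Suc2[of x "Suc p"]) simp
  also have "x ^ Suc (Suc p) * e + c *\<^sub>C (?X * k) - c *\<^sub>C (?X * k')
      + (c * q_int v (Suc p)) *\<^sub>C (inverse v ^ (p + 2) *\<^sub>C (?X * k) - v ^ (p + 2) *\<^sub>C (?X * k'))
    = x ^ Suc (Suc p) * e + (c * (1 + q_int v (Suc p) * inverse v ^ (p + 2))) *\<^sub>C (?X * k)
      - (c * (1 + q_int v (Suc p) * v ^ (p + 2))) *\<^sub>C (?X * k')"
    by (simp only: scaleC_diff_right scaleC_scaleC distrib_left scaleC_add_left mult.assoc)
      (simp add: algebra_simps)
  also have "\<dots> = x ^ Suc (Suc p) * e + (c * q_int v (Suc (Suc p))) *\<^sub>C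
      (?X * (inverse v ^ Suc p *\<^sub>C k - v ^ Suc p *\<^sub>C k'))"
    by (simp only: q_int_Suc_scaled[OF v] right_diff_distrib mult_scaleC_right scaleC_diff_right
        scaleC_scaleC mult.assoc) (simp only: add_diff_eq)
  finally show ?case .
qed

text \<open>Models e = E_i, x = F_i, y = F_j. The commutator of e with the powers on the left of y
  in term r and on the right of y in term r+1 are multiples of the same element \<open>G r\<close>,
  and the q-binomial coefficients make them cancel.\<close>

lemma serre_commute_simple_x:
  fixes e x y k k' :: "'a::complex_algebra_1"
  assumes v: "v \<noteq> 0" and nz: "\<And>k. k > 0 \<Longrightarrow> q_int v k \<noteq> 0"
    and ey: "e * y = y * e" and ex: "e * x = x * e + c *\<^sub>C (k - k')"
    and kx: "k * x = inverse v ^ 2 *\<^sub>C (x * k)" and kx': "k' * x = v ^ 2 *\<^sub>C (x * k')"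
    and ky: "k * y = v ^ n *\<^sub>C (y * k)" and ky': "k' * y = inverse v ^ n *\<^sub>C (y * k')"
  shows "e * serre v (Suc n) x y = serre v (Suc n) x y * e"
proof -
  let ?m = "Suc n"
  have v': "v - inverse v \<noteq> 0" using nz[of 1] by (auto simp: q_int_def)
  define D where "D p = (c * q_int v p) *\<^sub>C (x ^ (p - 1) * (inverse v ^ (p - 1) *\<^sub>C k - v ^ (p - 1) *\<^sub>C k'))"
    for p
  define G where "G r = c *\<^sub>C (x ^ (n - r) * y * x ^ r * (inverse v ^ r *\<^sub>C k - v ^ r *\<^sub>C k'))" for r
  have D: "e * x ^ p = x ^ p * e + D p" for p
    using commutator_power[OF v v' ex kx kx', of "p - 1"]
    by (cases p) (simp_all add: D_def q_int_def scaleC_zero_left)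
  have DG1: "D (?m - r) * y * x ^ r = q_int v (?m - r) *\<^sub>C G r" if rn: "r \<le> n" for r
  proof -
    obtain j where j: "n = r + j" using le_Suc_ex[OF rn] by blast
    \<comment> \<open>The prefactor of k' in \<open>D\<close> times the scalar from moving k' across
      y x^r; the product is the coefficient in \<open>G r\<close>. The inverse of v gives the same
      for k.\<close>
    have pw: "u ^ (n - r) * (inverse u ^ n * (u ^ 2) ^ r) = u ^ r" if "u \<noteq> 0" for u :: complex
    proof -
      have "u ^ (n - r) * (inverse u ^ n * (u ^ 2) ^ r)
          = (u ^ j * inverse u ^ j) * (u ^ r * inverse u ^ r) * u ^ r"
        by (simp add: j power_add power2_eq_square power_mult_distrib)
      then show ?thesis using that by (simp only: power_mult_distrib[symmetric]) simp
    qed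
    have pw': "inverse v ^ (n - r) * (v ^ n * (inverse v ^ 2) ^ r) = inverse v ^ r"
      using pw[of "inverse v"] v by (simp only: inverse_inverse_eq inverse_nonzero_iff_nonzero not_False_eq_True)
    have kyx: "k * (y * x ^ r) = (v ^ n * (inverse v ^ 2) ^ r) *\<^sub>C (y * x ^ r * k)"
    proof -
      have "k * (y * x ^ r) = v ^ n *\<^sub>C (y * (k * x ^ r))"
        by (simp only: mult.assoc[symmetric] ky) (simp only: scaleC_algebra_simps)
      then show ?thesis by (simp only: scaled_commute_power[OF kx] scaleC_algebra_simps)
    qed
    have kyx': "k' * (y * x ^ r) = (inverse v ^ n * (v ^ 2) ^ r) *\<^sub>C (y * x ^ r * k')"
    proof -
      have "k' * (y * x ^ r) = inverse v ^ n *\<^sub>C (y * (k' * x ^ r))"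
        by (simp only: mult.assoc[symmetric] ky') (simp only: scaleC_algebra_simps)
      then show ?thesis by (simp only: scaled_commute_power[OF kx'] scaleC_algebra_simps)
    qed
    have mr: "?m - r - 1 = n - r" by simp
    have "D (?m - r) * y * x ^ r = (c * q_int v (?m - r)) *\<^sub>C (x ^ (n - r)
        * (inverse v ^ (n - r) *\<^sub>C (k * (y * x ^ r)) - v ^ (n - r) *\<^sub>C (k' * (y * x ^ r))))"
      unfolding D_def mr by (simp only: scaleC_algebra_simps left_diff_distrib)
    also have "\<dots> = (c * q_int v (?m - r)) *\<^sub>C (x ^ (n - r)
        * (inverse v ^ r *\<^sub>C (y * x ^ r * k) - v ^ r *\<^sub>C (y * x ^ r * k')))"
      by (simp only: kyx kyx' scaleC_scaleC pw[OF v] pw')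
    also have "\<dots> = q_int v (?m - r) *\<^sub>C G r"
      by (simp only: G_def scaleC_algebra_simps right_diff_distrib mult.commute[of c])
    finally show ?thesis .
  qed
  have DG2: "x ^ (?m - Suc r) * y * D (Suc r) = q_int v (Suc r) *\<^sub>C G r" for r
    by (simp add: D_def G_def scaleC_algebra_simps mult.commute)
  have D0: "D 0 = 0" by (simp add: D_def q_int_def scaleC_zero_left)
  define w where "w r = (-1) ^ r * q_binom v ?m r" for r
  \<comment> \<open>Absorption identity: both [m-r] times the r-th and [r+1] times the (r+1)-st
    binomial coefficient equal [m]! / ([r]! [m-r-1]!), and the signs alternate.\<close>
  have w: "w r * q_int v (?m - r) + w (Suc r) * q_int v (Suc r) = 0" if "r \<le> n" for r
  proof -
    have f: "q_fact v j \<noteq> 0" for j using q_fact_nonzero nz by blast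
    have "?m - r = Suc (n - r)" "?m - Suc r = n - r" using that by simp_all
    then show ?thesis
      using f[of "n - r"] f[of r] nz[of "Suc r"] nz[of "Suc (n - r)"]
      by (simp add: w_def q_binom_def q_fact_Suc[of v r] q_fact_Suc[of v "n - r"])
  qed
  have "e * (x ^ (?m - r) * y * x ^ r)
      = x ^ (?m - r) * y * x ^ r * e + (D (?m - r) * y * x ^ r + x ^ (?m - r) * y * D r)" for r
  proof -
    have "e * (x ^ (?m - r) * y * x ^ r) = (e * x ^ (?m - r)) * y * x ^ r" by (simp only: mult.assoc)
    also have "\<dots> = x ^ (?m - r) * (e * y) * x ^ r + D (?m - r) * y * x ^ r"
      by (simp only: D[of "?m - r"] distrib_right mult.assoc)
    also have "x ^ (?m - r) * (e * y) * x ^ r = x ^ (?m - r) * y * (e * x ^ r)"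
      by (simp only: ey mult.assoc)
    finally show ?thesis by (simp only: D[of r] distrib_left mult.assoc) (simp add: add_ac)
  qed
  then have "e * serre v ?m x y = (\<Sum>r=0..?m. w r *\<^sub>C (x ^ (?m - r) * y * x ^ r * e)
      + (w r *\<^sub>C (D (?m - r) * y * x ^ r) + w r *\<^sub>C (x ^ (?m - r) * y * D r)))"
    by (simp only: serre_def sum_distrib_left mult_scaleC_right w_def scaleC_add_right)
  also have "\<dots> = serre v ?m x y * e + ((\<Sum>r=0..?m. w r *\<^sub>C (D (?m - r) * y * x ^ r))
      + (\<Sum>r=0..?m. w r *\<^sub>C (x ^ (?m - r) * y * D r)))"
    by (simp only: sum.distrib serre_def sum_distrib_right mult_scaleC_left w_def)
  also have "(\<Sum>r=0..?m. w r *\<^sub>C (D (?m - r) * y * x ^ r))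
      = (\<Sum>r=0..n. (w r * q_int v (?m - r)) *\<^sub>C G r)"
    by (simp only: sum.atLeast0_atMost_Suc)
      (simp add: D0 scaleC_zero_right, intro sum.cong refl, simp add: DG1 scaleC_scaleC)
  also have "(\<Sum>r=0..?m. w r *\<^sub>C (x ^ (?m - r) * y * D r))
      = (\<Sum>r=0..n. (w (Suc r) * q_int v (Suc r)) *\<^sub>C G r)"
    by (simp only: sum.atLeast0_atMost_Suc_shift DG2 D0 o_def scaleC_scaleC mult_zero_right scaleC_zero_right) simp
  also have "(\<Sum>r=0..n. (w r * q_int v (?m - r)) *\<^sub>C G r)
      + (\<Sum>r=0..n. (w (Suc r) * q_int v (Suc r)) *\<^sub>C G r) = 0"
    using w by (simp add: sum.distrib[symmetric] scaleC_add_left[symmetric] scaleC_zero_left)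
  finally show ?thesis by simp
qed

section \<open>Evaluation of the free algebra\<close>

lemma word_eval_add: "word_eval g (u + w) = word_eval g u * word_eval g w"
  by (cases u; cases w) simp

lemma fa_eval_superset:
  assumes "finite A" "Poly_Mapping.keys p \<subseteq> A"
  shows "fa_eval g p = (\<Sum>w\<in>A. Poly_Mapping.lookup p w *\<^sub>C word_eval g w)"
  unfolding fa_eval_def
  by (rule sum.mono_neutral_left) (use assms in \<open>auto simp: in_keys_iff scaleC_zero_left\<close>)

lemma fa_eval_add: "fa_eval g (p + r) = fa_eval g p + fa_eval g r"
proof -
  let ?A = "Poly_Mapping.keys p \<union> Poly_Mapping.keys r"
  have "Poly_Mapping.keys (p + r) \<subseteq> ?A" by (rule keys_add)
  then show ?thesis
    by (simp add: fa_eval_superset[of ?A] lookup_add scaleC_add_left sum.distrib)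
qed

lemma fa_eval_diff: "fa_eval g (p - r) = fa_eval g p - fa_eval g r"
  using fa_eval_add[of g "p - r" r] by simp

lemma fa_eval_single: "fa_eval g (Poly_Mapping.single w c) = c *\<^sub>C word_eval g w"
  by (cases "c = 0") (simp_all add: fa_eval_def scaleC_zero_left)

lemma fa_eval_mult: "fa_eval g (p * r) = fa_eval g p * fa_eval g r"
proof (induction p rule: poly_mapping_induct_singles)
  case (single k c)
  show ?case
    by (induction r rule: poly_mapping_induct_singles)
      (simp_all add: mult_single fa_eval_single fa_eval_add word_eval_add distrib_left
        scaleC_algebra_simps)
qed (simp add: distrib_right fa_eval_add)

lemma fa_eval_zero: "fa_eval g 0 = 0"
  by (simp add: fa_eval_def)

lemma fa_eval_var: "fa_eval g (fa_var s) = g s"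
  by (simp add: fa_var_def fa_eval_single scaleC_one)

lemma fa_eval_const: "fa_eval g (fa_const c) = c *\<^sub>C 1"
  by (simp add: fa_const_def fa_eval_single zero_free_word_def)

lemma fa_eval_one: "fa_eval g 1 = 1"
  using fa_eval_const[of g 1] by (simp add: fa_const_def scaleC_one)

lemma fa_eval_power: "fa_eval g (p ^ n) = fa_eval g p ^ n"
  by (induction n) (simp_all add: fa_eval_one fa_eval_mult)

lemma fa_eval_sum: "fa_eval g (\<Sum>i\<in>A. p i) = (\<Sum>i\<in>A. fa_eval g (p i))"
  by (induction A rule: infinite_finite_induct) (simp_all add: fa_eval_zero fa_eval_add)

lemma fa_eval_serre: "fa_eval g (serre_element v m p r) = serre v m (fa_eval g p) (fa_eval g r)"
  by (simp add: serre_element_def serre_def fa_eval_sum fa_eval_mult fa_eval_const fa_eval_power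
      scaleC_algebra_simps)

lemmas fa_eval_simps = fa_eval_add fa_eval_diff fa_eval_mult fa_eval_var fa_eval_const fa_eval_one
  fa_eval_serre

section \<open>Verma modules\<close>

text \<open>The interface between the Lie algebra and the quantum group. Nondegeneracy is stated
  over the integers, since it is applied to exponent vectors of products of the K_i.\<close>

locale quantum_data =
  fixes q :: complex and d :: "'i::finite \<Rightarrow> nat" and a :: "'i \<Rightarrow> 'i \<Rightarrow> int"
  assumes q_nonzero: "q \<noteq> 0" and q_not_root: "\<And>n::nat. n > 0 \<Longrightarrow> q ^ n \<noteq> 1"
    and d_pos: "d i > 0" and a_diag: "a i i = 2" and a_off_diag: "i \<noteq> j \<Longrightarrow> a i j \<le> 0"
    and symmetrized: "int (d i) * a i j = int (d j) * a j i"
    and symmetrized_nondegenerate: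
      "(\<And>i. (\<Sum>j\<in>UNIV. c j * (int (d i) * a i j)) = 0) \<Longrightarrow> c j = (0 :: int)"
begin

text \<open>The inner product (\<alpha>_i, \<alpha>_j); all commutation scalars become powers of q
  with these exponents.\<close>

definition b :: "'i \<Rightarrow> 'i \<Rightarrow> int"
  where "b i j = int (d i) * a i j"

lemma b_sym: "b i j = b j i"
  using symmetrized by (simp add: b_def)

lemma b_diag: "b i i = 2 * int (d i)"
  by (simp add: b_def a_diag)

lemma power_a: "(q ^ d i) powi a i j = q powi b i j"
  by (simp add: b_def power_int_mult)

lemma power_minus_a: "(q ^ d i) powi (- a i j) = q powi (- b i j)"
  by (simp only: b_def power_int_mult mult_minus_right[symmetric] power_int_of_nat)

lemma q_powi_eq_1_iff: "q powi k = 1 \<longleftrightarrow> k = 0"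
proof
  assume *: "q powi k = 1"
  show "k = 0"
  proof (rule ccontr)
    assume "k \<noteq> 0"
    moreover have "q ^ nat \<bar>k\<bar> = 1"
      using * by (cases "k \<ge> 0") (simp_all add: power_int_def power_inverse)
    ultimately show False using q_not_root[of "nat \<bar>k\<bar>"] by simp
  qed
qed simp

lemma q_powi_inject: "q powi k = q powi l \<longleftrightarrow> k = l"
  using q_powi_eq_1_iff[of "k - l"] q_nonzero by (simp add: power_int_diff)

lemma q_int_nonzero: "n > 0 \<Longrightarrow> q_int (q ^ d i) n \<noteq> 0"
proof -
  have *: "(q ^ d i) ^ n - inverse (q ^ d i) ^ n \<noteq> 0" if "n > 0" for n
  proof
    assume "(q ^ d i) ^ n - inverse (q ^ d i) ^ n = 0"
    then have "q powi (int (d i) * int n) = q powi (- (int (d i) * int n))"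
      by (simp add: power_int_minus power_inverse power_mult power_int_mult)
    then show False unfolding q_powi_inject using that d_pos[of i] by simp
  qed
  show "n > 0 \<Longrightarrow> q_int (q ^ d i) n \<noteq> 0"
    using *[of n] *[of 1] by (simp add: q_int_def)
qed

lemma qi_diff_nonzero: "q ^ d i - inverse (q ^ d i) \<noteq> 0"
  using q_int_nonzero[of 1 i] by (auto simp: q_int_def)

end

text \<open>Operators form a type of their own so that \<open>fa_eval\<close> can take values in
  them. Vectors are arbitrary functions on words, so no finite support condition has to be
  preserved.\<close>

typedef 'i endo =
  "{f :: ('i list \<Rightarrow> complex) \<Rightarrow> ('i list \<Rightarrow> complex).
    (\<forall>x y. f (\<lambda>w. x w + y w) = (\<lambda>w. f x w + f y w)) \<and> (\<forall>c x. f (\<lambda>w. c * x w) = (\<lambda>w. c * f x w))}"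
  morphisms app Endo
  by (rule exI[of _ "\<lambda>x. x"]) simp

setup_lifting type_definition_endo

instantiation endo :: (type) complex_algebra_1
begin

lift_definition zero_endo :: "'a endo" is "\<lambda>_ _. 0" by simp
lift_definition one_endo :: "'a endo" is "\<lambda>x. x" by simp
lift_definition plus_endo :: "'a endo \<Rightarrow> 'a endo \<Rightarrow> 'a endo" is "\<lambda>f g x w. f x w + g x w"
  by (simp add: algebra_simps)
lift_definition minus_endo :: "'a endo \<Rightarrow> 'a endo \<Rightarrow> 'a endo" is "\<lambda>f g x w. f x w - g x w"
  by (simp add: algebra_simps)
lift_definition uminus_endo :: "'a endo \<Rightarrow> 'a endo" is "\<lambda>f x w. - f x w"
  by (simp add: algebra_simps)
lift_definition times_endo :: "'a endo \<Rightarrow> 'a endo \<Rightarrow> 'a endo" is "\<lambda>f g x. f (g x)" by simp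
lift_definition scaleC_endo :: "complex \<Rightarrow> 'a endo \<Rightarrow> 'a endo" is "\<lambda>c f x w. c * f x w"
  by (simp add: algebra_simps)

instance
proof
  fix x y z :: "'a endo" and c e :: complex
  show "c *\<^sub>C (x + y) = c *\<^sub>C x + c *\<^sub>C y" by transfer (simp add: algebra_simps)
  show "(c + e) *\<^sub>C x = c *\<^sub>C x + e *\<^sub>C x" by transfer (simp add: algebra_simps)
  show "c *\<^sub>C e *\<^sub>C x = (c * e) *\<^sub>C x" by transfer (simp add: algebra_simps)
  show "1 *\<^sub>C x = x" by transfer simp
  show "x + y + z = x + (y + z)" by transfer (simp add: algebra_simps)
  show "x + y = y + x" by transfer (simp add: algebra_simps)
  show "0 + x = x" by transfer simp
  show "- x + x = 0" by transfer simp
  show "x - y = x + - y" by transfer simp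
  show "x * y * z = x * (y * z)" by transfer simp
  show "(x + y) * z = x * z + y * z" by transfer simp
  show "x * (y + z) = x * y + x * z" by transfer simp
  show "1 * x = x" by transfer simp
  show "x * 1 = x" by transfer simp
  show "(c *\<^sub>C x) * y = c *\<^sub>C (x * y)" by transfer simp
  show "x * (c *\<^sub>C y) = c *\<^sub>C (x * y)" by transfer simp
  show "(0 :: 'a endo) \<noteq> 1" by transfer (metis zero_neq_one)
qed

end

lemma app_simps [simp]:
  "app 0 f = (\<lambda>_. 0)" "app 1 f = f" "app (x + y) f = (\<lambda>w. app x f w + app y f w)"
  "app (x - y) f = (\<lambda>w. app x f w - app y f w)" "app (x * y) f = app x (app y f)"
  "app (c *\<^sub>C x) f = (\<lambda>w. c * app x f w)" "app (- x) f = (\<lambda>w. - app x f w)"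
  by (transfer, simp)+

lemma endo_eqI: "(\<And>f w. app x f w = app y f w) \<Longrightarrow> x = y"
  by (metis app_inject ext)

lemma app_add: "app x (\<lambda>w. f w + g w) = (\<lambda>w. app x f w + app x g w)"
  and app_scale: "app x (\<lambda>w. c * f w) = (\<lambda>w. c * app x f w)"
  using app[of x] by auto

lemma app_zero: "app x (\<lambda>w. 0) = (\<lambda>w. 0)"
  using app_scale[of x 0 "\<lambda>_. 0"] by simp

lemma app_sum_right: "app x (\<lambda>w. \<Sum>i\<in>A. f i w) = (\<lambda>w. \<Sum>i\<in>A. app x (f i) w)"
  by (induction A rule: infinite_finite_induct) (simp_all add: app_zero app_add)

lemma app_sum_left: "app (\<Sum>i\<in>A. x i) f = (\<lambda>w. \<Sum>i\<in>A. app (x i) f w)"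
  by (induction A rule: infinite_finite_induct) simp_all

section \<open>The generators as operators on functions of words\<close>

context quantum_data
begin

text \<open>The eigenvalue of K_i on F_w v when K_i v = t_i v.\<close>

primrec wt_scalar :: "('i \<Rightarrow> complex) \<Rightarrow> 'i \<Rightarrow> 'i list \<Rightarrow> complex"
  where "wt_scalar t i [] = t i"
  | "wt_scalar t i (j # w) = wt_scalar t i w * q powi (- b i j)"

definition bracket_scalar :: "('i \<Rightarrow> complex) \<Rightarrow> 'i \<Rightarrow> 'i list \<Rightarrow> complex"
  where "bracket_scalar t i w =
    1 / (q ^ d i - inverse (q ^ d i)) * (wt_scalar t i w - inverse (wt_scalar t i w))"

text \<open>
  A function \<open>f\<close> on words stands for the (possibly infinite) combination of the vectors
  \<open>F\<^sub>w v\<close> with coefficients \<open>f w\<close>, where \<open>v\<close> is the highest weight vector, \<open>K\<^sub>i v = t\<^sub>i v\<close>,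
  of the Verma module of the algebra without Serre relations. The recursion below moves \<open>E\<^sub>i\<close> past
  the letters of \<open>w\<close>: it passes \<open>F\<^sub>j\<close>, and each cancelled letter \<open>F\<^sub>i\<close> leaves \<open>[E\<^sub>i, F\<^sub>i]\<close>, which
  acts on the rest of the word by \<open>bracket_scalar\<close>.
\<close>

primrec raise :: "('i \<Rightarrow> complex) \<Rightarrow> 'i \<Rightarrow> 'i list \<Rightarrow> ('i list \<Rightarrow> complex) \<Rightarrow> complex"
  where "raise t i [] f = bracket_scalar t i [] * f [i]"
  | "raise t i (j # w) f = bracket_scalar t i (j # w) * f (i # j # w) + raise t i w (\<lambda>u. f (j # u))"

lemma raise_add: "raise t i w (\<lambda>u. f u + g u) = raise t i w f + raise t i w g"
  by (induction w arbitrary: f g) (simp_all add: algebra_simps)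

lemma raise_scale: "raise t i w (\<lambda>u. c * f u) = c * raise t i w f"
  by (induction w arbitrary: f) (simp_all add: algebra_simps)

definition opE :: "('i \<Rightarrow> complex) \<Rightarrow> 'i \<Rightarrow> 'i endo"
  where "opE t i = Endo (\<lambda>f w. raise t i w f)"

definition opF :: "'i \<Rightarrow> 'i endo"
  where "opF i = Endo (\<lambda>f w. case w of [] \<Rightarrow> 0 | j # u \<Rightarrow> if j = i then f u else 0)"

definition opK :: "('i \<Rightarrow> complex) \<Rightarrow> 'i \<Rightarrow> 'i endo"
  where "opK t i = Endo (\<lambda>f w. wt_scalar t i w * f w)"

definition opKinv :: "('i \<Rightarrow> complex) \<Rightarrow> 'i \<Rightarrow> 'i endo"
  where "opKinv t i = Endo (\<lambda>f w. inverse (wt_scalar t i w) * f w)"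

lemma app_opE: "app (opE t i) f w = raise t i w f"
  unfolding opE_def by (subst Endo_inverse) (simp_all add: raise_add raise_scale)

lemma app_opF: "app (opF i) f w = (case w of [] \<Rightarrow> 0 | j # u \<Rightarrow> if j = i then f u else 0)"
  unfolding opF_def by (subst Endo_inverse) (auto split: list.splits)

lemma app_opK: "app (opK t i) f w = wt_scalar t i w * f w"
  unfolding opK_def by (subst Endo_inverse) (simp_all add: algebra_simps)

lemma app_opKinv: "app (opKinv t i) f w = inverse (wt_scalar t i w) * f w"
  unfolding opKinv_def by (subst Endo_inverse) (simp_all add: algebra_simps)

definition vac :: "'i list \<Rightarrow> complex"
  where "vac w = (if w = [] then 1 else 0)"

lemma raise_vanishing: "f = (\<lambda>_. 0) \<Longrightarrow> raise t i w f = 0"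
  by (induction w arbitrary: f) simp_all

lemma opE_vac: "app (opE t i) vac = (\<lambda>_. 0)"
proof
  show "app (opE t i) vac w = 0" for w
    by (cases w) (simp_all add: app_opE vac_def raise_vanishing)
qed

lemma opF_Nil: "app (opF i) f [] = 0"
  by (simp add: app_opF)

context
  fixes t :: "'i \<Rightarrow> complex"
  assumes t: "\<And>i. t i \<noteq> 0"
begin

lemma wt_scalar_nonzero: "wt_scalar t i w \<noteq> 0"
  using t q_nonzero by (induction w) simp_all

lemma opK_inverse: "opK t i * opKinv t i = 1" "opKinv t i * opK t i = 1"
  by (rule endo_eqI, simp add: app_opK app_opKinv wt_scalar_nonzero)+

lemma opK_commute: "opK t i * opK t j = opK t j * opK t i"
  by (rule endo_eqI) (simp add: app_opK)

lemma opK_opF: "opK t i * opF j = q powi (- b i j) *\<^sub>C (opF j * opK t i)"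
  by (rule endo_eqI) (simp add: app_opK app_opF split: list.splits)

text \<open>\<open>raise t j w f\<close> combines the values of f at the words obtained from w by
  inserting one letter j. Such an insertion multiplies the eigenvalue of K_i by q^(-b_ij), which the
  factor on the right compensates.\<close>

lemma raise_wt_scalar:
  "wt_scalar t i w * raise t j w f = q powi b i j * raise t j w (\<lambda>u. wt_scalar t i u * f u)"
proof (induction w arbitrary: f)
  case Nil
  have "q powi b i j * q powi (- b i j) = 1" using q_nonzero by (simp add: power_int_minus)
  then show ?case by (simp add: mult.left_commute mult.assoc)
next
  case (Cons k w)
  have 1: "q powi b i j * q powi (- b i j) = 1" using q_nonzero by (simp add: power_int_minus)
  have "q powi b i j * raise t j (k # w) (\<lambda>u. wt_scalar t i u * f u)
    = (q powi b i j * q powi (- b i j)) * (bracket_scalar t j (k # w) * wt_scalar t i (k # w) * f (j # k # w))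
     + q powi (- b i k) * (q powi b i j * raise t j w (\<lambda>u. wt_scalar t i u * f (k # u)))"
    using raise_scale[of t j w "q powi (- b i k)" "\<lambda>u. wt_scalar t i u * f (k # u)"]
    by (simp add: algebra_simps)
  also have "\<dots> = bracket_scalar t j (k # w) * wt_scalar t i (k # w) * f (j # k # w)
     + q powi (- b i k) * (wt_scalar t i w * raise t j w (\<lambda>u. f (k # u)))"
    by (simp only: Cons 1) simp
  also have "\<dots> = wt_scalar t i (k # w) * raise t j (k # w) f" by (simp add: algebra_simps)
  finally show ?case ..
qed

lemma opK_opE: "opK t i * opE t j = q powi b i j *\<^sub>C (opE t j * opK t i)"
proof (rule endo_eqI)
  fix f w
  have "app (opK t i) f = (\<lambda>u. wt_scalar t i u * f u)" by (simp add: fun_eq_iff app_opK)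
  then show "app (opK t i * opE t j) f w = app (q powi b i j *\<^sub>C (opE t j * opK t i)) f w"
    using raise_wt_scalar[of i w j f] by (simp add: app_opK app_opE)
qed

lemma opKinv_opF: "opKinv t i * opF j = q powi b i j *\<^sub>C (opF j * opKinv t i)"
  using commute_inverse_scaled[OF opK_inverse _ opK_opF] q_nonzero by (simp add: power_int_minus)

lemma opKinv_opE: "opKinv t i * opE t j = q powi (- b i j) *\<^sub>C (opE t j * opKinv t i)"
  using commute_inverse_scaled[OF opK_inverse _ opK_opE] q_nonzero by (simp add: power_int_minus)

text \<open>At a word with first letter k, inserting i in front meets F_j only if i = j and yields
  the bracket term; insertions further inside leave k in front and yield F_j E_i.\<close>

lemma opE_opF:
  "opE t i * opF j = opF j * opE t i
    + (if i = j then (1 / (q ^ d i - inverse (q ^ d i))) *\<^sub>C (opK t i - opKinv t i) else 0)"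
proof (rule endo_eqI)
  fix f w
  show "app (opE t i * opF j) f w = app (opF j * opE t i
    + (if i = j then (1 / (q ^ d i - inverse (q ^ d i))) *\<^sub>C (opK t i - opKinv t i) else 0)) f w"
  proof (cases w)
    case Nil
    then show ?thesis
      by (simp add: app_opE app_opF app_opK app_opKinv bracket_scalar_def algebra_simps
          diff_divide_distrib)
  next
    case (Cons k u)
    have "raise t i u (\<lambda>v. app (opF j) f (k # v)) = (if k = j then raise t i u f else 0)"
      by (simp add: app_opF raise_vanishing)
    then show ?thesis
      using Cons by (simp add: app_opE app_opF app_opK app_opKinv bracket_scalar_def algebra_simps)
  qed
qed

section \<open>Serre elements acting on the Verma module\<close>

abbreviation "serreE i j \<equiv> serre (q ^ d i) (nat (1 - a i j)) (opE t i) (opE t j)"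
abbreviation "serreF i j \<equiv> serre (q ^ d i) (nat (1 - a i j)) (opF i) (opF j)"

lemma qi_powers:
  assumes "i \<noteq> j"
  obtains n where "nat (1 - a i j) = Suc n"
    "(q ^ d i) ^ n = q powi (- b i j)" "inverse (q ^ d i) ^ n = q powi b i j"
    "(q ^ d i) ^ 2 = q powi b i i" "inverse (q ^ d i) ^ 2 = q powi (- b i i)"
proof
  show "nat (1 - a i j) = Suc (nat (- a i j))" using a_off_diag[OF assms] by simp
  show 1: "(q ^ d i) ^ nat (- a i j) = q powi (- b i j)"
    using a_off_diag[OF assms] by (simp only: power_minus_a[symmetric]) (simp add: power_int_def)
  show "inverse (q ^ d i) ^ nat (- a i j) = q powi b i j"
    using arg_cong[OF 1, of inverse] by (simp add: power_inverse power_int_minus)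
  show 2: "(q ^ d i) ^ 2 = q powi b i i"
    by (simp add: b_diag mult.commute[of 2] power_int_mult)
  show "inverse (q ^ d i) ^ 2 = q powi (- b i i)"
    using arg_cong[OF 2, of inverse] by (simp add: power_inverse power_int_minus)
qed

lemma serreF_commute_opE:
  assumes ij: "i \<noteq> j" shows "opE t k * serreF i j = serreF i j * opE t k"
proof -
  obtain n where n: "nat (1 - a i j) = Suc n"
    "(q ^ d i) ^ n = q powi (- b i j)" "inverse (q ^ d i) ^ n = q powi b i j"
    "(q ^ d i) ^ 2 = q powi b i i" "inverse (q ^ d i) ^ 2 = q powi (- b i i)"
    using qi_powers[OF ij] .
  have v: "q ^ d i \<noteq> 0" using q_nonzero by simp
  consider "k = i" | "k = j" | "k \<noteq> i" "k \<noteq> j" by blast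
  then show ?thesis
  proof cases
    case 1
    show ?thesis
      unfolding n(1) 1
    proof (rule serre_commute_simple_x[OF v q_int_nonzero])
      show "opE t i * opF j = opF j * opE t i" using ij by (simp add: opE_opF)
      show "opE t i * opF i = opF i * opE t i
          + (1 / (q ^ d i - inverse (q ^ d i))) *\<^sub>C (opK t i - opKinv t i)"
        by (simp add: opE_opF)
    qed (simp_all only: n opK_opF opKinv_opF)
  next
    case 2
    show ?thesis
      unfolding n(1) 2
    proof (rule serre_commute_simple_y[OF v q_int_nonzero])
      show "opE t j * opF i = opF i * opE t j" using ij by (simp add: opE_opF)
      show "opE t j * opF j = opF j * opE t j
          + (1 / (q ^ d j - inverse (q ^ d j))) *\<^sub>C (opK t j - opKinv t j)"
        by (simp add: opE_opF)
    qed (simp_all only: n opK_opF opKinv_opF b_sym[of i j])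
  next
    case 3
    then show ?thesis by (intro serre_commute) (simp_all add: opE_opF)
  qed
qed

lemma serreE_commute_opF:
  assumes ij: "i \<noteq> j" shows "opF k * serreE i j = serreE i j * opF k"
proof -
  obtain n where n: "nat (1 - a i j) = Suc n"
    "(q ^ d i) ^ n = q powi (- b i j)" "inverse (q ^ d i) ^ n = q powi b i j"
    "(q ^ d i) ^ 2 = q powi b i i" "inverse (q ^ d i) ^ 2 = q powi (- b i i)"
    using qi_powers[OF ij] .
  have v: "q ^ d i \<noteq> 0" using q_nonzero by simp
  \<comment> \<open>Read from the side of F, the relation has K and its inverse interchanged, so the
    commutation lemmas apply with k = K^-1 and k' = K.\<close>
  have FE: "opF l * opE t l = opE t l * opF l
      + (1 / (q ^ d l - inverse (q ^ d l))) *\<^sub>C (opKinv t l - opK t l)" for l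
    by (simp add: opE_opF scaleC_diff_right algebra_simps)
  consider "k = i" | "k = j" | "k \<noteq> i" "k \<noteq> j" by blast
  then show ?thesis
  proof cases
    case 1
    show ?thesis
      unfolding n(1) 1
    proof (rule serre_commute_simple_x[OF v q_int_nonzero _ FE])
      show "opF i * opE t j = opE t j * opF i" using ij by (simp add: opE_opF)
    qed (simp_all only: n opK_opE opKinv_opE)
  next
    case 2
    show ?thesis
      unfolding n(1) 2
    proof (rule serre_commute_simple_y[OF v q_int_nonzero _ FE])
      show "opF j * opE t i = opE t i * opF j" using ij by (simp add: opE_opF)
    qed (simp_all only: n opK_opE opKinv_opE b_sym[of i j])
  next
    case 3
    then show ?thesis by (intro serre_commute) (simp_all add: opE_opF)
  qed
qed

lemma opF_decomposition:
  "f = (\<lambda>w. f [] * vac w + (\<Sum>k\<in>UNIV. app (opF k) (\<lambda>u. f (k # u)) w))"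
proof
  fix w
  show "f w = f [] * vac w + (\<Sum>k\<in>UNIV. app (opF k) (\<lambda>u. f (k # u)) w)"
    by (cases w) (simp_all add: vac_def app_opF)
qed

text \<open>Write f as a multiple of \<open>vac\<close> plus \<Sum> F_k f_k. Then x f = \<Sum> F_k
  (x f_k), whose value at the word k # w is that of x f_k at w; induction on the word reaches the
  empty word, where every F_k gives 0.\<close>

lemma commuting_with_opF_zero:
  assumes comm: "\<And>k. opF k * x = x * opF k" and vac: "app x vac = (\<lambda>_. 0)"
  shows "x = 0"
proof -
  have "app x f w = 0" for f w
  proof (induction w arbitrary: f)
    have *: "app x f w = (\<Sum>k\<in>UNIV. app (opF k) (app x (\<lambda>u. f (k # u))) w)" for f w
    proof -
      have "app x f w = f [] * app x vac w + (\<Sum>k\<in>UNIV. app x (app (opF k) (\<lambda>u. f (k # u))) w)"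
        by (subst opF_decomposition[of f]) (simp add: app_add app_scale app_sum_right)
      moreover have "app x (app (opF k) g) = app (opF k) (app x g)" for k g
        using arg_cong[OF comm, of "\<lambda>z. app z g"] by simp
      ultimately show ?thesis by (simp add: vac)
    qed
    {
      case Nil
      show ?case by (subst *) (simp add: app_opF)
    next
      case (Cons j w)
      then show ?case by (subst *) (simp add: app_opF)
    }
  qed
  then show ?thesis by (intro endo_eqI) simp
qed

lemma serre_annihilates:
  assumes "app x f = (\<lambda>_. 0)" "app y f = (\<lambda>_. 0)"
  shows "app (serre v m x y) f = (\<lambda>_. 0)"
proof -
  have "app (x ^ (m - r) * y * x ^ r) f = (\<lambda>_. 0)" for r
  proof (cases r)
    case 0
    then show ?thesis using assms by (simp add: app_zero)
  next
    case (Suc l)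
    have "app (x ^ r) f = (\<lambda>_. 0)" unfolding Suc power_Suc2 using assms by (simp add: app_zero)
    then show ?thesis by (simp add: app_zero)
  qed
  then show ?thesis by (simp add: serre_def app_sum_left)
qed

lemma serreE_zero: "i \<noteq> j \<Longrightarrow> serreE i j = 0"
  by (intro commuting_with_opF_zero serreE_commute_opF serre_annihilates opE_vac)

text \<open>
  The Serre elements in the \<open>F\<^sub>i\<close> do not act by zero. As they commute with all \<open>E\<^sub>i\<close>, their images
  generate a proper submodule, which does not meet the highest weight line.
\<close>

inductive_set serre_submodule :: "('i list \<Rightarrow> complex) set"
  where
    serre: "i \<noteq> j \<Longrightarrow> app (serreF i j) f \<in> serre_submodule"
  | lower: "f \<in> serre_submodule \<Longrightarrow> app (opF i) f \<in> serre_submodule"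
  | add: "f \<in> serre_submodule \<Longrightarrow> g \<in> serre_submodule \<Longrightarrow> (\<lambda>w. f w + g w) \<in> serre_submodule"
  | scale: "f \<in> serre_submodule \<Longrightarrow> (\<lambda>w. c * f w) \<in> serre_submodule"

lemma serre_submodule_diff:
  "f \<in> serre_submodule \<Longrightarrow> g \<in> serre_submodule \<Longrightarrow> (\<lambda>w. f w - g w) \<in> serre_submodule"
  using add[OF _ scale[of g "-1"], of f] by simp

text \<open>Every word occurring in a Serre element has an F as its leftmost factor, and the image
  of F_i has no component at the empty word.\<close>

lemma serre_submodule_Nil: "f \<in> serre_submodule \<Longrightarrow> f [] = 0"
proof (induction rule: serre_submodule.induct)
  case (serre i j f)
  have "app (opF i ^ m * opF j * opF i ^ r) f [] = 0" for m r
    by (cases m) (simp_all add: opF_Nil)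
  then show ?case by (simp add: serre_def app_sum_left)
qed (simp_all add: opF_Nil)

lemma scaled_commute_app:
  assumes "k * x = c *\<^sub>C (x * k)"
  shows "app k (app x f) = (\<lambda>w. c * app x (app k f) w)"
  using arg_cong[OF assms, of "\<lambda>z. app z f"] by simp

lemma serre_submodule_scaled_commuting:
  assumes comm: "\<And>j. k * opF j = c j *\<^sub>C (opF j * k)" and "f \<in> serre_submodule"
  shows "app k f \<in> serre_submodule"
  using assms(2)
proof (induction rule: serre_submodule.induct)
  case (serre i j f)
  then show ?case
    by (simp add: scaled_commute_app[OF serre_scaled_commute[OF comm comm]]
        serre_submodule.serre serre_submodule.scale)
next
  case (lower f i)
  then show ?case
    by (simp add: scaled_commute_app[OF comm] serre_submodule.lower serre_submodule.scale)
qed (simp_all add: app_add app_scale serre_submodule.add serre_submodule.scale)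

lemmas serre_submodule_opK = serre_submodule_scaled_commuting[OF opK_opF]
  and serre_submodule_opKinv = serre_submodule_scaled_commuting[OF opKinv_opF]

lemma serre_submodule_opE: "f \<in> serre_submodule \<Longrightarrow> app (opE t i) f \<in> serre_submodule"
proof (induction rule: serre_submodule.induct)
  case (serre k l f)
  have "app (opE t i) (app (serreF k l) f) = app (serreF k l) (app (opE t i) f)"
    using arg_cong[OF serreF_commute_opE[OF serre], of "\<lambda>z. app z f"] by simp
  then show ?case using serre serre_submodule.serre by simp
next
  case (lower f j)
  have *: "app (opE t i) (app (opF j) f)
    = app (opF j * opE t i
    + (if i = j then (1 / (q ^ d i - inverse (q ^ d i))) *\<^sub>C (opK t i - opKinv t i) else 0)) f"
    by (simp only: opE_opF[symmetric] app_simps)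
  have "app ((1 / (q ^ d i - inverse (q ^ d i))) *\<^sub>C (opK t i - opKinv t i)) f \<in> serre_submodule"
    unfolding app_simps
    by (intro serre_submodule.scale serre_submodule_diff serre_submodule_opK serre_submodule_opKinv lower)
  then show ?case
    unfolding * using lower by (auto intro: serre_submodule.lower serre_submodule.add)
qed (simp_all add: app_add app_scale serre_submodule.add serre_submodule.scale)

abbreviation "verma_gens \<equiv> case_uq_gen (opE t) opF (opK t) (opKinv t)"

lemma serre_submodule_app: "f \<in> serre_submodule \<Longrightarrow> app (fa_eval verma_gens p) f \<in> serre_submodule"
proof (induction p rule: poly_mapping_induct_singles)
  case (single k c)
  have "app (word_eval verma_gens (Word w)) f \<in> serre_submodule" for w
  proof (induction w)
    case (Cons s w)
    then show ?case
      by (cases s) (simp_all add: serre_submodule_opE serre_submodule.lower serre_submodule_opK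
          serre_submodule_opKinv)
  qed (simp add: single)
  then show ?case by (cases k) (simp add: fa_eval_single serre_submodule.scale)
qed (simp add: fa_eval_add serre_submodule.add)

lemma relations_kill_verma:
  assumes "p \<in> uq_relations q d a"
  shows "fa_eval verma_gens p = 0 \<or> (\<exists>i j. i \<noteq> j \<and> fa_eval verma_gens p = serreF i j)"
proof -
  have "opK t i * opE t j * opKinv t i = (q ^ d i) powi a i j *\<^sub>C opE t j"
    "opK t i * opF j * opKinv t i = (q ^ d i) powi (- a i j) *\<^sub>C opF j" for i j
    by (simp_all only: opK_opE opK_opF power_a power_minus_a scaleC_algebra_simps opK_inverse mult_1_right)
  then have KEK: "opK t i * (opE t j * opKinv t i) = (q ^ d i) powi a i j *\<^sub>C opE t j"
    and KFK: "opK t i * (opF j * opKinv t i) = (q ^ d i) powi (- a i j) *\<^sub>C opF j" for i j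
    by (simp_all only: mult.assoc)
  show ?thesis
    using assms unfolding uq_relations_def Let_def
    by (elim UnE CollectE exE conjE disjE)
      (auto simp: fa_eval_simps opK_inverse opK_commute KEK KFK opE_opF serreE_zero
        scaleC_algebra_simps)
qed

text \<open>The ideal need not act by zero, but its elements map every vector either to 0 or into
  the Serre submodule, and in both cases the highest weight coefficient vanishes.\<close>

lemma ideal_kills_verma:
  assumes "p \<in> ideal_generated (uq_relations q d a)"
  shows "app (fa_eval verma_gens p) f [] = 0"
proof -
  \<comment> \<open>The alternative matters in rank one: there are no Serre elements, the
    inductively defined set is empty, and so it does not contain 0.\<close>
  have "fa_eval verma_gens p = 0 \<or> (\<forall>f. app (fa_eval verma_gens p) f \<in> serre_submodule)"
    using assms
  proof (induction rule: ideal_generated.induct)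
    case (rel x)
    then show ?case using relations_kill_verma serre_submodule.serre by metis
  next
    case (diff x y)
    have "\<forall>f. app (0 - fa_eval verma_gens y) f \<in> serre_submodule"
      if "\<forall>f. app (fa_eval verma_gens y) f \<in> serre_submodule"
      using that serre_submodule.scale[of "app (fa_eval verma_gens y) f" "-1" for f] by simp
    then show ?case using diff.IH by (auto simp: fa_eval_diff serre_submodule_diff)
  next
    case (mult x l r)
    then show ?case by (auto simp: fa_eval_mult serre_submodule_app)
  qed (simp add: fa_eval_zero)
  then show ?thesis using serre_submodule_Nil by auto
qed

text \<open>\<phi>(u) is the coefficient of the highest weight vector v in u v. The weights t_i are
  arbitrary nonzero numbers; this freedom is what separates the K_\<nu>.\<close>

lemma verma_functional:
  fixes E F K Kinv :: "'i \<Rightarrow> 'u::complex_algebra_1"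
  assumes pres: "presented_by (case_uq_gen E F K Kinv) (uq_relations q d a)"
  obtains \<phi> :: "'u \<Rightarrow> complex" where "clinear \<phi>" "\<phi> 1 = 1" "\<And>x i. \<phi> (x * K i) = t i * \<phi> x"
    "\<And>x i. \<phi> (x * Kinv i) = inverse (t i) * \<phi> x" "\<And>x i. \<phi> (x * E i) = 0"
proof -
  let ?g = "case_uq_gen E F K Kinv"
  have surj: "\<exists>p. fa_eval ?g p = u" for u
    using pres unfolding presented_by_def by (metis UNIV_I rangeE)
  define \<psi> where "\<psi> p = app (fa_eval verma_gens p) vac []" for p
  \<comment> \<open>Two representatives of the same element differ by an element of the ideal, which
    has zero highest weight coefficient.\<close>
  have wd: "\<psi> p = \<psi> r" if "fa_eval ?g p = fa_eval ?g r" for p r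
  proof -
    have "p - r \<in> ideal_generated (uq_relations q d a)"
      using pres that unfolding presented_by_def by (auto simp: fa_eval_diff)
    from ideal_kills_verma[OF this, of vac] show ?thesis by (simp add: \<psi>_def fa_eval_diff)
  qed
  define \<phi> where "\<phi> u = \<psi> (SOME p. fa_eval ?g p = u)" for u
  have \<phi>: "\<phi> (fa_eval ?g p) = \<psi> p" for p
    unfolding \<phi>_def by (rule wd) (rule someI_ex[OF surj])
  have "clinear \<phi>"
  proof (rule clinearI)
    fix x y c
    obtain p r where [simp]: "x = fa_eval ?g p" "y = fa_eval ?g r" using surj by metis
    show "\<phi> (x + y) = \<phi> x + \<phi> y"
      by (simp add: fa_eval_add[symmetric] \<phi>) (simp add: \<psi>_def fa_eval_add)
    have "c *\<^sub>C x = fa_eval ?g (fa_const c * p)" by (simp add: fa_eval_simps scaleC_algebra_simps)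
    then have "\<phi> (c *\<^sub>C x) = \<psi> (fa_const c * p)" by (simp only: \<phi>)
    then show "\<phi> (c *\<^sub>C x) = c *\<^sub>C \<phi> x"
      by (simp add: \<phi>) (simp add: \<psi>_def fa_eval_simps scaleC_complex_def scaleC_algebra_simps)
  qed
  moreover have "\<phi> 1 = 1" using \<phi>[of 1] by (simp add: \<psi>_def fa_eval_one vac_def)
  moreover have right: "\<phi> (x * ?g s) = c * \<phi> x"
    if "app (verma_gens s) vac = (\<lambda>w. c * vac w)" for x s c
  proof -
    obtain p where [simp]: "x = fa_eval ?g p" using surj by metis
    have "x * ?g s = fa_eval ?g (p * fa_var s)" by (simp add: fa_eval_simps)
    then have "\<phi> (x * ?g s) = \<psi> (p * fa_var s)" by (simp only: \<phi>)
    then show ?thesis by (simp add: \<phi>) (simp add: \<psi>_def fa_eval_simps that app_scale)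
  qed
  have "\<phi> (x * K i) = t i * \<phi> x" for x i
    using right[of "GK i" "t i" x] by (simp add: fun_eq_iff app_opK vac_def)
  moreover have "\<phi> (x * Kinv i) = inverse (t i) * \<phi> x" for x i
    using right[of "GKinv i" "inverse (t i)" x] by (simp add: fun_eq_iff app_opKinv vac_def)
  moreover have "\<phi> (x * E i) = 0" for x i
    using right[of "GE i" 0 x] by (simp add: opE_vac)
  ultimately show ?thesis using that by blast
qed

end

end

section \<open>The triangular spanning set\<close>

text \<open>Descent on \<Sum> |\<nu>_i|: some nonzero coordinate can be moved one step towards
  0.\<close>

lemma int_lattice_induct [case_names zero up down]:
  fixes \<nu> :: "'i::finite \<Rightarrow> int"
  assumes zero: "Q (\<lambda>_. 0)"
    and up: "\<And>\<nu> i. Q \<nu> \<Longrightarrow> Q (\<nu>(i := \<nu> i + 1))" and down: "\<And>\<nu> i. Q \<nu> \<Longrightarrow> Q (\<nu>(i := \<nu> i - 1))"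
  shows "Q \<nu>"
proof (induction "\<Sum>i\<in>UNIV. nat \<bar>\<nu> i\<bar>" arbitrary: \<nu> rule: less_induct)
  case less
  show ?case
  proof (cases "\<nu> = (\<lambda>_. 0)")
    case True
    then show ?thesis using zero by simp
  next
    case False
    then obtain i where i: "\<nu> i \<noteq> 0" by auto
    define \<mu> where "\<mu> = \<nu>(i := if \<nu> i > 0 then \<nu> i - 1 else \<nu> i + 1)"
    have "(\<Sum>i\<in>UNIV. nat \<bar>\<mu> i\<bar>) < (\<Sum>i\<in>UNIV. nat \<bar>\<nu> i\<bar>)"
      by (rule sum_strict_mono_ex1) (use i in \<open>auto simp: \<mu>_def\<close>)
    then have "Q \<mu>" by (rule less)
    from up[OF this, of i] down[OF this, of i] show ?thesis
      using i by (auto simp: \<mu>_def fun_upd_idem split: if_splits)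
  qed
qed

locale quantum_hopf = quantum_data q d a + hopf_algebra \<Delta> \<epsilon> S
  for q :: complex and d :: "'i::finite \<Rightarrow> nat" and a :: "'i \<Rightarrow> 'i \<Rightarrow> int"
    and \<Delta> :: "'u::complex_algebra_1 \<Rightarrow> ('u, 'u) tensor" and \<epsilon> :: "'u \<Rightarrow> complex" and S :: "'u \<Rightarrow> 'u" +
  fixes E F K Kinv :: "'i \<Rightarrow> 'u"
  assumes presentation: "quantized_enveloping_algebra q d a E F K Kinv"
    and comult_K: "\<Delta> (K i) = K i \<boxtimes> K i"
    and comult_E: "\<Delta> (E i) = E i \<boxtimes> K i + 1 \<boxtimes> E i"
    and comult_F: "\<Delta> (F i) = F i \<boxtimes> 1 + Kinv i \<boxtimes> F i"
begin

lemma presented: "presented_by (case_uq_gen E F K Kinv) (uq_relations q d a)"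
  using presentation by (simp add: quantized_enveloping_algebra_def)

lemma relation_holds: "p \<in> uq_relations q d a \<Longrightarrow> fa_eval (case_uq_gen E F K Kinv) p = 0"
  using presented ideal_generated.rel unfolding presented_by_def by fastforce

lemma K_Kinv: "K i * Kinv i = 1" "Kinv i * K i = 1"
proof -
  have "fa_var (GK i) * fa_var (GKinv i) - 1 \<in> uq_relations q d a"
    "fa_var (GKinv i) * fa_var (GK i) - 1 \<in> uq_relations q d a"
    unfolding uq_relations_def Let_def by blast+
  from this[THEN relation_holds] show "K i * Kinv i = 1" "Kinv i * K i = 1"
    by (simp_all add: fa_eval_simps)
qed

lemma K_commute: "K i * K j = K j * K i"
proof -
  have "fa_var (GK i) * fa_var (GK j) - fa_var (GK j) * fa_var (GK i) \<in> uq_relations q d a"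
    unfolding uq_relations_def Let_def by blast
  from relation_holds[OF this] show ?thesis by (simp add: fa_eval_simps)
qed

lemma K_scaled_commute:
  assumes "K i * x * Kinv i = c *\<^sub>C x" shows "K i * x = c *\<^sub>C (x * K i)"
proof -
  have "K i * x = (K i * x * Kinv i) * K i" by (simp only: mult.assoc K_Kinv mult_1_right)
  then show ?thesis by (simp only: assms mult_scaleC_left)
qed

lemma K_E: "K i * E j = q powi b i j *\<^sub>C (E j * K i)"
proof (rule K_scaled_commute)
  have "fa_var (GK i) * fa_var (GE j) * fa_var (GKinv i)
      - fa_const ((q ^ d i) powi a i j) * fa_var (GE j) \<in> uq_relations q d a"
    unfolding uq_relations_def Let_def by blast
  from relation_holds[OF this] show "K i * E j * Kinv i = q powi b i j *\<^sub>C E j"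
    by (simp add: fa_eval_simps power_a scaleC_algebra_simps)
qed

lemma K_F: "K i * F j = q powi (- b i j) *\<^sub>C (F j * K i)"
proof (rule K_scaled_commute)
  have "fa_var (GK i) * fa_var (GF j) * fa_var (GKinv i)
      - fa_const ((q ^ d i) powi (- a i j)) * fa_var (GF j) \<in> uq_relations q d a"
    unfolding uq_relations_def Let_def by blast
  from relation_holds[OF this] show "K i * F j * Kinv i = q powi (- b i j) *\<^sub>C F j"
    by (simp add: fa_eval_simps power_minus_a scaleC_algebra_simps)
qed

lemma Kinv_E: "Kinv i * E j = q powi (- b i j) *\<^sub>C (E j * Kinv i)"
  and Kinv_F: "Kinv i * F j = q powi b i j *\<^sub>C (F j * Kinv i)"
  using commute_inverse_scaled[OF K_Kinv _ K_E, of i j] commute_inverse_scaled[OF K_Kinv _ K_F, of i j]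
    q_nonzero by (simp_all add: power_int_minus)

lemma E_F: "E i * F j = F j * E i
  + (if i = j then (1 / (q ^ d i - inverse (q ^ d i))) *\<^sub>C (K i - Kinv i) else 0)"
proof (cases "i = j")
  case True
  have "fa_var (GE i) * fa_var (GF i) - fa_var (GF i) * fa_var (GE i)
      - fa_const (1 / (q ^ d i - inverse (q ^ d i))) * (fa_var (GK i) - fa_var (GKinv i))
      \<in> uq_relations q d a"
    unfolding uq_relations_def Let_def by blast
  from relation_holds[OF this]
  have "E i * F i - F i * E i - (1 / (q ^ d i - inverse (q ^ d i))) *\<^sub>C (K i - Kinv i) = 0"
    by (simp only: fa_eval_simps uq_gen.case mult_scaleC_left mult_1_left)
  then show ?thesis using True by (simp add: diff_diff_eq)
next
  case False
  then have "fa_var (GE i) * fa_var (GF j) - fa_var (GF j) * fa_var (GE i) \<in> uq_relations q d a"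
    unfolding uq_relations_def Let_def by blast
  from relation_holds[OF this] False show ?thesis by (simp add: fa_eval_simps)
qed

section \<open>The torus elements K_\<nu>\<close>

lemma commute_inverse: "K i * x = x * K i \<Longrightarrow> Kinv i * x = x * Kinv i"
  using commute_inverse_scaled[OF K_Kinv, of 1 i x] by (simp add: scaleC_one)

lemma Kinv_K_commute: "Kinv i * K j = K j * Kinv i"
  by (rule commute_inverse[OF K_commute])

text \<open>A list fixes the order of the factors, since multiplication in the algebra is
  noncommutative; negative exponents go to the generators \<open>Kinv\<close>.\<close>

primrec Kprod :: "'i list \<Rightarrow> ('i \<Rightarrow> int) \<Rightarrow> 'u"
  where "Kprod [] \<nu> = 1"
  | "Kprod (i # l) \<nu> = (if \<nu> i \<ge> 0 then K i ^ nat (\<nu> i) else Kinv i ^ nat (- \<nu> i)) * Kprod l \<nu>"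

lemma Kprod_commute_K: "Kprod l \<nu> * K j = K j * Kprod l \<nu>"
proof (induction l)
  case (Cons i l)
  let ?k = "if \<nu> i \<ge> 0 then K i ^ nat (\<nu> i) else Kinv i ^ nat (- \<nu> i)"
  have *: "?k * K j = K j * ?k"
    by (simp add: power_commuting_commutes K_commute Kinv_K_commute)
  have "Kprod (i # l) \<nu> * K j = ?k * (Kprod l \<nu> * K j)" by (simp only: Kprod.simps mult.assoc)
  also have "\<dots> = ?k * K j * Kprod l \<nu>" by (simp only: Cons mult.assoc)
  finally show ?case by (simp only: * Kprod.simps mult.assoc)
qed simp

lemma Kprod_upd_notin: "i \<notin> set l \<Longrightarrow> Kprod l (\<nu>(i := n)) = Kprod l \<nu>"
  by (induction l) auto

lemma Kprod_K: "distinct l \<Longrightarrow> i \<in> set l \<Longrightarrow> Kprod l (\<nu>(i := \<nu> i + 1)) = K i * Kprod l \<nu>"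
proof (induction l)
  case (Cons j l)
  show ?case
  proof (cases "i = j")
    case True
    have eq: "(if \<nu> i + 1 \<ge> 0 then K i ^ nat (\<nu> i + 1) else Kinv i ^ nat (- (\<nu> i + 1)))
      = K i * (if \<nu> i \<ge> 0 then K i ^ nat (\<nu> i) else Kinv i ^ nat (- \<nu> i))"
    proof (cases "\<nu> i \<ge> 0")
      case True
      then show ?thesis by (simp add: nat_add_distrib)
    next
      case False
      then have *: "nat (- \<nu> i) = Suc (nat (- (\<nu> i + 1)))" by simp
      have "K i * Kinv i ^ nat (- \<nu> i) = Kinv i ^ nat (- (\<nu> i + 1))"
        unfolding * by (simp only: power_Suc mult.assoc[symmetric] K_Kinv mult_1_left)
      then show ?thesis using False by (auto simp: not_le)
    qed
    have "Kprod (j # l) (\<nu>(i := \<nu> i + 1))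
      = (if \<nu> i + 1 \<ge> 0 then K i ^ nat (\<nu> i + 1) else Kinv i ^ nat (- (\<nu> i + 1))) * Kprod l \<nu>"
      using Kprod_upd_notin[of i l \<nu> "\<nu> i + 1"] True Cons.prems(1)
      by (simp add: fun_upd_same del: fun_upd_apply)
    then show ?thesis unfolding eq using True by (simp only: Kprod.simps mult.assoc)
  next
    case False
    let ?k = "if \<nu> j \<ge> 0 then K j ^ nat (\<nu> j) else Kinv j ^ nat (- \<nu> j)"
    have *: "?k * K i = K i * ?k"
      by (simp add: power_commuting_commutes K_commute Kinv_K_commute)
    have "Kprod (j # l) (\<nu>(i := \<nu> i + 1)) = ?k * Kprod l (\<nu>(i := \<nu> i + 1))"
      using False by (simp add: fun_upd_other del: fun_upd_apply)
    also have "\<dots> = ?k * K i * Kprod l \<nu>" using False Cons by (simp add: mult.assoc del: fun_upd_apply)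
    finally show ?thesis by (simp only: * Kprod.simps mult.assoc)
  qed
qed simp

text \<open>K_\<nu> for any enumeration of the indices; the K_i commute, so the choice does not
  affect the rules below.\<close>

definition Kp :: "('i \<Rightarrow> int) \<Rightarrow> 'u"
  where "Kp = Kprod (SOME l. distinct l \<and> set l = UNIV)"

lemma Kp_zero: "Kp (\<lambda>_. 0) = 1"
proof -
  have "Kprod l (\<lambda>_. 0) = 1" for l by (induction l) simp_all
  then show ?thesis by (simp add: Kp_def)
qed

lemma Kp_up: "Kp (\<nu>(i := \<nu> i + 1)) = K i * Kp \<nu>"
proof -
  have "\<exists>l :: 'i list. distinct l \<and> set l = UNIV" using finite_distinct_list[OF finite] by blast
  from someI_ex[OF this] show ?thesis unfolding Kp_def by (intro Kprod_K) auto
qed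

lemma Kp_down: "Kp (\<nu>(i := \<nu> i - 1)) = Kinv i * Kp \<nu>"
proof -
  have "Kp \<nu> = K i * Kp (\<nu>(i := \<nu> i - 1))"
    using Kp_up[of "\<nu>(i := \<nu> i - 1)" i] by simp
  then show ?thesis by (simp add: mult.assoc[symmetric] K_Kinv)
qed

lemma Kp_add: "Kp \<nu> * Kp \<mu> = Kp (\<lambda>i. \<nu> i + \<mu> i)"
proof (induction \<nu> rule: int_lattice_induct)
  case (up \<nu> i)
  have "(\<lambda>j. (\<nu>(i := \<nu> i + 1)) j + \<mu> j) = (\<lambda>j. \<nu> j + \<mu> j)(i := (\<nu> i + \<mu> i) + 1)" by auto
  then show ?case using Kp_up[of "\<lambda>j. \<nu> j + \<mu> j" i] up by (simp add: Kp_up mult.assoc del: fun_upd_apply)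
next
  case (down \<nu> i)
  have "(\<lambda>j. (\<nu>(i := \<nu> i - 1)) j + \<mu> j) = (\<lambda>j. \<nu> j + \<mu> j)(i := (\<nu> i + \<mu> i) - 1)" by auto
  then show ?case using Kp_down[of "\<lambda>j. \<nu> j + \<mu> j" i] down by (simp add: Kp_down mult.assoc del: fun_upd_apply)
qed (simp add: Kp_zero)

lemma Kp_minus: "Kp \<nu> * Kp (\<lambda>i. - \<nu> i) = 1"
  by (simp add: Kp_add Kp_zero)

lemma Kp_K: "K i * Kp \<nu> = Kp \<nu> * K i"
  by (simp add: Kp_def Kprod_commute_K)

lemma Kp_Kinv: "Kinv i * Kp \<nu> = Kp \<nu> * Kinv i"
  by (rule commute_inverse[OF Kp_K])

text \<open>The inner product of \<Sum> \<nu>_i \<alpha>_i with \<alpha>_j, hence the exponent of q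
  by which K_\<nu> acts on E_j.\<close>

definition pairing :: "('i \<Rightarrow> int) \<Rightarrow> 'i \<Rightarrow> int"
  where "pairing \<nu> j = (\<Sum>i\<in>UNIV. \<nu> i * b i j)"

lemma pairing_upd: "pairing (\<nu>(i := n)) j = pairing \<nu> j + (n - \<nu> i) * b i j"
proof -
  have "(\<Sum>k\<in>UNIV - {i}. (\<nu>(i := n)) k * b k j) = (\<Sum>k\<in>UNIV - {i}. \<nu> k * b k j)"
    by (rule sum.cong) auto
  then show ?thesis
    unfolding pairing_def sum.remove[OF finite UNIV_I, of _ i]
    by (simp only: fun_upd_same) (simp only: algebra_simps)
qed

lemma pairing_eq_zero: "(\<And>j. pairing \<nu> j = 0) \<Longrightarrow> \<nu> i = 0"
proof (rule symmetrized_nondegenerate)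
  fix k
  assume "\<And>j. pairing \<nu> j = 0"
  moreover have "(\<Sum>j\<in>UNIV. \<nu> j * (int (d k) * a k j)) = pairing \<nu> k"
    unfolding pairing_def by (rule sum.cong[OF refl]) (use b_sym[of _ k] in \<open>simp add: b_def\<close>)
  ultimately show "(\<Sum>j\<in>UNIV. \<nu> j * (int (d k) * a k j)) = 0" by simp
qed

lemma Kp_E: "Kp \<nu> * E j = q powi pairing \<nu> j *\<^sub>C (E j * Kp \<nu>)"
proof (induction \<nu> rule: int_lattice_induct)
  case (up \<nu> i)
  have "K i * Kp \<nu> * E j = q powi pairing \<nu> j *\<^sub>C (K i * E j * Kp \<nu>)"
    by (simp add: mult.assoc up mult_scaleC_right)
  then show ?case
    using q_nonzero by (simp add: Kp_up K_E scaleC_algebra_simps pairing_upd power_int_add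
        del: fun_upd_apply)
next
  case (down \<nu> i)
  have "Kinv i * Kp \<nu> * E j = q powi pairing \<nu> j *\<^sub>C (Kinv i * E j * Kp \<nu>)"
    by (simp add: mult.assoc down mult_scaleC_right)
  then show ?case
    using q_nonzero by (simp add: Kp_down Kinv_E scaleC_algebra_simps pairing_upd
        power_int_diff power_int_minus divide_inverse del: fun_upd_apply)
qed (simp add: Kp_zero pairing_def scaleC_one)

text \<open>Only membership in a span is at stake here, so the scalar is left unspecified;
  \<open>Kp_E\<close> keeps it because it decides which K_\<nu> are central.\<close>

lemma Kp_F: "\<exists>c. Kp \<nu> * F j = c *\<^sub>C (F j * Kp \<nu>)"
proof (induction \<nu> rule: int_lattice_induct)
  case zero
  show ?case by (rule exI[of _ 1]) (simp add: Kp_zero scaleC_one)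
next
  case (up \<nu> i)
  then obtain c where "Kp \<nu> * F j = c *\<^sub>C (F j * Kp \<nu>)" by blast
  then have "K i * Kp \<nu> * F j = c *\<^sub>C (K i * F j * Kp \<nu>)"
    by (simp add: mult.assoc mult_scaleC_right)
  then show ?case by (auto simp: Kp_up K_F scaleC_algebra_simps simp del: fun_upd_apply)
next
  case (down \<nu> i)
  then obtain c where "Kp \<nu> * F j = c *\<^sub>C (F j * Kp \<nu>)" by blast
  then have "Kinv i * Kp \<nu> * F j = c *\<^sub>C (Kinv i * F j * Kp \<nu>)"
    by (simp add: mult.assoc mult_scaleC_right)
  then show ?case by (auto simp: Kp_down Kinv_F scaleC_algebra_simps simp del: fun_upd_apply)
qed

section \<open>Words in the generators and the monomials they span\<close>

definition Fw :: "'i list \<Rightarrow> 'u" where "Fw w = prod_list (map F w)"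
definition Ew :: "'i list \<Rightarrow> 'u" where "Ew w = prod_list (map E w)"

lemma Fw_simps [simp]: "Fw [] = 1" "Fw (i # w) = F i * Fw w" "Fw (v @ w) = Fw v * Fw w"
  and Ew_simps [simp]: "Ew [] = 1" "Ew (i # w) = E i * Ew w" "Ew (v @ w) = Ew v * Ew w"
  by (simp_all add: Fw_def Ew_def)

lemma Ew_K: "\<exists>c. Ew w * K i = c *\<^sub>C (K i * Ew w)"
proof (induction w)
  case Nil
  show ?case by (rule exI[of _ 1]) (simp add: scaleC_one)
next
  case (Cons j w)
  then obtain c where "Ew w * K i = c *\<^sub>C (K i * Ew w)" by blast
  then have "Ew (j # w) * K i = c *\<^sub>C (E j * K i * Ew w)"
    by (simp add: mult.assoc mult_scaleC_right)
  also have "E j * K i = inverse (q powi b i j) *\<^sub>C (K i * E j)"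
    using q_nonzero by (simp add: K_E scaleC_scaleC scaleC_one)
  also have "c *\<^sub>C (inverse (q powi b i j) *\<^sub>C (K i * E j) * Ew w)
      = (c * inverse (q powi b i j)) *\<^sub>C (K i * Ew (j # w))"
    by (simp only: scaleC_algebra_simps Ew_simps)
  finally show ?case by blast
qed

lemma Ew_Kinv: "\<exists>c. Ew w * Kinv i = c *\<^sub>C (Kinv i * Ew w)"
proof (induction w)
  case Nil
  show ?case by (rule exI[of _ 1]) (simp add: scaleC_one)
next
  case (Cons j w)
  then obtain c where "Ew w * Kinv i = c *\<^sub>C (Kinv i * Ew w)" by blast
  then have "Ew (j # w) * Kinv i = c *\<^sub>C (E j * Kinv i * Ew w)"
    by (simp add: mult.assoc mult_scaleC_right)
  also have "E j * Kinv i = inverse (q powi (- b i j)) *\<^sub>C (Kinv i * E j)"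
    using q_nonzero by (simp add: Kinv_E scaleC_scaleC scaleC_one)
  also have "c *\<^sub>C (inverse (q powi (- b i j)) *\<^sub>C (Kinv i * E j) * Ew w)
      = (c * inverse (q powi (- b i j))) *\<^sub>C (Kinv i * Ew (j # w))"
    by (simp only: scaleC_algebra_simps Ew_simps)
  finally show ?case by blast
qed

definition monomials :: "'u set"
  where "monomials = {Fw v * Kp \<nu> * Ew w | v \<nu> w. True}"

lemma monomial_in_span: "Fw v * Kp \<nu> * Ew w \<in> cspan monomials"
  by (rule complex_vector.span_base) (auto simp: monomials_def)

lemma span_monomials_right_E: "x \<in> cspan monomials \<Longrightarrow> x * E i \<in> cspan monomials"
proof (rule clinear_span_image_subset[OF clinear_mult_right complex_vector.subspace_span])
  fix x assume "x \<in> monomials"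
  then obtain v \<nu> w where "x = Fw v * Kp \<nu> * Ew w" by (auto simp: monomials_def)
  then have "x * E i = Fw v * Kp \<nu> * Ew (w @ [i])" by (simp add: mult.assoc)
  then show "x * E i \<in> cspan monomials" by (simp only: monomial_in_span)
qed

lemma span_monomials_right_K: "x \<in> cspan monomials \<Longrightarrow> x * K i \<in> cspan monomials"
proof (rule clinear_span_image_subset[OF clinear_mult_right complex_vector.subspace_span])
  fix x assume "x \<in> monomials"
  then obtain v \<nu> w where x: "x = Fw v * Kp \<nu> * Ew w" by (auto simp: monomials_def)
  obtain c where "Ew w * K i = c *\<^sub>C (K i * Ew w)" using Ew_K by blast
  then have "x * K i = c *\<^sub>C (Fw v * (Kp \<nu> * K i) * Ew w)" by (simp add: x scaleC_algebra_simps)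
  also have "Kp \<nu> * K i = Kp (\<nu>(i := \<nu> i + 1))" by (simp add: Kp_up Kp_K)
  finally show "x * K i \<in> cspan monomials"
    by (simp only: complex_vector.span_scale[OF monomial_in_span])
qed

lemma span_monomials_right_Kinv: "x \<in> cspan monomials \<Longrightarrow> x * Kinv i \<in> cspan monomials"
proof (rule clinear_span_image_subset[OF clinear_mult_right complex_vector.subspace_span])
  fix x assume "x \<in> monomials"
  then obtain v \<nu> w where x: "x = Fw v * Kp \<nu> * Ew w" by (auto simp: monomials_def)
  obtain c where "Ew w * Kinv i = c *\<^sub>C (Kinv i * Ew w)" using Ew_Kinv by blast
  then have "x * Kinv i = c *\<^sub>C (Fw v * (Kp \<nu> * Kinv i) * Ew w)" by (simp add: x scaleC_algebra_simps)
  also have "Kp \<nu> * Kinv i = Kp (\<nu>(i := \<nu> i - 1))" by (simp add: Kp_down Kp_Kinv)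
  finally show "x * Kinv i \<in> cspan monomials"
    by (simp only: complex_vector.span_scale[OF monomial_in_span])
qed

text \<open>F_i is moved left past the last letter of the E-word. Each exchange leaves at most a
  term in K_k and its inverse, which the two preceding lemmas keep in the span.\<close>

lemma span_monomials_right_F: "x \<in> cspan monomials \<Longrightarrow> x * F i \<in> cspan monomials"
proof (rule clinear_span_image_subset[OF clinear_mult_right complex_vector.subspace_span])
  have "Fw v * Kp \<nu> * Ew w * F i \<in> cspan monomials" for v \<nu> w
  proof (induction w rule: rev_induct)
    case Nil
    obtain c where c: "Kp \<nu> * F i = c *\<^sub>C (F i * Kp \<nu>)" using Kp_F by blast
    have "Fw v * Kp \<nu> * Ew [] * F i = c *\<^sub>C (Fw (v @ [i]) * Kp \<nu> * Ew [])"
      by (simp add: mult.assoc c mult_scaleC_right)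
    then show ?case by (simp only: complex_vector.span_scale[OF monomial_in_span])
  next
    case (snoc k w)
    let ?x = "Fw v * Kp \<nu> * Ew w"
    have x: "?x \<in> cspan monomials" by (rule monomial_in_span)
    have *: "Fw v * Kp \<nu> * Ew (w @ [k]) * F i = ?x * F i * E k
      + (if k = i then (1 / (q ^ d k - inverse (q ^ d k))) *\<^sub>C (?x * K k - ?x * Kinv k) else 0)"
      by (simp add: mult.assoc E_F distrib_left right_diff_distrib mult_scaleC_right)
    show ?case
      unfolding *
      by (auto intro!: complex_vector.span_add complex_vector.span_scale complex_vector.span_diff
          complex_vector.span_zero
          span_monomials_right_E snoc x span_monomials_right_K span_monomials_right_Kinv)
  qed
  then show "x * F i \<in> cspan monomials" if "x \<in> monomials" for x
    using that by (auto simp: monomials_def)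
qed

text \<open>The span contains 1 and is stable under right multiplication by every generator.\<close>

lemma span_monomials: "x \<in> cspan monomials"
proof -
  have one: "1 \<in> cspan monomials"
    using monomial_in_span[of "[]" "\<lambda>_. 0" "[]"] by (simp add: Kp_zero)
  have word: "word_eval (case_uq_gen E F K Kinv) (Word l) \<in> cspan monomials" for l
  proof (induction l rule: rev_induct)
    case (snoc s l)
    then show ?case
      by (cases s) (simp_all add: span_monomials_right_E span_monomials_right_F
          span_monomials_right_K span_monomials_right_Kinv)
  qed (simp add: one)
  obtain p where "x = fa_eval (case_uq_gen E F K Kinv) p"
    using presented unfolding presented_by_def by (metis UNIV_I rangeE)
  moreover have "fa_eval (case_uq_gen E F K Kinv) p \<in> cspan monomials" for p
    unfolding fa_eval_def
    by (intro complex_vector.span_sum complex_vector.span_scale) (metis word free_word.exhaust)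
  ultimately show ?thesis by simp
qed


section \<open>Functionals on the torus\<close>

lemma comult_Kinv: "\<Delta> (Kinv i) = Kinv i \<boxtimes> Kinv i"
proof -
  have "\<Delta> (Kinv i) = tensor_mult (\<Delta> (Kinv i)) (tensor_mult (K i \<boxtimes> K i) (Kinv i \<boxtimes> Kinv i))"
    by (simp add: K_Kinv tensor_mult_one_right)
  also have "\<dots> = tensor_mult (\<Delta> (Kinv i * K i)) (Kinv i \<boxtimes> Kinv i)"
    by (simp only: tensor_mult_assoc comult_mult comult_K)
  also have "\<dots> = Kinv i \<boxtimes> Kinv i" by (simp add: K_Kinv comult_one)
  finally show ?thesis .
qed

lemma comult_Kp: "\<Delta> (Kp \<nu>) = Kp \<nu> \<boxtimes> Kp \<nu>"
proof (induction \<nu> rule: int_lattice_induct)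
  case (up \<nu> i)
  then show ?case unfolding Kp_up by (simp add: comult_mult comult_K)
next
  case (down \<nu> i)
  then show ?case unfolding Kp_down by (simp add: comult_mult comult_Kinv)
qed (simp add: Kp_zero comult_one)

text \<open>Convolution of functionals. On the grouplike K_\<nu> it multiplies values, which allows
  products of separating functionals.\<close>

definition conv :: "('u \<Rightarrow> complex) \<Rightarrow> ('u \<Rightarrow> complex) \<Rightarrow> 'u \<Rightarrow> complex"
  where "conv f g x = tensor_lift (\<lambda>a b. f a * g b) (\<Delta> x)"

lemma cbilinear_functional_mult:
  fixes f g :: "'u \<Rightarrow> complex"
  assumes "clinear f" "clinear g" shows "cbilinear (\<lambda>x y. f x * g y)"
  using assms by (auto simp: cbilinear_def clinear_iff scaleC_complex_def algebra_simps)

lemma conv_linear: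
  assumes "clinear f" "clinear g" shows "clinear (conv f g)"
  unfolding conv_def
  by (rule clinear_compose[OF clinear_tensor_lift[OF cbilinear_functional_mult[OF assms]] linear_comult])

lemma conv_Kp:
  assumes "clinear f" "clinear g" shows "conv f g (Kp \<nu>) = f (Kp \<nu>) * g (Kp \<nu>)"
  by (simp add: conv_def comult_Kp cbilinear_functional_mult[OF assms])

lemma comult_mult_E:
  "\<Delta> (x * E i) = tensor_mult (\<Delta> x) (E i \<boxtimes> K i) + tensor_mult (\<Delta> x) (1 \<boxtimes> E i)"
  by (simp add: comult_mult comult_E clinear_add[OF tensor_mult_linear_right])

lemma conv_E:
  assumes fg: "clinear f" "clinear g" and "\<And>x. f (x * E i) = 0" "\<And>x. g (x * E i) = 0"
  shows "conv f g (x * E i) = 0"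
  by (simp add: conv_def comult_mult_E tensor_lift_mult_pure[OF cbilinear_functional_mult[OF fg]]
      clinear_add[OF clinear_tensor_lift[OF cbilinear_functional_mult[OF fg]]] assms tensor_lift_zero)

text \<open>For each excluded \<mu>, two highest weight functionals combine to one with values 1 at
  K_\<nu> and 0 at K_\<mu>; the convolution of these is the required f. Vanishing on right multiples
  of the E_i survives convolution.\<close>

lemma separating_functional:
  assumes "finite X" "\<nu> \<notin> X"
  obtains f :: "'u \<Rightarrow> complex" where "clinear f" "\<And>x i. f (x * E i) = 0" "f (Kp \<nu>) = 1"
    "\<And>\<mu>. \<mu> \<in> X \<Longrightarrow> f (Kp \<mu>) = 0"
  using assms
proof (induction X arbitrary: thesis rule: finite_induct)
  case empty
  obtain \<phi> :: "'u \<Rightarrow> complex" where \<phi>: "clinear \<phi>" "\<phi> 1 = 1" "\<And>x i. \<phi> (x * K i) = 1 * \<phi> x"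
    "\<And>x i. \<phi> (x * Kinv i) = inverse 1 * \<phi> x" "\<And>x i. \<phi> (x * E i) = 0"
    by (rule verma_functional[OF _ presented, of "\<lambda>_. 1"]) auto
  have "\<phi> (Kp \<mu>) = 1" for \<mu>
    by (induction \<mu> rule: int_lattice_induct)
      (simp_all only: Kp_zero Kp_up Kp_down Kp_K Kp_Kinv \<phi> mult_1_left inverse_1)
  then show ?case using empty(1)[of \<phi>] \<phi> by blast
next
  case (insert \<mu> X)
  obtain f :: "'u \<Rightarrow> complex" where f: "clinear f" "\<And>x i. f (x * E i) = 0" "f (Kp \<nu>) = 1"
    "\<And>\<mu>. \<mu> \<in> X \<Longrightarrow> f (Kp \<mu>) = 0"
    using insert.IH insert.prems(2) by blast
  obtain i where i: "\<nu> i \<noteq> \<mu> i" using insert.prems(2) by force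
  \<comment> \<open>With weight q at one index where \<nu> and \<mu> differ and 1 elsewhere, \<phi>
    takes the value q^(\<eta>_i) at K_\<eta>, so it distinguishes K_\<nu> from K_\<mu>.\<close>
  define t where "t = (\<lambda>j. if j = i then q else 1)"
  obtain \<phi> :: "'u \<Rightarrow> complex" where \<phi>: "clinear \<phi>" "\<phi> 1 = 1" "\<And>x j. \<phi> (x * K j) = t j * \<phi> x"
    "\<And>x j. \<phi> (x * Kinv j) = inverse (t j) * \<phi> x" "\<And>x j. \<phi> (x * E j) = 0"
    by (rule verma_functional[OF _ presented, of t]) (use q_nonzero in \<open>auto simp: t_def\<close>)
  obtain \<psi> :: "'u \<Rightarrow> complex" where \<psi>: "clinear \<psi>" "\<psi> 1 = 1" "\<And>x i. \<psi> (x * K i) = 1 * \<psi> x"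
    "\<And>x i. \<psi> (x * Kinv i) = inverse 1 * \<psi> x" "\<And>x i. \<psi> (x * E i) = 0"
    by (rule verma_functional[OF _ presented, of "\<lambda>_. 1"]) auto
  have \<psi>K: "\<psi> (Kp \<mu>) = 1" for \<mu>
    by (induction \<mu> rule: int_lattice_induct)
      (simp_all only: Kp_zero Kp_up Kp_down Kp_K Kp_Kinv \<psi> mult_1_left inverse_1)
  have \<phi>K: "\<phi> (Kp \<mu>) = q powi \<mu> i" for \<mu>
  proof (induction \<mu> rule: int_lattice_induct)
    case (up \<mu> j)
    then show ?case
      unfolding Kp_up Kp_K \<phi> using q_nonzero by (simp add: t_def power_int_add)
  next
    case (down \<mu> j)
    then show ?case
      unfolding Kp_down Kp_Kinv \<phi> using q_nonzero by (simp add: t_def power_int_diff divide_inverse)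
  qed (simp add: Kp_zero \<phi>)
  define g where "g x = (1 / (q powi \<nu> i - q powi \<mu> i)) *\<^sub>C (\<phi> x - q powi \<mu> i *\<^sub>C \<psi> x)" for x
  have g: "clinear g" unfolding g_def by (intro clinear_compose_scale clinear_compose_diff \<phi> \<psi>)
  have gE: "g (x * E j) = 0" for x j by (simp add: g_def \<phi> \<psi> scaleC_complex_def)
  have "q powi \<nu> i - q powi \<mu> i \<noteq> 0" using q_powi_inject i by simp
  then have gK: "g (Kp \<nu>) = 1" "g (Kp \<mu>) = 0"
    by (simp_all add: g_def \<phi>K \<psi>K scaleC_complex_def)
  show ?case
  proof (rule insert.prems(1)[of "conv f g"])
    show "clinear (conv f g)" by (rule conv_linear[OF f(1) g])
    show "conv f g (x * E j) = 0" for x j by (rule conv_E[OF f(1) g f(2) gE])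
    show "conv f g (Kp \<nu>) = 1" by (simp add: conv_Kp[OF f(1) g] f gK)
    show "conv f g (Kp \<eta>) = 0" if "\<eta> \<in> insert \<mu> X" for \<eta>
      using that f(4) gK(2) by (auto simp: conv_Kp[OF f(1) g])
  qed
qed

text \<open>If E_i = 0, the commutator with F_i forces K_i to equal its inverse; a highest weight
  functional with all weights q then gives q = 1/q.\<close>

lemma E_nonzero: "E i \<noteq> 0"
proof
  assume "E i = 0"
  then have "(1 / (q ^ d i - inverse (q ^ d i))) *\<^sub>C (K i - Kinv i) = 0"
    using E_F[of i i] by simp
  then have KK: "K i = Kinv i" using qi_diff_nonzero[of i] by simp
  obtain \<phi> :: "'u \<Rightarrow> complex" where \<phi>: "\<phi> 1 = 1" "\<And>x j. \<phi> (x * K j) = q * \<phi> x"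
    "\<And>x j. \<phi> (x * Kinv j) = inverse q * \<phi> x"
    by (rule verma_functional[OF _ presented, of "\<lambda>_. q"]) (use q_nonzero in auto)
  have "q = inverse q" using \<phi>(2)[of 1 i] \<phi>(3)[of 1 i] \<phi>(1) KK by simp
  then have "q ^ 2 = 1" using q_nonzero by (metis power2_eq_square right_inverse)
  then show False using q_not_root[of 2] by simp
qed

section \<open>Contracting the coproduct with a functional\<close>

definition contract_left :: "('u \<Rightarrow> complex) \<Rightarrow> 'u \<Rightarrow> 'u"
  where "contract_left f x = tensor_lift (\<lambda>a b. f a *\<^sub>C b) (\<Delta> x)"

definition contract_right :: "('u \<Rightarrow> complex) \<Rightarrow> 'u \<Rightarrow> 'u"
  where "contract_right f x = tensor_lift (\<lambda>a b. f b *\<^sub>C a) (\<Delta> x)"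

lemma cbilinear_contract:
  fixes f :: "'u \<Rightarrow> complex"
  assumes "clinear f"
  shows "cbilinear (\<lambda>a b. f a *\<^sub>C (b :: 'u))" "cbilinear (\<lambda>a b. f b *\<^sub>C (a :: 'u))"
  using assms by (auto simp: cbilinear_def clinear_iff scaleC_complex_def scaleC_add_left
      scaleC_add_right scaleC_scaleC mult.commute)

lemma contract_linear:
  assumes "clinear f" shows "clinear (contract_left f)" "clinear (contract_right f)"
  unfolding contract_left_def contract_right_def
  by (rule clinear_compose[OF clinear_tensor_lift[OF cbilinear_contract(1)[OF assms]] linear_comult]
      clinear_compose[OF clinear_tensor_lift[OF cbilinear_contract(2)[OF assms]] linear_comult])+

text \<open>In \<Delta>(x E_i) the summand with E_i in the first factor is killed by f, so
  contraction commutes with right multiplication by E_i.\<close>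

lemma contract_left_Kp_Ew:
  assumes f: "clinear f" and fE: "\<And>x i. f (x * E i) = 0"
  shows "contract_left f (Kp \<nu> * Ew w) = f (Kp \<nu>) *\<^sub>C (Kp \<nu> * Ew w)"
proof (induction w rule: rev_induct)
  case Nil
  show ?case by (simp add: contract_left_def comult_Kp cbilinear_contract[OF f])
next
  case (snoc i w)
  note bil = cbilinear_contract(1)[OF f]
  have "contract_left f (x * E i) = contract_left f x * E i" for x
  proof -
    have "contract_left f (x * E i) = tensor_lift (\<lambda>a b. (f a *\<^sub>C b) * E i) (\<Delta> x)"
      by (simp add: contract_left_def comult_mult_E clinear_add[OF clinear_tensor_lift[OF bil]]
          tensor_lift_mult_pure[OF bil] fE scaleC_zero_left tensor_lift_zero mult_scaleC_left)
    then show ?thesis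
      unfolding contract_left_def by (simp add: tensor_lift_compose[OF bil clinear_mult_right])
  qed
  then have "contract_left f (Kp \<nu> * Ew w * E i) = f (Kp \<nu>) *\<^sub>C (Kp \<nu> * Ew w * E i)"
    by (simp add: snoc mult_scaleC_left)
  then show ?case by (simp add: mult.assoc)
qed

section \<open>Height and the coproduct\<close>

text \<open>A union of weight spaces rather than a subspace: its elements are weight vectors whose
  weight, in the root lattice, has coordinate sum n. Spans are taken where sums are needed.\<close>

definition height_part :: "int \<Rightarrow> 'u set"
  where "height_part n = (\<Union>\<gamma> \<in> {\<gamma>. (\<Sum>i\<in>UNIV. \<gamma> i) = n}.
    joint_eigenspace (\<lambda>i x. K i * x * Kinv i) UNIV (\<lambda>i. q powi pairing \<gamma> i))"

lemma height_partI:
  assumes "\<And>i. K i * x = q powi pairing \<gamma> i *\<^sub>C (x * K i)" "(\<Sum>i\<in>UNIV. \<gamma> i) = n"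
  shows "x \<in> height_part n"
proof -
  have "K i * x * Kinv i = q powi pairing \<gamma> i *\<^sub>C x" for i
    by (simp add: assms(1) scaleC_algebra_simps K_Kinv)
  then show ?thesis using assms(2) by (auto simp: height_part_def joint_eigenspace_def)
qed

lemma height_partE:
  assumes "x \<in> height_part n"
  obtains \<gamma> where "\<And>i. K i * x = q powi pairing \<gamma> i *\<^sub>C (x * K i)" "(\<Sum>i\<in>UNIV. \<gamma> i) = n"
proof -
  obtain \<gamma> where \<gamma>: "\<And>i. K i * x * Kinv i = q powi pairing \<gamma> i *\<^sub>C x" "(\<Sum>i\<in>UNIV. \<gamma> i) = n"
    using assms by (auto simp: height_part_def joint_eigenspace_def)
  then show ?thesis using that[of \<gamma>] K_scaled_commute by blast
qed

lemma pairing_add: "pairing (\<lambda>i. \<gamma> i + \<delta> i) j = pairing \<gamma> j + pairing \<delta> j"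
  by (simp add: pairing_def distrib_right sum.distrib)

lemma height_part_mult:
  assumes "x \<in> height_part m" "y \<in> height_part n" shows "x * y \<in> height_part (m + n)"
proof -
  obtain \<gamma> where \<gamma>: "\<And>i. K i * x = q powi pairing \<gamma> i *\<^sub>C (x * K i)" "(\<Sum>i\<in>UNIV. \<gamma> i) = m"
    using height_partE[OF assms(1)] by blast
  obtain \<delta> where \<delta>: "\<And>i. K i * y = q powi pairing \<delta> i *\<^sub>C (y * K i)" "(\<Sum>i\<in>UNIV. \<delta> i) = n"
    using height_partE[OF assms(2)] by blast
  show ?thesis
  proof (rule height_partI)
    show "K i * (x * y) = q powi pairing (\<lambda>i. \<gamma> i + \<delta> i) i *\<^sub>C (x * y * K i)" for i
    proof -
      have "K i * (x * y) = q powi pairing \<gamma> i *\<^sub>C (x * (K i * y))"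
        by (simp only: mult.assoc[symmetric] \<gamma>(1) mult_scaleC_left)
      also have "\<dots> = (q powi pairing \<gamma> i * q powi pairing \<delta> i) *\<^sub>C (x * y * K i)"
        by (simp only: \<delta>(1) mult_scaleC_right scaleC_scaleC mult.assoc)
      finally show ?thesis using q_nonzero by (simp add: pairing_add power_int_add)
    qed
    show "(\<Sum>i\<in>UNIV. \<gamma> i + \<delta> i) = m + n" using \<gamma>(2) \<delta>(2) by (simp add: sum.distrib)
  qed
qed

lemma pairing_unit: "pairing (\<lambda>k. if k = j then c else 0) i = c * b i j"
proof -
  have "pairing (\<lambda>k. if k = j then c else 0) i = (\<Sum>k\<in>UNIV. if k = j then c * b k i else 0)"
    unfolding pairing_def by (rule sum.cong) auto
  then show ?thesis using b_sym[of i j] by simp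
qed

lemma height_part_E: "E j \<in> height_part 1"
  by (rule height_partI[of _ "\<lambda>k. if k = j then 1 else 0"]) (simp_all add: pairing_unit K_E)

lemma height_part_F: "F j \<in> height_part (- 1)"
  by (rule height_partI[of _ "\<lambda>k. if k = j then - 1 else 0"]) (simp_all add: pairing_unit K_F)

lemma height_part_0: "(\<And>i. K i * x = x * K i) \<Longrightarrow> x \<in> height_part 0"
  by (rule height_partI[of _ "\<lambda>_. 0"]) (simp_all add: pairing_def scaleC_one)

lemma height_part_Kp: "Kp \<nu> \<in> height_part 0"
  by (rule height_part_0) (rule Kp_K)

lemma height_part_Kinv: "Kinv i \<in> height_part 0"
  by (rule height_part_0) (rule Kinv_K_commute[symmetric])

lemma height_part_one: "1 \<in> height_part 0"
  by (rule height_part_0) simp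

lemma height_part_Fw: "Fw v \<in> height_part (- int (length v))"
proof (induction v)
  case (Cons i v)
  show ?case using height_part_mult[OF height_part_F[of i] Cons] by (simp add: algebra_simps)
qed (simp add: height_part_one)

lemma height_part_Ew: "Ew w \<in> height_part (int (length w))"
proof (induction w)
  case (Cons i v)
  show ?case using height_part_mult[OF height_part_E[of i] Cons] by simp
qed (simp add: height_part_one)

lemma height_part_Fw_Kp: "Fw v * Kp \<nu> \<in> height_part (- int (length v))"
  using height_part_mult[OF height_part_Fw height_part_Kp] by simp

text \<open>Nondegeneracy and q not being a root of unity make the character of a lattice weight
  determine the weight. Only finitely many weights occur in two expansions of x, so interpolation
  supplies projections; the sum of those of height n fixes x by the first expansion and kills it by
  the second.\<close>

lemma height_parts_independent:
  assumes x: "x \<in> cspan (height_part n)" "x \<in> cspan (\<Union>m\<in>-{n}. height_part m)"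
  shows "x = 0"
proof -
  define ch where "ch \<gamma> = (\<lambda>i. q powi pairing \<gamma> i)" for \<gamma>
  let ?W = "\<lambda>\<gamma>. joint_eigenspace (\<lambda>i x. K i * x * Kinv i) UNIV (ch \<gamma>)"
  have ch_inj: "\<gamma> = \<delta>" if "ch \<gamma> = ch \<delta>" for \<gamma> \<delta>
  proof -
    have "pairing \<gamma> i = pairing \<delta> i" for i
      using fun_cong[OF that, of i] by (simp add: ch_def q_powi_inject)
    then have "pairing (\<lambda>k. \<gamma> k - \<delta> k) i = 0" for i
      by (simp add: pairing_def left_diff_distrib sum_subtractf)
    from pairing_eq_zero[OF this] show ?thesis by (auto simp: fun_eq_iff)
  qed
  have lin: "clinear (\<lambda>x. K i * x * Kinv i)" for i
    by (rule clinear_compose[OF clinear_mult_right clinear_mult_left])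
  have mem: "\<exists>\<gamma>. (\<Sum>i\<in>UNIV. \<gamma> i) = m \<and> v \<in> ?W \<gamma>" if "v \<in> height_part m" for v m
    using that by (auto simp: height_part_def ch_def)
  obtain T r where T: "finite T" "T \<subseteq> height_part n" "x = (\<Sum>v\<in>T. r v *\<^sub>C v)"
    using x(1) unfolding complex_vector.span_explicit by auto
  obtain T' r' where T': "finite T'" "T' \<subseteq> (\<Union>m\<in>-{n}. height_part m)" "x = (\<Sum>v\<in>T'. r' v *\<^sub>C v)"
    using x(2) unfolding complex_vector.span_explicit by auto
  have "\<forall>v\<in>T. \<exists>\<gamma>. (\<Sum>i\<in>UNIV. \<gamma> i) = n \<and> v \<in> ?W \<gamma>" using T(2) mem by blast
  from bchoice[OF this] obtain w where
    w: "\<And>v. v \<in> T \<Longrightarrow> (\<Sum>i\<in>UNIV. w v i) = n" "\<And>v. v \<in> T \<Longrightarrow> v \<in> ?W (w v)"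
    by blast
  have "\<forall>v\<in>T'. \<exists>\<gamma>. (\<Sum>i\<in>UNIV. \<gamma> i) \<noteq> n \<and> v \<in> ?W \<gamma>" using T'(2) mem by blast
  from bchoice[OF this] obtain w' where
    w': "\<And>v. v \<in> T' \<Longrightarrow> (\<Sum>i\<in>UNIV. w' v i) \<noteq> n" "\<And>v. v \<in> T' \<Longrightarrow> v \<in> ?W (w' v)"
    by blast
  define G where "G = w ` T"
  define X where "X = w ` T \<union> w' ` T'"
  have fin: "finite G" "finite X" using T(1) T'(1) by (simp_all add: G_def X_def)
  have "\<forall>\<gamma>. \<exists>P. clinear P \<and> (\<forall>x\<in>?W \<gamma>. P x = x) \<and> (\<forall>\<delta>\<in>X - {\<gamma>}. \<forall>x\<in>?W \<delta>. P x = 0)"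
  proof
    fix \<gamma>
    have ne: "\<exists>k\<in>UNIV. \<chi> k \<noteq> ch \<gamma> k" if "\<chi> \<in> ch ` (X - {\<gamma>})" for \<chi>
    proof -
      obtain \<delta> where \<delta>: "\<delta> \<in> X" "\<delta> \<noteq> \<gamma>" "\<chi> = ch \<delta>" using \<open>\<chi> \<in> ch ` (X - {\<gamma>})\<close> by blast
      then have "ch \<delta> \<noteq> ch \<gamma>" using ch_inj by blast
      then show ?thesis using \<delta>(3) by (auto simp: fun_eq_iff)
    qed
    have fin': "finite (ch ` (X - {\<gamma>}))" using fin by simp
    obtain P where "clinear P" "\<And>x. x \<in> ?W \<gamma> \<Longrightarrow> P x = x"
      "\<And>\<chi> x. \<chi> \<in> ch ` (X - {\<gamma>}) \<Longrightarrow>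
        x \<in> joint_eigenspace (\<lambda>i x. K i * x * Kinv i) UNIV \<chi> \<Longrightarrow> P x = 0"
      by (rule eigenspace_interpolation[of UNIV "\<lambda>i x. K i * x * Kinv i" "ch ` (X - {\<gamma>})" "ch \<gamma>",
            OF lin fin' ne]) (assumption | blast)+
    then show "\<exists>P. clinear P \<and> (\<forall>x\<in>?W \<gamma>. P x = x) \<and> (\<forall>\<delta>\<in>X - {\<gamma>}. \<forall>x\<in>?W \<delta>. P x = 0)"
      by (intro exI[of _ P]) blast
  qed
  from choice[OF this] obtain P where 
    "\<forall>\<gamma>. clinear (P \<gamma>) \<and> (\<forall>x\<in>?W \<gamma>. P \<gamma> x = x) \<and> (\<forall>\<delta>\<in>X - {\<gamma>}. \<forall>x\<in>?W \<delta>. P \<gamma> x = 0)" ..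
  then have P: "\<And>\<gamma>. clinear (P \<gamma>)" "\<And>\<gamma> x. x \<in> ?W \<gamma> \<Longrightarrow> P \<gamma> x = x"
    "\<And>\<gamma> \<delta> x. \<delta> \<in> X \<Longrightarrow> \<delta> \<noteq> \<gamma> \<Longrightarrow> x \<in> ?W \<delta> \<Longrightarrow> P \<gamma> x = 0"
    by blast+
  define Q where "Q x = (\<Sum>\<gamma>\<in>G. P \<gamma> x)" for x
  have Q: "clinear Q" unfolding Q_def by (intro clinear_compose_sum P(1))
  have "Q v = v" if "v \<in> T" for v
  proof -
    have "Q v = (\<Sum>\<gamma>\<in>G. if \<gamma> = w v then v else 0)"
      unfolding Q_def
    proof (rule sum.cong[OF refl])
      fix \<gamma>
      have "w v \<in> X" using that by (simp add: X_def)
      then show "P \<gamma> v = (if \<gamma> = w v then v else 0)"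
        using P(2)[OF w(2)[OF that]] P(3)[OF _ _ w(2)[OF that], of \<gamma>] by auto
    qed
    then show ?thesis using that fin by (simp add: G_def)
  qed
  then have "Q x = x" unfolding T(3) by (simp add: clinear_sum[OF Q] clinear_scale[OF Q])
  moreover have "Q v = 0" if "v \<in> T'" for v
    unfolding Q_def
  proof (intro sum.neutral ballI)
    fix \<gamma> assume "\<gamma> \<in> G"
    then have "w' v \<noteq> \<gamma>" using w(1) w'(1)[OF that] by (auto simp: G_def)
    then show "P \<gamma> v = 0" using P(3)[OF _ _ w'(2)[OF that]] that by (simp add: X_def)
  qed
  then have "Q x = 0"
    unfolding T'(3) by (simp add: clinear_sum[OF Q] clinear_scale[OF Q] scaleC_zero_right)
  ultimately show ?thesis by simp
qed

text \<open>Every spanning monomial is homogeneous, so the algebra is the direct sum of the span of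
  height n and that of all other heights.\<close>

lemma height_projection:
  obtains P where "clinear P" "\<And>x. x \<in> height_part n \<Longrightarrow> P x = x"
    "\<And>m x. m \<noteq> n \<Longrightarrow> x \<in> height_part m \<Longrightarrow> P x = 0"
proof -
  let ?M = "cspan (height_part n)" and ?N = "cspan (\<Union>m\<in>-{n}. height_part m)"
  have decomp: "\<exists>y1\<in>?M. \<exists>y2\<in>?N. x = y1 + y2" for x
    using span_monomials[of x]
  proof (induction rule: complex_vector.span_induct_alt)
    case base
    show ?case by (intro bexI[of _ 0]) (simp_all add: complex_vector.span_zero)
  next
    case (step c x y)
    obtain y1 y2 where mn: "y1 \<in> ?M" "y2 \<in> ?N" "y = y1 + y2" using step by blast
    obtain v \<nu> w where x: "x = Fw v * Kp \<nu> * Ew w" using step by (auto simp: monomials_def)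
    have h: "x \<in> height_part (- int (length v) + int (length w))"
      unfolding x by (rule height_part_mult[OF height_part_Fw_Kp height_part_Ew])
    show ?case
    proof (cases "x \<in> ?M")
      case True
      then have "c *\<^sub>C x + y1 \<in> ?M"
        using mn by (simp add: complex_vector.span_add complex_vector.span_scale)
      moreover have "c *\<^sub>C x + y = (c *\<^sub>C x + y1) + y2" by (simp add: mn)
      ultimately show ?thesis using mn(2) by blast
    next
      case False
      then have "x \<in> ?N"
        using h complex_vector.span_base[of x "height_part n"]
        by (intro complex_vector.span_base) auto
      then have "c *\<^sub>C x + y2 \<in> ?N"
        using mn by (simp add: complex_vector.span_add complex_vector.span_scale)
      moreover have "c *\<^sub>C x + y = y1 + (c *\<^sub>C x + y2)" by (simp add: mn)
      ultimately show ?thesis using mn(1) by blast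
    qed
  qed
  obtain P where P: "clinear P" "\<And>x. x \<in> ?M \<Longrightarrow> P x = x" "\<And>x. x \<in> ?N \<Longrightarrow> P x = 0"
    by (rule direct_sum_projection[of ?M ?N, OF complex_vector.subspace_span
          complex_vector.subspace_span height_parts_independent[of _ n] decomp]) auto
  show ?thesis
  proof (rule that[OF P(1)])
    show "P x = x" if "x \<in> height_part n" for x
      by (rule P(2)) (use that in \<open>simp add: complex_vector.span_base\<close>)
    show "P x = 0" if "m \<noteq> n" "x \<in> height_part m" for m x
      by (rule P(3)) (use that in \<open>auto intro: complex_vector.span_base\<close>)
  qed
qed

text \<open>The error terms of a coproduct computation: everything strictly higher in the first
  factor than the leading term.\<close>

definition above :: "int \<Rightarrow> ('u, 'u) tensor set"
  where "above n = cspan {x \<boxtimes> y | x y m. m > n \<and> x \<in> height_part m}"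

lemma above_subspace: "csubspace (above n)"
  unfolding above_def by (rule complex_vector.subspace_span)

lemma aboveI: "x \<in> height_part m \<Longrightarrow> m > n \<Longrightarrow> x \<boxtimes> y \<in> above n"
  unfolding above_def by (rule complex_vector.span_base) blast

lemma above_mono: "t \<in> above m \<Longrightarrow> n \<le> m \<Longrightarrow> t \<in> above n"
  unfolding above_def
  by (erule set_rev_mp, rule complex_vector.span_mono) (blast intro: less_le_trans order.strict_trans1)

lemma above_mult_left:
  assumes "x \<in> height_part m" "t \<in> above n" shows "tensor_mult (x \<boxtimes> y) t \<in> above (m + n)"
  by (rule clinear_span_image_subset[OF tensor_mult_linear_right above_subspace _
        assms(2)[unfolded above_def]])
    (auto intro!: aboveI height_part_mult[OF assms(1)])

lemma above_mult_right:
  assumes "x \<in> height_part m" "t \<in> above n" shows "tensor_mult t (x \<boxtimes> y) \<in> above (n + m)"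
  by (rule clinear_span_image_subset[OF tensor_mult_linear_left above_subspace _
        assms(2)[unfolded above_def]])
    (auto intro!: aboveI height_part_mult[OF _ assms(1)])

lemma above_mult:
  assumes "s \<in> above m" "t \<in> above n" shows "tensor_mult s t \<in> above (m + n)"
proof (rule clinear_span_image_subset[OF tensor_mult_linear_left above_subspace _
        assms(1)[unfolded above_def]])
  fix s :: "('u, 'u) tensor" assume "s \<in> {x \<boxtimes> y | x y k. k > m \<and> x \<in> height_part k}"
  then obtain x y k where s: "s = x \<boxtimes> y" "k > m" "x \<in> height_part k" by blast
  have "tensor_mult s t \<in> above (k + n)" unfolding s(1) by (rule above_mult_left[OF s(3) assms(2)])
  then show "tensor_mult s t \<in> above (m + n)" by (rule above_mono) (use s in simp)
qed

lemma above_add: "s \<in> above n \<Longrightarrow> t \<in> above n \<Longrightarrow> s + t \<in> above n"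
  by (rule complex_vector.subspace_add[OF above_subspace])

text \<open>In \<Delta>(F_i) the summand F_i \<otimes> 1 lowers the height of the first factor and
  the other keeps it, so the lowest term comes from choosing the former at every letter.\<close>

lemma comult_Fw: "\<Delta> (Fw v) - Fw v \<boxtimes> 1 \<in> above (- int (length v))"
proof (induction v)
  case Nil
  show ?case by (simp add: comult_one complex_vector.subspace_0[OF above_subspace])
next
  case (Cons i v)
  define D where "D = \<Delta> (Fw v) - Fw v \<boxtimes> 1"
  have \<Delta>: "\<Delta> (Fw v) = Fw v \<boxtimes> 1 + D" by (simp add: D_def)
  let ?n = "- int (length (i # v))"
  have "\<Delta> (Fw (i # v)) - Fw (i # v) \<boxtimes> 1
    = tensor_mult (F i \<boxtimes> 1) D + ((Kinv i * Fw v) \<boxtimes> F i + tensor_mult (Kinv i \<boxtimes> F i) D)"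
    by (simp add: comult_mult comult_F \<Delta> clinear_add[OF tensor_mult_linear_left]
        clinear_add[OF tensor_mult_linear_right])
  also have "\<dots> \<in> above ?n"
  proof (intro above_add)
    show "tensor_mult (F i \<boxtimes> 1) D \<in> above ?n"
      using above_mult_left[OF height_part_F[of i] Cons[folded D_def]] by (simp add: algebra_simps)
    show "(Kinv i * Fw v) \<boxtimes> F i \<in> above ?n"
      using aboveI[OF height_part_mult[OF height_part_Kinv height_part_Fw]] by simp
    show "tensor_mult (Kinv i \<boxtimes> F i) D \<in> above ?n"
      using above_mult_left[OF height_part_Kinv[of i] Cons[folded D_def]]
      by (rule above_mono) simp
  qed
  finally show ?case .
qed

text \<open>In \<Delta>(E_i) the summand 1 \<otimes> E_i keeps the height of the first factor and
  E_i \<otimes> K_i raises it, so the lowest term has height 0 whatever the length of w.\<close>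

lemma comult_Ew: "\<Delta> (Ew w) - 1 \<boxtimes> Ew w \<in> above 0"
proof (induction w)
  case Nil
  show ?case by (simp add: comult_one complex_vector.subspace_0[OF above_subspace])
next
  case (Cons i w)
  define D where "D = \<Delta> (Ew w) - 1 \<boxtimes> Ew w"
  have \<Delta>: "\<Delta> (Ew w) = 1 \<boxtimes> Ew w + D" by (simp add: D_def)
  have "\<Delta> (Ew (i # w)) - 1 \<boxtimes> Ew (i # w)
    = E i \<boxtimes> (K i * Ew w) + (tensor_mult (E i \<boxtimes> K i) D + tensor_mult (1 \<boxtimes> E i) D)"
    by (simp add: comult_mult comult_E \<Delta> clinear_add[OF tensor_mult_linear_left]
        clinear_add[OF tensor_mult_linear_right])
  also have "\<dots> \<in> above 0"
  proof (intro above_add)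
    show "E i \<boxtimes> (K i * Ew w) \<in> above 0" by (rule aboveI[OF height_part_E]) simp
    show "tensor_mult (E i \<boxtimes> K i) D \<in> above 0"
      using above_mult_left[OF height_part_E[of i] Cons[folded D_def]] by (rule above_mono) simp
    show "tensor_mult (1 \<boxtimes> E i) D \<in> above 0"
      using above_mult_left[OF height_part_one Cons[folded D_def]] by simp
  qed
  finally show ?case .
qed

lemma comult_monomial:
  "\<Delta> (Fw v * Kp \<nu> * Ew w) - (Fw v * Kp \<nu>) \<boxtimes> (Kp \<nu> * Ew w) \<in> above (- int (length v))"
proof -
  define D1 where "D1 = \<Delta> (Fw v) - Fw v \<boxtimes> 1"
  define D2 where "D2 = \<Delta> (Ew w) - 1 \<boxtimes> Ew w"
  have \<Delta>: "\<Delta> (Fw v) = Fw v \<boxtimes> 1 + D1" "\<Delta> (Ew w) = 1 \<boxtimes> Ew w + D2"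
    by (simp_all add: D1_def D2_def)
  let ?n = "- int (length v)"
  define D1' where "D1' = tensor_mult D1 (Kp \<nu> \<boxtimes> Kp \<nu>)"
  have D1': "D1' \<in> above ?n"
    using above_mult_right[OF height_part_Kp comult_Fw] by (simp add: D1'_def D1_def)
  have "\<Delta> (Fw v * Kp \<nu> * Ew w) - (Fw v * Kp \<nu>) \<boxtimes> (Kp \<nu> * Ew w)
    = tensor_mult D1' (1 \<boxtimes> Ew w) + (tensor_mult ((Fw v * Kp \<nu>) \<boxtimes> Kp \<nu>) D2 + tensor_mult D1' D2)"
    by (simp add: comult_mult comult_Kp \<Delta> clinear_add[OF tensor_mult_linear_left]
        clinear_add[OF tensor_mult_linear_right] D1'_def)
  also have "\<dots> \<in> above ?n"
  proof (intro above_add)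
    show "tensor_mult D1' (1 \<boxtimes> Ew w) \<in> above ?n"
      using above_mult_right[OF height_part_one D1'] by simp
    show "tensor_mult ((Fw v * Kp \<nu>) \<boxtimes> Kp \<nu>) D2 \<in> above ?n"
      using above_mult_left[OF height_part_Fw_Kp comult_Ew] by (simp add: D2_def)
    show "tensor_mult D1' D2 \<in> above ?n"
      using above_mult[OF D1' comult_Ew] by (simp add: D2_def)
  qed
  finally show ?thesis .
qed

section \<open>The Hopf center\<close>

definition lower_monomials :: "nat \<Rightarrow> 'u set"
  where "lower_monomials n = {Fw v * Kp \<nu> * Ew w | v \<nu> w. length v \<le> n}"

lemma center_height_part: "z \<in> algebra_center \<Longrightarrow> z \<in> height_part 0"
  by (rule height_part_0) (simp add: algebra_center_def)

text \<open>
  The component of \<open>\<Delta> z\<close> of lowest height in the first factor vanishes. In it a monomial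
  \<open>F\<^sub>v K\<^sub>\<nu> E\<^sub>w\<close> appears as \<open>F\<^sub>v K\<^sub>\<nu> \<otimes> K\<^sub>\<nu> E\<^sub>w\<close>; the map \<open>W\<close> recovers the monomial from this, using
  functionals that detect \<open>\<nu>\<close> to remove the doubled \<open>K\<^sub>\<nu>\<close>.
\<close>

lemma lower_monomials_reduce:
  assumes z: "z \<in> cspan (lower_monomials (Suc n))"
    and \<Delta>z: "\<Delta> z \<in> cspan {x \<boxtimes> y | x y. x \<in> algebra_center}"
  shows "z \<in> cspan (lower_monomials n)"
proof -
  obtain T r where T: "finite T" "T \<subseteq> lower_monomials (Suc n)" and zsum: "z = (\<Sum>x\<in>T. r x *\<^sub>C x)"
    using z unfolding complex_vector.span_explicit by auto
  have "\<forall>x\<in>T. \<exists>v \<nu> w. x = Fw v * Kp \<nu> * Ew w \<and> length v \<le> Suc n"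
    using T(2) by (auto simp: lower_monomials_def)
  from bchoice[OF this] obtain v where
    "\<forall>x\<in>T. \<exists>\<nu> w. x = Fw (v x) * Kp \<nu> * Ew w \<and> length (v x) \<le> Suc n" by blast
  from bchoice[OF this] obtain \<nu> where
    "\<forall>x\<in>T. \<exists>w. x = Fw (v x) * Kp (\<nu> x) * Ew w \<and> length (v x) \<le> Suc n" by blast
  from bchoice[OF this] obtain w where mon: "\<And>x. x \<in> T \<Longrightarrow> x = Fw (v x) * Kp (\<nu> x) * Ew (w x)"
    and len: "\<And>x. x \<in> T \<Longrightarrow> length (v x) \<le> Suc n"
    by blast
  define L where "L = \<nu> ` T"
  have finL: "finite L" using T(1) by (simp add: L_def)
  have "\<forall>\<mu>. \<exists>f. clinear f \<and> (\<forall>x i. f (x * E i) = 0) \<and> f (Kp \<mu>) = 1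
      \<and> (\<forall>\<eta>\<in>L - {\<mu>}. f (Kp \<eta>) = (0::complex))"
  proof
    fix \<mu>
    obtain f :: "'u \<Rightarrow> complex" where "clinear f" "\<And>x i. f (x * E i) = 0" "f (Kp \<mu>) = 1"
      "\<And>\<eta>. \<eta> \<in> L - {\<mu>} \<Longrightarrow> f (Kp \<eta>) = 0"
      using separating_functional[of "L - {\<mu>}" \<mu>] finL by blast
    then show "\<exists>f. clinear f \<and> (\<forall>x i. f (x * E i) = 0) \<and> f (Kp \<mu>) = 1
      \<and> (\<forall>\<eta>\<in>L - {\<mu>}. f (Kp \<eta>) = (0::complex))" by blast
  qed
  from choice[OF this] obtain f :: "('i \<Rightarrow> int) \<Rightarrow> 'u \<Rightarrow> complex" where
    "\<forall>\<mu>. clinear (f \<mu>) \<and> (\<forall>x i. f \<mu> (x * E i) = 0) \<and> f \<mu> (Kp \<mu>) = 1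
      \<and> (\<forall>\<eta>\<in>L - {\<mu>}. f \<mu> (Kp \<eta>) = (0::complex))" ..
  then have f: "\<And>\<mu>. clinear (f \<mu>)"
    "\<And>\<mu> x i. f \<mu> (x * E i) = 0" "\<And>\<mu>. f \<mu> (Kp \<mu>) = 1"
    "\<And>\<mu> \<eta>. \<eta> \<in> L \<Longrightarrow> \<eta> \<noteq> \<mu> \<Longrightarrow> f \<mu> (Kp \<eta>) = 0"
    by blast+
  define N where "N = - int (Suc n)"
  obtain P where P: "clinear P" "\<And>x. x \<in> height_part N \<Longrightarrow> P x = x"
    "\<And>m x. m \<noteq> N \<Longrightarrow> x \<in> height_part m \<Longrightarrow> P x = 0"
    using height_projection by blast
  \<comment> \<open>\<open>P\<close> keeps the lowest height in the first factor. On K_\<nu> E_w the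
    contraction with f_\<mu> is multiplication by 1 if \<mu> = \<nu> and by 0 otherwise, so a single
    inverse K_{-\<nu>} takes effect.\<close>
  define \<Psi> where "\<Psi> x y = (\<Sum>\<mu>\<in>L. P x * Kp (\<lambda>i. - \<mu> i) * contract_left (f \<mu>) y)" for x y
  have bil: "cbilinear \<Psi>"
  proof (rule cbilinearI)
    show "clinear (\<Psi> x)" for x
      unfolding \<Psi>_def
      by (intro clinear_compose_sum clinear_compose[OF clinear_mult_left contract_linear(1)[OF f(1)]])
    show "clinear (\<lambda>x. \<Psi> x y)" for y
      unfolding \<Psi>_def
      by (intro clinear_compose_sum clinear_compose[OF clinear_mult_right
            clinear_compose[OF clinear_mult_right P(1)]])
  qed
  note lin = clinear_tensor_lift[OF bil]
  define W where "W x = tensor_lift \<Psi> (\<Delta> x)" for x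
  have linW: "clinear W" unfolding W_def by (rule clinear_compose[OF lin linear_comult])
  have \<Psi>0: "\<Psi> x y = 0" if "m \<noteq> N" "x \<in> height_part m" for x y m
    using P(3)[OF that] by (simp add: \<Psi>_def)
  have lift0: "tensor_lift \<Psi> t = 0" if "t \<in> above N" for t
  proof (rule clinear_eq_on_span[OF lin clinear_const_zero _ that[unfolded above_def]])
    fix s :: "('u, 'u) tensor" assume "s \<in> {x \<boxtimes> y | x y m. m > N \<and> x \<in> height_part m}"
    then obtain x y m where "s = x \<boxtimes> y" "m > N" "x \<in> height_part m" by blast
    then show "tensor_lift \<Psi> s = 0" using \<Psi>0[of m x y] by (simp add: bil)
  qed
  \<comment> \<open>Central first factors have height 0, which differs from -(n+1).\<close>
  have "W z = 0"
    unfolding W_def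
    by (rule clinear_eq_on_span[OF lin clinear_const_zero _ \<Delta>z])
      (use \<Psi>0[OF _ center_height_part] in \<open>auto simp: bil N_def\<close>)
  moreover have "W x = (if length (v x) = Suc n then x else 0)" if x: "x \<in> T" for x
  proof -
    let ?a = "Fw (v x) * Kp (\<nu> x)" and ?b = "Kp (\<nu> x) * Ew (w x)"
    have "\<Delta> x - ?a \<boxtimes> ?b \<in> above (- int (length (v x)))"
      using comult_monomial[of "v x" "\<nu> x" "w x"] mon[OF x] by simp
    then have "\<Delta> x - ?a \<boxtimes> ?b \<in> above N"
      by (rule above_mono) (use len[OF x] in \<open>simp add: N_def\<close>)
    from lift0[OF this] have Wx: "W x = \<Psi> ?a ?b"
      by (simp add: W_def clinear_diff[OF lin] bil)
    show ?thesis
    proof (cases "length (v x) = Suc n")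
      case True
      then have Pa: "P ?a = ?a"
        using height_part_Fw_Kp[of "v x" "\<nu> x"] by (intro P(2)) (simp add: N_def)
      have "\<Psi> ?a ?b = (\<Sum>\<mu>\<in>L. if \<mu> = \<nu> x then x else 0)"
        unfolding \<Psi>_def
      proof (rule sum.cong[OF refl])
        fix \<mu> assume "\<mu> \<in> L"
        have L: "\<nu> x \<in> L" using x by (simp add: L_def)
        show "P ?a * Kp (\<lambda>i. - \<mu> i) * contract_left (f \<mu>) ?b = (if \<mu> = \<nu> x then x else 0)"
        proof (cases "\<mu> = \<nu> x")
          case True
          have "P ?a * Kp (\<lambda>i. - \<mu> i) * contract_left (f \<mu>) ?b
            = Fw (v x) * (Kp (\<nu> x) * Kp (\<lambda>i. - \<nu> x i)) * ?b"
            unfolding Pa contract_left_Kp_Ew[OF f(1,2)] using True f(3)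
            by (simp add: scaleC_one mult.assoc)
          then show ?thesis using True mon[OF x] by (simp only: Kp_minus) (simp add: mult.assoc)
        next
          case False
          then show ?thesis
            unfolding contract_left_Kp_Ew[OF f(1,2)] using f(4)[OF L, of \<mu>]
            by (simp add: scaleC_zero_left)
        qed
      qed
      also have "\<dots> = x" using finL x by (simp add: L_def)
      finally show ?thesis using Wx True by simp
    next
      case False
      then show ?thesis
        unfolding Wx using \<Psi>0[OF _ height_part_Fw_Kp] len[OF x] by (simp add: N_def)
    qed
  qed
  then have "W z = (\<Sum>x\<in>T. r x *\<^sub>C (if length (v x) = Suc n then x else 0))"
    unfolding zsum by (simp add: clinear_sum[OF linW] clinear_scale[OF linW])
  \<comment> \<open>The monomials with F-words of length n+1, taken with their coefficients, sum to
    W z = 0; subtracting this sum deletes them without any appeal to linear independence.\<close>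
  ultimately have "z = z - (\<Sum>x\<in>T. r x *\<^sub>C (if length (v x) = Suc n then x else 0))" by simp
  also have "\<dots> = (\<Sum>x\<in>T. r x *\<^sub>C (if length (v x) = Suc n then 0 else x))"
    unfolding zsum sum_subtractf[symmetric]
    by (rule sum.cong) (simp_all add: scaleC_zero_right)
  also have "\<dots> \<in> cspan (lower_monomials n)"
  proof (intro complex_vector.span_sum complex_vector.span_scale)
    fix x assume x: "x \<in> T"
    show "(if length (v x) = Suc n then 0 else x) \<in> cspan (lower_monomials n)"
    proof (cases "length (v x) = Suc n")
      case False
      then have "length (v x) \<le> n" using len[OF x] by simp
      then have "x \<in> lower_monomials n" unfolding lower_monomials_def using mon[OF x] by blast
      then show ?thesis using False by (simp add: complex_vector.span_base)
    qed (simp add: complex_vector.span_zero)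
  qed
  finally show ?thesis .
qed

text \<open>An element involves finitely many monomials, which bounds the length of its F-words; the
  reduction then descends to length 0.\<close>

lemma central_coefficients_in_lower_monomials_0:
  assumes \<Delta>z: "\<Delta> z \<in> cspan {x \<boxtimes> y | x y. x \<in> algebra_center}"
  shows "z \<in> cspan (lower_monomials 0)"
proof -
  have "\<exists>n. z \<in> cspan (lower_monomials n)"
    using span_monomials[of z]
  proof (induction rule: complex_vector.span_induct_alt)
    case (step c x y)
    obtain n where n: "y \<in> cspan (lower_monomials n)" using step by blast
    obtain v \<nu> w where x: "x = Fw v * Kp \<nu> * Ew w" using step by (auto simp: monomials_def)
    have "x \<in> lower_monomials (max n (length v))"
      unfolding lower_monomials_def using x max.cobounded2 by blast
    moreover have "lower_monomials n \<subseteq> lower_monomials (max n (length v))"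
      by (fastforce simp: lower_monomials_def)
    then have "y \<in> cspan (lower_monomials (max n (length v)))"
      using n complex_vector.span_mono by blast
    ultimately show ?case
      by (blast intro: complex_vector.span_add complex_vector.span_scale complex_vector.span_base)
  qed (blast intro: complex_vector.span_zero)
  then obtain n where "z \<in> cspan (lower_monomials n)" by blast
  then show ?thesis by (induction n) (use lower_monomials_reduce[OF _ \<Delta>z] in blast)+
qed

text \<open>Centrality gives (q^(\<nu>,\<alpha>_j) - 1) E_j K_\<nu> = 0, where K_\<nu> is invertible
  and E_j is nonzero.\<close>

lemma central_Kp:
  assumes "Kp \<nu> \<in> algebra_center" shows "\<nu> = (\<lambda>_. 0)"
proof -
  have "pairing \<nu> j = 0" for j
  proof (rule ccontr)
    assume "pairing \<nu> j \<noteq> 0"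
    then have "q powi pairing \<nu> j - 1 \<noteq> 0" using q_powi_eq_1_iff by simp
    moreover have "(q powi pairing \<nu> j - 1) *\<^sub>C (E j * Kp \<nu>) = 0"
      using assms Kp_E[of \<nu> j] by (simp add: algebra_center_def scaleC_diff_left scaleC_one)
    ultimately have "E j * Kp \<nu> = 0" by simp
    then have "E j * (Kp \<nu> * Kp (\<lambda>i. - \<nu> i)) = 0" by (simp only: mult.assoc[symmetric] mult_zero_left)
    then show False using E_nonzero by (simp add: Kp_minus)
  qed
  from pairing_eq_zero[OF this] show ?thesis by auto
qed

lemma central_coefficients_scalar:
  assumes z: "z \<in> algebra_center" and \<Delta>z: "\<Delta> z \<in> cspan {x \<boxtimes> y | x y. x \<in> algebra_center}"
  shows "\<exists>c. z = c *\<^sub>C 1"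
proof -
  obtain P where P: "clinear P" "\<And>x. x \<in> height_part 0 \<Longrightarrow> P x = x"
    "\<And>m x. m \<noteq> 0 \<Longrightarrow> x \<in> height_part m \<Longrightarrow> P x = 0"
    using height_projection by blast
  \<comment> \<open>z has height 0, so P z = z, while \<open>P\<close> kills each K_\<nu> E_w with w
    nonempty.\<close>
  have "P z \<in> cspan (range Kp)"
  proof (rule clinear_span_image_subset[OF P(1) complex_vector.subspace_span _
        central_coefficients_in_lower_monomials_0[OF \<Delta>z]])
    fix x assume "x \<in> lower_monomials 0"
    then obtain \<nu> w where x: "x = Kp \<nu> * Ew w" by (auto simp: lower_monomials_def)
    have h: "x \<in> height_part (int (length w))"
      using height_part_mult[OF height_part_Kp height_part_Ew] by (simp add: x)
    show "P x \<in> cspan (range Kp)"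
    proof (cases w)
      case Nil
      then show ?thesis using h P(2) by (simp add: x complex_vector.span_base)
    next
      case (Cons i w')
      then have "P x = 0" using h by (intro P(3)) auto
      then show ?thesis by (simp add: complex_vector.span_zero)
    qed
  qed
  then have "z \<in> cspan (range Kp)" using P(2)[OF center_height_part[OF z]] by simp
  then obtain T r where T: "finite T" "T \<subseteq> range Kp" and zsum: "z = (\<Sum>x\<in>T. r x *\<^sub>C x)"
    unfolding complex_vector.span_explicit by auto
  then have "\<forall>x\<in>T. \<exists>\<nu>. x = Kp \<nu>" by blast
  from bchoice[OF this] obtain \<nu> where \<nu>: "\<And>x. x \<in> T \<Longrightarrow> x = Kp (\<nu> x)" by blast
  have csub: "csubspace (algebra_center :: 'u set)"
    by (auto simp: algebra_center_def complex_vector.subspace_def distrib_left distrib_right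
        mult_scaleC_left mult_scaleC_right)
  have scalar: "x = 1" if x: "x \<in> T" "r x \<noteq> 0" for x
  proof -
    obtain f :: "'u \<Rightarrow> complex" where f: "clinear f" "f (Kp (\<nu> x)) = 1"
      "\<And>\<mu>. \<mu> \<in> \<nu> ` T - {\<nu> x} \<Longrightarrow> f (Kp \<mu>) = 0"
      by (rule separating_functional[of "\<nu> ` T - {\<nu> x}" "\<nu> x"]) (use T(1) in auto)
    note lin = clinear_tensor_lift[OF cbilinear_contract(2)[OF f(1)]]
    \<comment> \<open>Contracting the second factor leaves a combination of the central first
      factors; computed on the expansion of z, it isolates the single term at x.\<close>
    have "contract_right f z \<in> algebra_center"
      unfolding contract_right_def
      by (rule clinear_span_image_subset[OF lin csub _ \<Delta>z])
        (auto simp: cbilinear_contract[OF f(1)] intro: complex_vector.subspace_scale[OF csub])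
    also have "contract_right f z = (\<Sum>y\<in>T. if y = x then r x *\<^sub>C x else 0)"
      unfolding zsum clinear_sum[OF contract_linear(2)[OF f(1)]]
    proof (rule sum.cong[OF refl])
      fix y assume y: "y \<in> T"
      have "contract_right f (r y *\<^sub>C y) = (r y * f (Kp (\<nu> y))) *\<^sub>C y"
      proof -
        have "contract_right f (Kp \<mu>) = f (Kp \<mu>) *\<^sub>C Kp \<mu>" for \<mu>
          by (simp add: contract_right_def comult_Kp cbilinear_contract[OF f(1)])
        then have "contract_right f y = f (Kp (\<nu> y)) *\<^sub>C y" using \<nu>[OF y] by metis
        then show ?thesis
          by (simp only: clinear_scale[OF contract_linear(2)[OF f(1)]] scaleC_scaleC)
      qed
      moreover have "\<nu> y \<noteq> \<nu> x" if "y \<noteq> x" using that \<nu> x(1) y by metis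
      ultimately show "contract_right f (r y *\<^sub>C y) = (if y = x then r x *\<^sub>C x else 0)"
        using f(2,3) y by (auto simp: scaleC_zero_left)
    qed
    also have "\<dots> = r x *\<^sub>C x" using T(1) x(1) by simp
    finally have "inverse (r x) *\<^sub>C r x *\<^sub>C x \<in> algebra_center"
      by (rule complex_vector.subspace_scale[OF csub])
    then have "x \<in> algebra_center" using x(2) by (simp add: scaleC_scaleC scaleC_one)
    then have "\<nu> x = (\<lambda>_. 0)" using central_Kp \<nu>[OF x(1)] by metis
    then show "x = 1" using \<nu>[OF x(1)] Kp_zero by simp
  qed
  have "z = (\<Sum>x\<in>T. r x *\<^sub>C 1)"
    unfolding zsum by (rule sum.cong) (use scalar in \<open>auto simp: scaleC_zero_left\<close>)
  also have "\<dots> = (\<Sum>x\<in>T. r x) *\<^sub>C 1" by (simp add: complex_vector.scale_sum_left)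
  finally show ?thesis by blast
qed

lemma antipode_one: "S 1 = 1"
proof -
  have "cbilinear (\<lambda>a b. S a * b)"
    using linear_antipode
    by (intro cbilinearI clinear_mult_left clinear_compose[OF clinear_mult_right])
  then show ?thesis using antipode_left[of 1] by (simp add: comult_one counit_one scaleC_one)
qed

text \<open>The scalars are themselves a central Hopf subalgebra, so the greatest one exists as soon
  as every competitor is shown to consist of scalars.\<close>

lemma hopf_center_trivial: "hopf_center \<Delta> S = range (\<lambda>c. c *\<^sub>C 1)"
  unfolding hopf_center_def
proof (rule Greatest_equality)
  let ?C = "range (\<lambda>c. c *\<^sub>C (1 :: 'u))"
  have "csubspace ?C"
    using complex_vector.subspace_span[of "{1 :: 'u}"] by (simp add: complex_vector.span_singleton)
  moreover have "1 \<in> ?C" by (rule range_eqI[of _ _ 1]) (simp add: scaleC_one)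
  moreover have "\<Delta> x \<in> cspan {a \<boxtimes> b |a b. a \<in> ?C \<and> b \<in> ?C}" if "x \<in> ?C" for x
  proof -
    obtain c where "x = c *\<^sub>C 1" using \<open>x \<in> ?C\<close> by blast
    then have "\<Delta> x = c *\<^sub>C (1 \<boxtimes> 1)" by (simp add: clinear_scale[OF linear_comult] comult_one)
    then show ?thesis
      using \<open>1 \<in> ?C\<close> by (auto intro!: complex_vector.span_scale intro: complex_vector.span_base)
  qed
  moreover have "S x \<in> ?C" if "x \<in> ?C" for x
    using that by (auto simp: clinear_scale[OF linear_antipode] antipode_one)
  ultimately have "hopf_subalgebra \<Delta> S ?C"
    unfolding hopf_subalgebra_def by (auto simp: scaleC_algebra_simps)
  moreover have "?C \<subseteq> algebra_center"
    by (auto simp: algebra_center_def mult_scaleC_left mult_scaleC_right)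
  ultimately show "hopf_subalgebra \<Delta> S ?C \<and> ?C \<subseteq> algebra_center" ..
next
  fix H assume H: "hopf_subalgebra \<Delta> S H \<and> H \<subseteq> algebra_center"
  show "H \<le> range (\<lambda>c. c *\<^sub>C (1 :: 'u))"
  proof
    fix z assume z: "z \<in> H"
    have "\<Delta> z \<in> cspan {a \<boxtimes> b |a b. a \<in> H \<and> b \<in> H}" using H z by (simp add: hopf_subalgebra_def)
    moreover have "{a \<boxtimes> b |a b. a \<in> H \<and> b \<in> H} \<subseteq> {x \<boxtimes> y | x y. x \<in> algebra_center}"
      using H by blast
    ultimately have "\<Delta> z \<in> cspan {x \<boxtimes> y | x y. x \<in> algebra_center}"
      using complex_vector.span_mono by blast
    then show "z \<in> range (\<lambda>c. c *\<^sub>C 1)" using central_coefficients_scalar H z by blast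
  qed
qed

end

theorem proposition6p1:
  fixes br :: "'g::complex_vector \<Rightarrow> 'g \<Rightarrow> 'g" and \<hh> :: "'g set"
    and \<alpha> :: "'i::finite \<Rightarrow> 'g \<Rightarrow> complex" and B :: "'g \<Rightarrow> 'g \<Rightarrow> complex"
    and a :: "'i \<Rightarrow> 'i \<Rightarrow> int" and d :: "'i \<Rightarrow> nat"
    and q :: complex
    and E F K Kinv :: "'i \<Rightarrow> 'u::complex_algebra_1"
    and \<Delta> :: "'u \<Rightarrow> ('u, 'u) tensor" and \<epsilon> :: "'u \<Rightarrow> complex" and S :: "'u \<Rightarrow> 'u"
  assumes "simple_lie_algebra br" and "cartan_subalgebra br \<hh>" and "simple_roots br \<hh> \<alpha>"
    and "normalized_invariant_form br \<hh> B"
    and "\<And>i j. of_int (a i j) =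
      2 * dual_form \<hh> B (\<alpha> i) (\<alpha> j) / dual_form \<hh> B (\<alpha> i) (\<alpha> i)"
    and "\<And>i. of_nat (d i) = dual_form \<hh> B (\<alpha> i) (\<alpha> i) / 2"
    and "q \<noteq> 0" and "\<And>n::nat. n > 0 \<Longrightarrow> q ^ n \<noteq> 1"
    and "quantized_enveloping_algebra q d a E F K Kinv"
    and "hopf_algebra \<Delta> \<epsilon> S"
    and "\<And>i. \<Delta> (K i) = K i \<boxtimes> K i"
    and "\<And>i. \<Delta> (E i) = E i \<boxtimes> K i + 1 \<boxtimes> E i"
    and "\<And>i. \<Delta> (F i) = F i \<boxtimes> 1 + Kinv i \<boxtimes> F i"
  shows "hopf_center \<Delta> S = range (\<lambda>c::complex. c *\<^sub>C (1::'u))"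
proof -
  interpret R: root_data br \<hh> \<alpha> B by unfold_locales fact+
  \<comment> \<open>This identity carries symmetry and nondegeneracy from the dual form over to the
    integer matrix. Cancelling (\<alpha>_i, \<alpha>_i) is allowed because root lengths are at least
    2.\<close>
  have d_dual: "of_nat (d i) * complex_of_int (a i j) = dual_form \<hh> B (\<alpha> i) (\<alpha> j)" for i j
  proof -
    obtain r where "r \<ge> 2" "dual_form \<hh> B (\<alpha> i) (\<alpha> i) = complex_of_real r"
      using R.root_length[OF R.simple_root] .
    then have "dual_form \<hh> B (\<alpha> i) (\<alpha> i) \<noteq> 0" by auto
    then show ?thesis unfolding assms(5)[of i j] assms(6)[of i] by simp
  qed
  have "quantum_data q d a"
  proof
    show "q \<noteq> 0" by fact
    show "q ^ n \<noteq> 1" if "n > 0" for n using assms(8) that .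
    fix i
    obtain r where r: "r \<ge> 2" "dual_form \<hh> B (\<alpha> i) (\<alpha> i) = complex_of_real r"
      using R.root_length[OF R.simple_root] .
    have "d i \<noteq> 0"
    proof
      assume "d i = 0"
      then have "complex_of_real r = 0" using assms(6)[of i] r by simp
      then show False using r by simp
    qed
    then show "d i > 0" by simp
    have "complex_of_int (a i i) = 2" using assms(5)[of i i] r by simp
    then show "a i i = 2" using of_int_eq_iff[of "a i i" 2, where ?'a = complex] by simp
  next
    fix i j :: 'i
    show "a i j \<le> 0" if "i \<noteq> j" by (rule R.cartan_integer_nonpos[OF that assms(5)])
    have "complex_of_int (int (d i) * a i j) = complex_of_int (int (d j) * a j i)"
      using R.dual_form_sym[of "\<alpha> i" "\<alpha> j"] by (simp add: d_dual)
    then show "int (d i) * a i j = int (d j) * a j i" by (simp only: of_int_eq_iff)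
  next
    fix c :: "'i \<Rightarrow> int" and j
    assume *: "\<And>i. (\<Sum>j\<in>UNIV. c j * (int (d i) * a i j)) = 0"
    have "(\<Sum>j\<in>UNIV. complex_of_int (c j) * dual_form \<hh> B (\<alpha> i) (\<alpha> j)) = 0" for i
      using arg_cong[OF *[of i], of complex_of_int] by (simp add: d_dual)
    from R.gram_nondegenerate[OF this] show "c j = 0" by simp
  qed
  then interpret quantum_hopf q d a \<Delta> \<epsilon> S E F K Kinv
    using assms(9-13) by (simp add: quantum_hopf_def quantum_hopf_axioms_def)
  show ?thesis by (rule hopf_center_trivial)
qed

end
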